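(* Let $k$ be a $\sigma\delta$-field of characteristic $0$ with $D_k=C_k$, let $A\in GL_m(k)$, and let $L=k\langle X,\det(X)^{-1}\rangle$, where $X$ is an $m\times m$ matrix of differential indeterminates over $k$ and $\sigma$ is extended to $L$ by $\sigma(X)=AX$ and commutativity with $\delta$. Let $\mathbb{H}$ be the Galois group $Aut_{\sigma\delta}(kC_L\langle X\rangle/kC_L)$, regarded as a linear differential group, and for $n\in\mathbb{N}$ let $\mathbb{H}_n$ be the Galois group $Aut_\sigma(F_nC_L/kC_L)$, regarded as a linear algebraic group, of the difference system $$\sigma(X^{(j)})=\sum_{i=0}^{j}\binom{j}{i}A^{(i)}X^{(j-i)},\qquad j=0,1,\dots,n$$ (precise definitions in the context). For $B\in GL_m$ let $$B_{[n]}=\begin{pmatrix} B&0&\cdots&0\\ B'&B&\cdots&0\\ \vdots&\vdots&\ddots&\vdots\\ B^{(n)}&\cdots& &B\end{pmatrix},$$ the block lower triangular matrix whose $(i,j)$ block ($0\le j\le i\le n$) is $\binom{i}{j}B^{(i-j)}$. Then $\mathbb{H}$ is defined by $$B\in\mathbb{H}\iff \forall n\in\mathbb{N}\ \ B_{[n]}\in\mathbb{H}_n,$$ and there exists $n_0\in\mathbb{N}$ such that, for all $B$, $$B\in\mathbb{H}\iff \forall n\in\{0,\dots,n_0\}\ \ B_{[n]}\in\mathbb{H}_n.$$ Furthermore, for every $n$ the embedding $$i_n:\mathbb{H}\hookrightarrow\mathbb{H}_n,\qquad B\mapsto(B,B',\dots,B^{(n)})$$ (where $(B,\dots,B^{(n)})$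 stands for $B_{[n]}$) has Zariski dense image.
   Context: A $\sigma\delta$-field is a field with an automorphism $\sigma$ and a derivation $\delta$ with $\sigma\delta=\delta\sigma$. For a field $F$ with automorphism $\sigma$, $C_F=\{x\in F:\sigma(x)=x\}$ and $D_F$ is the relative algebraic closure of $C_F$ in $F$. $F\{a\}$ and $F\langle a\rangle$ denote the $\delta$-differential ring and field generated over $F$ by $a$; so $L=k(X,X',X'',\dots)$ with all entries of $X,X',\dots$ algebraically independent over $k$. $kC_L$ is the subfield of $L$ generated by $k$ and $C_L$. $Aut_{\sigma\delta}(E/F)$ (resp. $Aut_\sigma(E/F)$) is the group of automorphisms of $E$ fixing $F$ pointwise and commuting with $\sigma,\delta$ (resp. $\sigma$). $K_n=k(X,X',\dots,X^{(n)})$, $F_n=kC_{K_n}[X,\det(X)^{-1},X',\dots,X^{(n)}]$, so $F_nC_L=kC_L[X,\det(X)^{-1},X',\dots,X^{(n)}]\subset L$. The group $\mathbb{H}$: let $I_\delta\subset kC_L\{Y\}$ ($Y$ an $m\times m$ matrix of differential indeterminates) be the ideal of differential polynomials over $kC_L$ vanishing at $X$. $\mathbb{H}$ is the linear differential subgroup of $GL_m$ over $kC_L$ consisting of the $B$ such that the $\delta$-automorphism $Y\mapsto YB$ leaves $I_\delta$ (extended to the field over which $B$ is taken) invariant; $\mathbb{H}(C_L)$ is identified with $Aut_{\sigma\delta}(kC_L\langle X\rangle/kC_L)$ via $g\mapsto X^{-1}g(X)$. The group $\mathbb{H}_n$: the difference system above has the fundamental matrix $\mathcal{X}=X_{[n]}\in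 GL_{m(n+1)}(F_n)$, the block lower triangular matrix with $(i,j)$ block $\binom{i}{j}X^{(i-j)}$ for $0\le j\le i\le n$. $\mathbb{H}_n$ is the algebraic subgroup of $GL_{m(n+1)}$ over $kC_L$ consisting of the matrices $M$ such that $Z\mapsto ZM$ leaves invariant the ideal of polynomials over $kC_L$ in an $m(n+1)\times m(n+1)$ matrix $Z$ of indeterminates that vanish at $\mathcal{X}$; $\mathbb{H}_n(C_L)$ is identified with $Aut_\sigma(F_nC_L/kC_L)$ via $g\mapsto\mathcal{X}^{-1}g(\mathcal{X})$. The groups $\mathbb{H}$ and $\mathbb{H}_n$ are understood as (differential) algebraic groups, i.e. via their points in a differentially closed $\delta$-field $U\supseteq kC_L$; membership $B\in\mathbb{H}$ is for $B\in GL_m(U)$, and Zariski density of the image means density of $i_n(\mathbb{H}(U))$ in $\mathbb{H}_n(U)$. *)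

theory Defs
  imports
    "Jordan_Normal_Form.Determinant"
    "HOL-Library.Poly_Mapping"
    "HOL-Algebra.Ring"
begin

section \<open>Fields with an automorphism and a derivation\<close>

definition is_subfield :: "'a::field set \<Rightarrow> bool" where
  "is_subfield F \<longleftrightarrow> 0 \<in> F \<and> 1 \<in> F \<and>
     (\<forall>x\<in>F. \<forall>y\<in>F. x + y \<in> F \<and> x * y \<in> F) \<and> (\<forall>x\<in>F. - x \<in> F \<and> inverse x \<in> F)"

definition is_automorphism :: "('a::field \<Rightarrow> 'a) \<Rightarrow> bool" where
  "is_automorphism \<sigma> \<longleftrightarrow> bij \<sigma> \<and> \<sigma> 1 = 1 \<and>
     (\<forall>x y. \<sigma> (x + y) = \<sigma> x + \<sigma> y \<and> \<sigma> (x * y) = \<sigma> x * \<sigma> y)"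

definition is_derivation :: "('a::field \<Rightarrow> 'a) \<Rightarrow> bool" where
  "is_derivation \<delta> \<longleftrightarrow> (\<forall>x y. \<delta> (x + y) = \<delta> x + \<delta> y \<and> \<delta> (x * y) = \<delta> x * y + x * \<delta> y)"

definition fixed_field :: "('a \<Rightarrow> 'a) \<Rightarrow> 'a set \<Rightarrow> 'a set" where
  "fixed_field \<sigma> F = {x \<in> F. \<sigma> x = x}"

definition rel_alg_closure :: "'a::field set \<Rightarrow> 'a set \<Rightarrow> 'a set" where
  "rel_alg_closure C F =
     {x \<in> F. \<exists>p. p \<noteq> 0 \<and> (\<forall>i. Polynomial.coeff p i \<in> C) \<and> poly p x = 0}"

definition GL :: "nat \<Rightarrow> 'a::field mat set" where
  "GL N = {B \<in> carrier_mat N N. invertible_mat B}"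

definition GL_over :: "nat \<Rightarrow> 'a::field set \<Rightarrow> 'a mat set" where
  "GL_over N F = {B \<in> GL N. elements_mat B \<subseteq> F}"


section \<open>Polynomials and differential polynomials\<close>

text \<open>Polynomials with coefficients in \<open>'a\<close> and indeterminates indexed by \<open>'v\<close>.\<close>
type_synonym ('v, 'a) mpol = "('v \<Rightarrow>\<^sub>0 nat) \<Rightarrow>\<^sub>0 'a"

definition Const :: "'a::zero \<Rightarrow> ('v, 'a) mpol" where
  "Const c = Poly_Mapping.single 0 c"

definition Var :: "'v \<Rightarrow> ('v, 'a::zero_neq_one) mpol" where
  "Var v = Poly_Mapping.single (Poly_Mapping.single v 1) 1"

text \<open>Evaluation at the point \<open>x\<close>, with \<open>h\<close> applied to the coefficients.\<close>
definition eval_pol :: "('a::zero \<Rightarrow> 'b::comm_semiring_1) \<Rightarrow> ('v \<Rightarrow> 'b) \<Rightarrow> ('v, 'a) mpol \<Rightarrow> 'b" where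
  "eval_pol h x P = (\<Sum>t\<in>Poly_Mapping.keys P.
     h (Poly_Mapping.lookup P t) * (\<Prod>v\<in>Poly_Mapping.keys t. x v ^ Poly_Mapping.lookup t v))"

text \<open>The polynomials with coefficients in \<open>F\<close> that involve only indeterminates from \<open>V\<close>.\<close>
definition pol_over :: "'a::zero set \<Rightarrow> 'v set \<Rightarrow> ('v, 'a) mpol set" where
  "pol_over F V = {P. range (Poly_Mapping.lookup P) \<subseteq> F \<and>
     (\<forall>t\<in>Poly_Mapping.keys P. Poly_Mapping.keys t \<subseteq> V)}"

definition vanishing_ideal :: "'a::comm_ring_1 set \<Rightarrow> 'v set \<Rightarrow> ('v \<Rightarrow> 'a) \<Rightarrow> ('v, 'a) mpol set" where
  "vanishing_ideal F V x = {P \<in> pol_over F V. eval_pol id x P = 0}"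

text \<open>The ideal of the subring \<open>R\<close> generated by \<open>S\<close>.\<close>
definition ideal_generated :: "'r::comm_ring_1 set \<Rightarrow> 'r set \<Rightarrow> 'r set" where
  "ideal_generated R S =
     {(\<Sum>p\<in>T. c p * p) | T c. finite T \<and> T \<subseteq> S \<and> (\<forall>p\<in>T. c p \<in> R)}"

text \<open>Extension of an ideal of polynomials in \<open>V\<close> along the embedding \<open>\<iota>\<close> of the coefficients.\<close>
definition extend_ideal ::
    "('a::comm_ring_1 \<Rightarrow> 'b::comm_ring_1) \<Rightarrow> 'v set \<Rightarrow> ('v, 'a) mpol set \<Rightarrow> ('v, 'b) mpol set" where
  "extend_ideal \<iota> V I = ideal_generated (pol_over UNIV V) (Poly_Mapping.map \<iota> ` I)"

text \<open>
  In a differential polynomial ring the indeterminate \<open>(l, v)\<close> is the \<open>l\<close>-th derivative of the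
  differential indeterminate \<open>v\<close>. The first sum below differentiates the coefficients; in the second
  one, the derivation is applied to a factor \<open>(l, v)\<close> of the monomial \<open>t\<close>.
\<close>
definition dpol_deriv ::
    "('a::comm_ring_1 \<Rightarrow> 'a) \<Rightarrow> (nat \<times> 'v, 'a) mpol \<Rightarrow> (nat \<times> 'v, 'a) mpol" where
  "dpol_deriv \<delta> P =
     (\<Sum>t\<in>Poly_Mapping.keys P. Poly_Mapping.single t (\<delta> (Poly_Mapping.lookup P t))) +
     (\<Sum>t\<in>Poly_Mapping.keys P. \<Sum>(l, v)\<in>Poly_Mapping.keys t.
        Poly_Mapping.single
          (t - Poly_Mapping.single (l, v) 1 + Poly_Mapping.single (Suc l, v) 1)
          (of_nat (Poly_Mapping.lookup t (l, v)) * Poly_Mapping.lookup P t))"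

text \<open>The point at which a differential polynomial is evaluated when \<open>y v\<close> is substituted for \<open>v\<close>.\<close>
definition jet :: "('a \<Rightarrow> 'a) \<Rightarrow> ('v \<Rightarrow> 'a) \<Rightarrow> nat \<times> 'v \<Rightarrow> 'a" where
  "jet \<delta> y = (\<lambda>(l, v). (\<delta> ^^ l) (y v))"


section \<open>Differentially closed fields\<close>

definition is_delta_field :: "'e ring \<Rightarrow> ('e \<Rightarrow> 'e) \<Rightarrow> bool" where
  "is_delta_field E D \<longleftrightarrow> field E \<and> D \<in> carrier E \<rightarrow> carrier E \<and>
     (\<forall>a\<in>carrier E. \<forall>b\<in>carrier E.
        D (a \<oplus>\<^bsub>E\<^esub> b) = D a \<oplus>\<^bsub>E\<^esub> D b \<and>
        D (a \<otimes>\<^bsub>E\<^esub> b) = (D a \<otimes>\<^bsub>E\<^esub> b) \<oplus>\<^bsub>E\<^esub> (a \<otimes>\<^bsub>E\<^esub> D b))"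

text \<open>
  A field \<open>U\<close> is differentially closed if every finite system of differential equations
  \<open>f = 0\<close> (\<open>f \<in> S\<close>) and a differential inequation \<open>g \<noteq> 0\<close> over \<open>U\<close>, in finitely many unknowns, that
  has a solution in some differential field extension \<open>E\<close> of \<open>U\<close> has a solution in \<open>U\<close>.

  An extension \<open>E\<close> of \<open>U\<close> together with a point with coordinates in \<open>E\<close> is the same as a
  differential ring homomorphism \<open>\<psi>\<close> from the differential polynomial ring over \<open>U\<close> to \<open>E\<close>:
  the embedding of \<open>U\<close> is the restriction of \<open>\<psi>\<close> to the constant polynomials, the coordinates are
  the images of the unknowns, and \<open>\<psi>\<close> is the evaluation at the point.

  The type chosen for the elements of \<open>E\<close> is no restriction: if there is a solution in some
  extension, there is one in the differential subfield generated by \<open>U\<close> and the solution. The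
  elements of this subfield are quotients of values of differential polynomials, so
  each of them can be represented by the set of pairs (numerator, denominator) yielding it.
  The unknowns are indexed by \<open>nat\<close>; since \<open>S\<close> is finite, only finitely many of them matter.
\<close>
type_synonym 'u ext_elem = "((nat \<times> nat, 'u) mpol \<times> (nat \<times> nat, 'u) mpol) set"

definition differentially_closed :: "('u::field \<Rightarrow> 'u) \<Rightarrow> bool" where
  "differentially_closed \<delta> \<longleftrightarrow>
     (\<forall>(S :: (nat \<times> nat, 'u) mpol set) g. finite S \<longrightarrow>
        (\<exists>(E :: 'u ext_elem ring) D \<psi>. is_delta_field E D \<and>
            \<psi> \<in> ring_hom \<lparr>carrier = UNIV, mult = (*), one = 1, zero = 0, add = (+)\<rparr> E \<and>
            (\<forall>P. \<psi> (dpol_deriv \<delta> P) = D (\<psi> P)) \<and>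
            (\<forall>f\<in>S. \<psi> f = \<zero>\<^bsub>E\<^esub>) \<and> \<psi> g \<noteq> \<zero>\<^bsub>E\<^esub>) \<longrightarrow>
        (\<exists>y :: nat \<Rightarrow> 'u. (\<forall>f\<in>S. eval_pol id (jet \<delta> y) f = 0) \<and> eval_pol id (jet \<delta> y) g \<noteq> 0))"

text \<open>\<open>\<iota>\<close> embeds the differential subfield \<open>K\<close> into the field with derivation \<open>\<delta>'\<close>.\<close>
definition is_delta_embedding ::
    "'a::field set \<Rightarrow> ('a \<Rightarrow> 'a) \<Rightarrow> ('b::field \<Rightarrow> 'b) \<Rightarrow> ('a \<Rightarrow> 'b) \<Rightarrow> bool" where
  "is_delta_embedding K \<delta> \<delta>' \<iota> \<longleftrightarrow> \<iota> 1 = 1 \<and>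
     (\<forall>x\<in>K. \<forall>y\<in>K. \<iota> (x + y) = \<iota> x + \<iota> y \<and> \<iota> (x * y) = \<iota> x * \<iota> y) \<and>
     (\<forall>x\<in>K. \<iota> (\<delta> x) = \<delta>' (\<iota> x))"


section \<open>The differential field of the generic matrix\<close>

definition dmat_vars :: "nat \<Rightarrow> (nat \<times> nat \<times> nat) set" where
  "dmat_vars m = {(l, i, j). i < m \<and> j < m}"

definition mat_vars :: "nat \<Rightarrow> (nat \<times> nat) set" where
  "mat_vars N = {(i, j). i < N \<and> j < N}"

text \<open>The entries of \<open>X\<close> are differential indeterminates over \<open>k\<close>.\<close>
definition delta_generic :: "('a::field \<Rightarrow> 'a) \<Rightarrow> 'a set \<Rightarrow> nat \<Rightarrow> 'a mat \<Rightarrow> bool" where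
  "delta_generic \<delta> k m X \<longleftrightarrow> vanishing_ideal k (dmat_vars m) (jet \<delta> (($$) X)) = {0}"

text \<open>The differential field generated over \<open>k\<close> by the entries of \<open>X\<close>.\<close>
definition delta_field_generated :: "('a::field \<Rightarrow> 'a) \<Rightarrow> 'a set \<Rightarrow> 'a mat \<Rightarrow> 'a set" where
  "delta_field_generated \<delta> k X = is_subfield hull (k \<union> (\<Union>l. (\<delta> ^^ l) ` elements_mat X))"

definition kC :: "('a::field \<Rightarrow> 'a) \<Rightarrow> 'a set \<Rightarrow> 'a set" where
  "kC \<sigma> k = is_subfield hull (k \<union> fixed_field \<sigma> UNIV)"


section \<open>The Galois groups\<close>

text \<open>
  The matrix \<open>B\<^bsub>[n]\<^esub>\<close> for a square matrix \<open>B\<close> of size \<open>m\<close>: the row (column) with number \<open>i * m + a\<close>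
  is row (column) \<open>a\<close> of the \<open>i\<close>-th block row (column).
\<close>
definition prolong :: "('a::field \<Rightarrow> 'a) \<Rightarrow> nat \<Rightarrow> 'a mat \<Rightarrow> 'a mat" where
  "prolong \<delta> n B = (let m = dim_row B in
     mat (m * (n + 1)) (m * (n + 1)) (\<lambda>(r, c).
       let i = r div m; j = c div m in
       if j \<le> i then of_nat (i choose j) * (\<delta> ^^ (i - j)) (B $$ (r mod m, c mod m)) else 0))"

text \<open>The differential substitution \<open>Y \<mapsto> Y B\<close> for a matrix \<open>Y\<close> of differential indeterminates.\<close>
definition dsubst :: "('a::field \<Rightarrow> 'a) \<Rightarrow> nat \<Rightarrow> 'a mat \<Rightarrow>
    (nat \<times> nat \<times> nat, 'a) mpol \<Rightarrow> (nat \<times> nat \<times> nat, 'a) mpol" where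
  "dsubst \<delta> m B = eval_pol Const (\<lambda>(l, i, j).
     (dpol_deriv \<delta> ^^ l) ((mat m m (\<lambda>(i, j). Var (0, i, j)) * map_mat Const B) $$ (i, j)))"

text \<open>The substitution \<open>Z \<mapsto> Z M\<close> for a matrix \<open>Z\<close> of indeterminates.\<close>
definition msubst :: "nat \<Rightarrow> 'a::field mat \<Rightarrow> (nat \<times> nat, 'a) mpol \<Rightarrow> (nat \<times> nat, 'a) mpol" where
  "msubst N M = eval_pol Const (\<lambda>(i, j). (mat N N Var * map_mat Const M) $$ (i, j))"

text \<open>
  \<open>\<H>(U)\<close> and \<open>\<H>\<^sub>n(U)\<close>, where \<open>K = k C\<^sub>L\<close>, the derivation of \<open>U\<close> is \<open>\<delta>U\<close>, and \<open>\<iota>\<close> is the embedding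
  of \<open>K\<close> into \<open>U\<close>.
\<close>
definition delta_Galois_group :: "('a::field \<Rightarrow> 'a) \<Rightarrow> 'a set \<Rightarrow> nat \<Rightarrow> 'a mat \<Rightarrow>
    ('u::field \<Rightarrow> 'u) \<Rightarrow> ('a \<Rightarrow> 'u) \<Rightarrow> 'u mat set" where
  "delta_Galois_group \<delta> K m X \<delta>U \<iota> =
     (let V = dmat_vars m; I = extend_ideal \<iota> V (vanishing_ideal K V (jet \<delta> (($$) X)))
      in {B \<in> GL m. dsubst \<delta>U m B ` I = I})"

definition Galois_group :: "('a::field \<Rightarrow> 'a) \<Rightarrow> 'a set \<Rightarrow> nat \<Rightarrow> 'a mat \<Rightarrow>
    ('a \<Rightarrow> 'u::field) \<Rightarrow> nat \<Rightarrow> 'u mat set" where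
  "Galois_group \<delta> K m X \<iota> n =
     (let N = m * (n + 1); V = mat_vars N;
          I = extend_ideal \<iota> V (vanishing_ideal K V (($$) (prolong \<delta> n X)))
      in {M \<in> GL N. msubst N M ` I = I})"


section \<open>Zariski density\<close>

definition zariski_closure :: "nat \<Rightarrow> 'u::field mat set \<Rightarrow> 'u mat set" where
  "zariski_closure N S = {M \<in> GL N. \<forall>P \<in> pol_over UNIV (mat_vars N).
     (\<forall>M'\<in>S. eval_pol id (($$) M') P = 0) \<longrightarrow> eval_pol id (($$) M) P = 0}"

definition zariski_dense_in :: "nat \<Rightarrow> 'u::field mat set \<Rightarrow> 'u mat set \<Rightarrow> bool" where
  "zariski_dense_in N S G \<longleftrightarrow> S \<subseteq> G \<and> G \<subseteq> zariski_closure N S"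

end

theory Submission
  imports Defs "HOL-Library.Nat_Bijection"
begin

text \<open>
  Let \<open>T = X\<^sup>-\<^sup>1 Y\<close> in \<open>L \<otimes>\<^sub>K K{X}\<close>, the quotient of \<open>L{Y}\<close> by the extension of \<open>I\<^sub>\<delta>\<close>, where \<open>K = k C\<^sub>L\<close>. It is
  fixed by \<open>\<sigma>\<close>, so by descent the ideal of its relations over \<open>L\<close> is generated by the relations \<open>J\<^sub>\<delta>\<close> over
  \<open>C\<^sub>L\<close>, and a point over \<open>U\<close> lies in \<open>\<H>\<close> iff it satisfies \<open>J\<^sub>\<delta>\<close>. In the same way \<open>\<H>\<^sub>n\<close> is defined by the
  ideal \<open>J\<^sub>n\<close> of the relations of \<open>T\<^bsub>[n]\<^esub>\<close>, and \<open>p \<in> J\<^sub>n\<close> iff \<open>p(Y\<^bsub>[n]\<^esub>) \<in> J\<^sub>\<delta>\<close>.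
  By the basis theorem of Ritt and Raudenbush finitely many elements of \<open>J\<^sub>\<delta>\<close> define \<open>\<H>\<close>, which bounds the
  order. If \<open>P\<close> vanishes on the image of \<open>\<H>\<close>, then by the differential Nullstellensatz some power of
  \<open>det(Y\<^bsub>[n]\<^esub>) P(Y\<^bsub>[n]\<^esub>)\<close> lies in the extension of \<open>J\<^sub>\<delta>\<close> to \<open>U\<close>; hence that power of \<open>det(Z) P(Z)\<close> lies in the
  extension of \<open>J\<^sub>n\<close>, and \<open>P\<close> vanishes on \<open>\<H>\<^sub>n\<close>.
\<close>

section \<open>Subrings and homomorphisms\<close>

text \<open>Two features of the definitions shape the proof. The groups require an ideal to be
  mapped onto itself, while equations for a matrix express only that it is mapped into itself.
  Polynomials of bounded degree form finite dimensional spaces stable under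
  \<open>Z \<mapsto> Z M\<close>, and this closes the gap; for differential polynomials the question
  is therefore referred back to each order \<open>n\<close>. Moreover \<open>L\<close> and
  \<open>U\<close> are unrelated extensions of \<open>K\<close>: a relation over \<open>L\<close>
  has no meaning in \<open>U\<close>, whereas one over \<open>C_L\<close> has, through
  \<open>\<iota>\<close>. This is what descent is for, and since \<open>C_L\<close> is stable under
  the derivation, the relations stay a differential ideal after extension to \<open>U\<close>. The
  ring \<open>L \<otimes>\<^sub>K U\<close>, in which both kinds of points would live, is never
  built; \<open>K\<close>-linear functionals from \<open>U\<close> to \<open>K\<close> detect what
  happens in it and also decide membership in extended ideals. Characteristic 0 is used where
  separants and radicals of differential ideals force a division by positive integers.\<close>

definition is_subring :: "'a::comm_ring_1 set \<Rightarrow> bool" where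
  "is_subring F \<longleftrightarrow> 0 \<in> F \<and> 1 \<in> F \<and> (\<forall>x\<in>F. \<forall>y\<in>F. x + y \<in> F \<and> x * y \<in> F) \<and> (\<forall>x\<in>F. - x \<in> F)"

lemma is_subringD:
  assumes "is_subring F"
  shows "0 \<in> F" "1 \<in> F" "x \<in> F \<Longrightarrow> y \<in> F \<Longrightarrow> x + y \<in> F" "x \<in> F \<Longrightarrow> y \<in> F \<Longrightarrow> x * y \<in> F"
    "x \<in> F \<Longrightarrow> - x \<in> F" "x \<in> F \<Longrightarrow> y \<in> F \<Longrightarrow> x - y \<in> F"
  using assms unfolding is_subring_def by (auto, metis add_uminus_conv_diff)

lemma is_subring_UNIV [simp]: "is_subring UNIV"
  by (simp add: is_subring_def)

lemma is_subring_sum: "is_subring F \<Longrightarrow> (\<And>i. i \<in> A \<Longrightarrow> f i \<in> F) \<Longrightarrow> sum f A \<in> F"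
  by (induction A rule: infinite_finite_induct) (auto simp: is_subringD)

lemma is_subring_prod: "is_subring F \<Longrightarrow> (\<And>i. i \<in> A \<Longrightarrow> f i \<in> F) \<Longrightarrow> prod f A \<in> F"
  by (induction A rule: infinite_finite_induct) (auto simp: is_subringD)

lemma is_subring_power: "is_subring F \<Longrightarrow> x \<in> F \<Longrightarrow> x ^ n \<in> F"
  by (induction n) (auto simp: is_subringD)

lemma is_subring_of_nat: "is_subring F \<Longrightarrow> of_nat n \<in> F"
  by (induction n) (auto simp: is_subringD)

lemma is_subfield_imp_is_subring: "is_subfield F \<Longrightarrow> is_subring F"
  by (auto simp: is_subring_def is_subfield_def)

text \<open>\<open>\<iota>\<close> is a total function with unspecified values outside
  \<open>K\<close>, so the laws are required on a subset only. \<open>h 0 = 0\<close> is demanded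
  outright because \<open>Poly_Mapping.map\<close> and evaluation over enlarged supports rely on
  it.\<close>

definition hom_on :: "'a::comm_ring_1 set \<Rightarrow> ('a \<Rightarrow> 'b::comm_ring_1) \<Rightarrow> bool" where
  "hom_on F h \<longleftrightarrow> h 0 = 0 \<and> h 1 = 1 \<and> (\<forall>x\<in>F. \<forall>y\<in>F. h (x + y) = h x + h y \<and> h (x * y) = h x * h y)"

lemma hom_on_UNIV: "hom_on UNIV h \<longleftrightarrow> comm_ring_hom h"
proof
  assume "hom_on UNIV h"
  then show "comm_ring_hom h" unfolding hom_on_def by unfold_locales auto
next
  assume "comm_ring_hom h"
  then interpret comm_ring_hom h .
  show "hom_on UNIV h" by (simp add: hom_on_def hom_add hom_mult)
qed

lemma comm_ring_hom_id: "comm_ring_hom id"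
  by unfold_locales auto

section \<open>Evaluation of polynomials\<close>

definition eval_mon :: "('v \<Rightarrow> 'b::comm_semiring_1) \<Rightarrow> ('v \<Rightarrow>\<^sub>0 nat) \<Rightarrow> 'b" where
  "eval_mon x t = (\<Prod>v\<in>Poly_Mapping.keys t. x v ^ Poly_Mapping.lookup t v)"

lemma eval_mon_superset:
  "finite A \<Longrightarrow> Poly_Mapping.keys t \<subseteq> A \<Longrightarrow> eval_mon x t = (\<Prod>v\<in>A. x v ^ Poly_Mapping.lookup t v)"
  unfolding eval_mon_def by (rule prod.mono_neutral_left) (auto simp: in_keys_iff)

lemma eval_mon_0 [simp]: "eval_mon x 0 = 1"
  by (simp add: eval_mon_def)

lemma eval_mon_add: "eval_mon x (s + t) = eval_mon x s * eval_mon x t"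
proof -
  let ?A = "Poly_Mapping.keys s \<union> Poly_Mapping.keys t"
  have "eval_mon x (s + t) = (\<Prod>v\<in>?A. x v ^ Poly_Mapping.lookup (s + t) v)"
    by (rule eval_mon_superset) (auto simp: Poly_Mapping.keys_add)
  also have "\<dots> = (\<Prod>v\<in>?A. x v ^ Poly_Mapping.lookup s v) * (\<Prod>v\<in>?A. x v ^ Poly_Mapping.lookup t v)"
    by (simp add: lookup_add power_add prod.distrib)
  also have "\<dots> = eval_mon x s * eval_mon x t"
    using eval_mon_superset[of ?A s x] eval_mon_superset[of ?A t x] by simp
  finally show ?thesis .
qed

lemma eval_mon_single [simp]: "eval_mon x (Poly_Mapping.single v n) = x v ^ n"
  by (cases "n = 0") (auto simp: eval_mon_def)

lemma eval_pol_alt: "eval_pol h x P = (\<Sum>t\<in>Poly_Mapping.keys P. h (Poly_Mapping.lookup P t) * eval_mon x t)"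
  by (simp add: eval_pol_def eval_mon_def)

text \<open>Polynomials with different supports are compared over a common finite index set; the
  added terms vanish because \<open>h 0 = 0\<close>.\<close>

lemma eval_pol_superset:
  assumes "h 0 = 0" "finite A" "Poly_Mapping.keys P \<subseteq> A"
  shows "eval_pol h x P = (\<Sum>t\<in>A. h (Poly_Mapping.lookup P t) * eval_mon x t)"
  unfolding eval_pol_alt by (rule sum.mono_neutral_left) (use assms in \<open>auto simp: in_keys_iff\<close>)

lemma eval_pol_0 [simp]: "eval_pol h x 0 = 0"
  by (simp add: eval_pol_def)

lemma eval_pol_single: "h 0 = 0 \<Longrightarrow> eval_pol h x (Poly_Mapping.single t c) = h c * eval_mon x t"
  by (cases "c = 0") (auto simp: eval_pol_alt)

lemma eval_pol_Const [simp]: "h 0 = 0 \<Longrightarrow> eval_pol h x (Const c) = h c"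
  by (simp add: Const_def eval_pol_single)

lemma eval_pol_Var [simp]: "h 0 = 0 \<Longrightarrow> h 1 = 1 \<Longrightarrow> eval_pol h x (Var v) = x v"
  by (simp add: Var_def eval_pol_single)

lemma pol_overI:
  "(\<And>t. Poly_Mapping.lookup P t \<in> F) \<Longrightarrow> (\<And>t v. t \<in> Poly_Mapping.keys P \<Longrightarrow> v \<in> Poly_Mapping.keys t \<Longrightarrow> v \<in> V)
    \<Longrightarrow> P \<in> pol_over F V"
  by (auto simp: pol_over_def)

lemma pol_over_lookup: "P \<in> pol_over F V \<Longrightarrow> Poly_Mapping.lookup P t \<in> F"
  by (auto simp: pol_over_def)

lemma pol_over_keys: "P \<in> pol_over F V \<Longrightarrow> t \<in> Poly_Mapping.keys P \<Longrightarrow> Poly_Mapping.keys t \<subseteq> V"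
  by (auto simp: pol_over_def)

lemma pol_over_keysD:
  "P \<in> pol_over F V \<Longrightarrow> t \<in> Poly_Mapping.keys P \<Longrightarrow> v \<in> Poly_Mapping.keys t \<Longrightarrow> v \<in> V"
  using pol_over_keys by blast

lemma pol_over_mono: "F \<subseteq> F' \<Longrightarrow> V \<subseteq> V' \<Longrightarrow> pol_over F V \<subseteq> pol_over F' V'"
  by (fastforce simp: pol_over_def)

lemma pol_over_UNIV [simp]: "pol_over UNIV UNIV = UNIV"
  by (auto simp: pol_over_def)

lemma eval_pol_cong:
  assumes "P \<in> pol_over F V" "\<And>c. c \<in> F \<Longrightarrow> h c = h' c" "\<And>v. v \<in> V \<Longrightarrow> x v = x' v"
  shows "eval_pol h x P = eval_pol h' x' P"
proof -
  have "h (Poly_Mapping.lookup P t) = h' (Poly_Mapping.lookup P t)" for t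
    using pol_over_lookup[OF assms(1)] by (rule assms(2))
  moreover have "x v = x' v" if "t \<in> Poly_Mapping.keys P" "v \<in> Poly_Mapping.keys t" for t v
    using pol_over_keysD[OF assms(1) that] by (rule assms(3))
  ultimately show ?thesis unfolding eval_pol_def by (simp cong: sum.cong prod.cong)
qed

lemma pol_over_single:
  "is_subring F \<Longrightarrow> c \<in> F \<Longrightarrow> Poly_Mapping.keys t \<subseteq> V \<Longrightarrow> Poly_Mapping.single t c \<in> pol_over F V"
  by (auto simp: pol_over_def lookup_single when_def is_subringD split: if_splits)

lemma pol_over_add: "is_subring F \<Longrightarrow> P \<in> pol_over F V \<Longrightarrow> Q \<in> pol_over F V \<Longrightarrow> P + Q \<in> pol_over F V"
  by (rule pol_overI)
    (auto simp: lookup_add pol_over_lookup is_subringD dest!: subsetD[OF Poly_Mapping.keys_add] dest: pol_over_keys)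

lemma pol_over_0: "is_subring F \<Longrightarrow> 0 \<in> pol_over F V"
  by (auto simp: pol_over_def is_subringD)

lemma pol_over_sum:
  "is_subring F \<Longrightarrow> (\<And>i. i \<in> A \<Longrightarrow> f i \<in> pol_over F V) \<Longrightarrow> sum f A \<in> pol_over F V"
  by (induction A rule: infinite_finite_induct) (auto simp: pol_over_0 pol_over_add)

lemma pol_over_uminus: "is_subring F \<Longrightarrow> P \<in> pol_over F V \<Longrightarrow> - P \<in> pol_over F V"
  by (auto simp: pol_over_def is_subringD)

lemma mpol_expand: "(P :: 't \<Rightarrow>\<^sub>0 'a::comm_monoid_add) = (\<Sum>t\<in>Poly_Mapping.keys P. Poly_Mapping.single t (Poly_Mapping.lookup P t))"
  by (rule poly_mapping_eqI) (simp add: lookup_sum lookup_single when_def in_keys_iff)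

lemma mpol_mult_expand:
  fixes P Q :: "('v, 'a::comm_ring_1) mpol"
  shows "P * Q = (\<Sum>s\<in>Poly_Mapping.keys P. \<Sum>t\<in>Poly_Mapping.keys Q.
     Poly_Mapping.single (s + t) (Poly_Mapping.lookup P s * Poly_Mapping.lookup Q t))"
  by (subst mpol_expand[of P], subst mpol_expand[of Q]) (simp add: sum_product mult_single)

lemma pol_over_mult:
  assumes "is_subring F" "P \<in> pol_over F V" "Q \<in> pol_over F V"
  shows "P * Q \<in> pol_over F V"
  unfolding mpol_mult_expand[of P Q]
  using assms pol_over_keys[OF assms(2)] pol_over_keys[OF assms(3)]
  by (intro pol_over_sum pol_over_single is_subringD pol_over_lookup)
    (auto dest!: subsetD[OF Poly_Mapping.keys_add])

lemma pol_over_Const: "is_subring F \<Longrightarrow> c \<in> F \<Longrightarrow> Const c \<in> pol_over F V"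
  by (auto simp: Const_def pol_over_single)

lemma pol_over_Var: "is_subring F \<Longrightarrow> v \<in> V \<Longrightarrow> Var v \<in> pol_over F V"
  by (auto simp: Var_def pol_over_single is_subringD)

lemma Const_0 [simp]: "Const 0 = 0" and Const_1 [simp]: "Const 1 = 1"
  by (auto simp: Const_def)

lemma is_subring_pol_over: "is_subring F \<Longrightarrow> is_subring (pol_over F V)"
  unfolding is_subring_def[of "pol_over F V"]
  using pol_over_0 pol_over_add pol_over_mult pol_over_uminus pol_over_Const[of F 1] is_subringD(2)[of F]
  by (metis Const_1)

text \<open>Evaluating a monomial at the indeterminates themselves returns it. In this way facts
  about single terms follow from facts about constants, variables and products.\<close>

lemma single_eq_mon: "Poly_Mapping.single t (c::'a::comm_ring_1) = Const c * eval_mon Var t"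
proof -
  have 1: "eval_mon Var t = (Poly_Mapping.single t 1 :: ('v, 'a) mpol)" for t :: "'v \<Rightarrow>\<^sub>0 nat"
  proof -
    have p: "Var v ^ n = (Poly_Mapping.single (Poly_Mapping.single v n) 1 :: ('v, 'a) mpol)" for v :: 'v and n
      by (induction n) (simp_all add: Var_def mult_single single_add[symmetric])
    have "(\<Prod>v\<in>A. Var v ^ Poly_Mapping.lookup t v) =
        (Poly_Mapping.single (\<Sum>v\<in>A. Poly_Mapping.single v (Poly_Mapping.lookup t v)) 1 :: ('v, 'a) mpol)" for A
      by (induction A rule: infinite_finite_induct) (simp_all add: p mult_single)
    then show ?thesis
      unfolding eval_mon_def by (simp flip: mpol_expand)
  qed
  show ?thesis by (simp add: 1 Const_def mult_single)
qed

text \<open>The terms of \<open>P\<close> are products of constants from \<open>F\<close> and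
  variables from \<open>V\<close>. Membership of both operands is kept in the sum and product cases
  because maps that are homomorphisms only on \<open>F\<close> respect the operations only
  there.\<close>

lemma pol_over_induct [consumes 2, case_names Const Var add mult]:
  assumes "P \<in> pol_over F V" "is_subring F"
    and "\<And>c. c \<in> F \<Longrightarrow> R (Const c)" "\<And>v. v \<in> V \<Longrightarrow> R (Var v)"
    and "\<And>P Q. P \<in> pol_over F V \<Longrightarrow> Q \<in> pol_over F V \<Longrightarrow> R P \<Longrightarrow> R Q \<Longrightarrow> R (P + Q)"
    and "\<And>P Q. P \<in> pol_over F V \<Longrightarrow> Q \<in> pol_over F V \<Longrightarrow> R P \<Longrightarrow> R Q \<Longrightarrow> R (P * Q)"
  shows "R P"
proof -
  let ?S = "{P \<in> pol_over F V. R P}"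
  note F = assms(2) is_subring_pol_over[OF assms(2), of V]
  have 0: "0 \<in> ?S" "1 \<in> ?S"
    using assms(3)[of 0] assms(3)[of 1] F by (auto simp: is_subringD)
  have 1: "eval_mon Var t \<in> ?S" if "Poly_Mapping.keys t \<subseteq> V" for t
  proof -
    have p: "Var v ^ n \<in> ?S" if "v \<in> V" for v n
      using 0 that by (induction n) (auto simp: assms(4,6) F pol_over_Var is_subringD)
    have "(\<Prod>v\<in>A. Var v ^ Poly_Mapping.lookup t v) \<in> ?S" if "A \<subseteq> V" for A
      using that
    proof (induction A rule: infinite_finite_induct)
      case (insert x A)
      then show ?case using p[of x "Poly_Mapping.lookup t x"] 
        by (simp del: One_nat_def) (metis (no_types, lifting) F(2) assms(6) is_subringD(4))
    qed (use 0 in auto)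
    then show ?thesis using that unfolding eval_mon_def by blast
  qed
  have 2: "Poly_Mapping.single t (Poly_Mapping.lookup P t) \<in> ?S" if "t \<in> Poly_Mapping.keys P" for t
    using 1[OF pol_over_keys[OF assms(1) that]] pol_over_lookup[OF assms(1), of t] assms(3,6)
    unfolding single_eq_mon by (auto simp: F pol_over_Const pol_over_mult)
  have "(\<Sum>t\<in>A. Poly_Mapping.single t (Poly_Mapping.lookup P t)) \<in> ?S" if "A \<subseteq> Poly_Mapping.keys P" for A
    using that by (induction A rule: infinite_finite_induct) (use 0 2 assms(5) F in \<open>auto simp: pol_over_add\<close>)
  then have "P \<in> ?S" using mpol_expand[of P] by force
  then show ?thesis by simp
qed

lemmas mpol_induct = pol_over_induct[of _ UNIV UNIV, simplified, consumes 0, case_names Const Var add mult]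

lemma eval_pol_add:
  assumes "is_subring F" "hom_on F h" "P \<in> pol_over F V" "Q \<in> pol_over F W"
  shows "eval_pol h x (P + Q) = eval_pol h x P + eval_pol h x Q"
proof -
  let ?A = "Poly_Mapping.keys P \<union> Poly_Mapping.keys Q"
  have h0: "h 0 = 0" using assms by (simp add: hom_on_def)
  have "eval_pol h x (P + Q) = (\<Sum>t\<in>?A. h (Poly_Mapping.lookup (P + Q) t) * eval_mon x t)"
    by (rule eval_pol_superset) (auto simp: h0 Poly_Mapping.keys_add)
  also have "\<dots> = (\<Sum>t\<in>?A. h (Poly_Mapping.lookup P t) * eval_mon x t) + (\<Sum>t\<in>?A. h (Poly_Mapping.lookup Q t) * eval_mon x t)"
    using assms by (simp add: lookup_add hom_on_def pol_over_lookup distrib_right sum.distrib)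
  also have "\<dots> = eval_pol h x P + eval_pol h x Q"
    using eval_pol_superset[of h ?A P x] eval_pol_superset[of h ?A Q x] h0 by simp
  finally show ?thesis .
qed

lemma eval_pol_sum:
  assumes "is_subring F" "hom_on F h" "\<And>i. i \<in> A \<Longrightarrow> f i \<in> pol_over F UNIV"
  shows "eval_pol h x (sum f A) = (\<Sum>i\<in>A. eval_pol h x (f i))"
  using assms(3)
proof (induction A rule: infinite_finite_induct)
  case (insert y A)
  then show ?case using eval_pol_add[OF assms(1,2), of "f y" UNIV "sum f A" UNIV] assms(1)
    by (simp add: pol_over_sum)
qed auto

lemma eval_pol_mult:
  assumes F: "is_subring F" "hom_on F h" and P: "P \<in> pol_over F V" "Q \<in> pol_over F W"
  shows "eval_pol h x (P * Q) = eval_pol h x P * eval_pol h x Q"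
proof -
  have h0: "h 0 = 0" using assms by (simp add: hom_on_def)
  let ?p = "Poly_Mapping.lookup P" let ?q = "Poly_Mapping.lookup Q"
  have s: "Poly_Mapping.single (s + t) (?p s * ?q t) \<in> pol_over F UNIV" for s t
    by (intro pol_over_single is_subringD pol_over_lookup[OF P(1)] pol_over_lookup[OF P(2)]) (auto simp: F)
  have "eval_pol h x (P * Q) = (\<Sum>s\<in>Poly_Mapping.keys P. eval_pol h x (\<Sum>t\<in>Poly_Mapping.keys Q.
     Poly_Mapping.single (s + t) (?p s * ?q t)))"
    unfolding mpol_mult_expand[of P Q] by (rule eval_pol_sum[OF F]) (intro pol_over_sum F(1) s)
  also have "\<dots> = (\<Sum>s\<in>Poly_Mapping.keys P. \<Sum>t\<in>Poly_Mapping.keys Q.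
     eval_pol h x (Poly_Mapping.single (s + t) (?p s * ?q t)))"
    by (intro sum.cong refl eval_pol_sum[OF F] s)
  also have "\<dots> = (\<Sum>s\<in>Poly_Mapping.keys P. \<Sum>t\<in>Poly_Mapping.keys Q. h (?p s * ?q t) * eval_mon x (s + t))"
    by (simp add: eval_pol_single h0)
  also have "\<dots> = eval_pol h x P * eval_pol h x Q"
    using F pol_over_lookup[OF P(1)] pol_over_lookup[OF P(2)]
    by (simp add: hom_on_def eval_pol_alt sum_product eval_mon_add mult_ac)
  finally show ?thesis .
qed

lemma eval_pol_comm_ring_hom: "comm_ring_hom h \<Longrightarrow> comm_ring_hom (eval_pol h x)"
proof -
  assume h: "comm_ring_hom h"
  interpret comm_ring_hom h by fact
  have H: "hom_on UNIV h" using h by (simp add: hom_on_UNIV)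
  show ?thesis
    using eval_pol_add[of UNIV h _ UNIV _ UNIV] eval_pol_mult[of UNIV h _ UNIV _ UNIV] H eval_pol_Const[of h x 1]
    by unfold_locales (auto simp: hom_on_def)
qed

lemma Const_add: "Const (a + b) = Const a + Const b"
  by (simp add: Const_def single_add)

lemma Const_mult: "Const (a * b :: 'a::comm_ring_1) = Const a * Const b"
  by (simp add: Const_def mult_single)

lemma Const_uminus: "Const (- c) = - Const (c :: 'a::comm_ring_1)"
  by (simp add: Const_def single_uminus)

lemma of_nat_eq_Const: "(of_nat n :: ('v, 'a::comm_ring_1) mpol) = Const (of_nat n)"
  by (simp add: Const_def)

lemma comm_ring_hom_Const: "comm_ring_hom (Const :: 'a::comm_ring_1 \<Rightarrow> ('v, 'a) mpol)"
  by unfold_locales (auto simp: Const_add Const_mult)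

lemma comm_ring_hom_comp: "comm_ring_hom f \<Longrightarrow> comm_ring_hom g \<Longrightarrow> comm_ring_hom (f \<circ> g)"
proof -
  assume "comm_ring_hom f" "comm_ring_hom g"
  then interpret f: comm_ring_hom f + g: comm_ring_hom g by simp_all
  show ?thesis by unfold_locales (auto simp: f.hom_add f.hom_mult g.hom_add g.hom_mult)
qed

lemma hom_eval_pol:
  assumes "comm_ring_hom \<Phi>"
  shows "\<Phi> (eval_pol h x P) = eval_pol (\<Phi> \<circ> h) (\<Phi> \<circ> x) P"
proof -
  interpret comm_ring_hom \<Phi> by fact
  show ?thesis by (simp add: eval_pol_def hom_sum hom_mult hom_prod hom_power)
qed

lemma eval_pol_Const_Var [simp]: "eval_pol Const Var (P :: ('v, 'a::comm_ring_1) mpol) = P"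
  by (simp add: eval_pol_alt flip: single_eq_mon mpol_expand)

lemma eval_pol_eval_pol:
  assumes "comm_ring_hom h"
  shows "eval_pol h y (eval_pol Const x P) = eval_pol h (\<lambda>v. eval_pol h y (x v)) P"
proof -
  interpret comm_ring_hom h by fact
  show ?thesis using hom_eval_pol[OF eval_pol_comm_ring_hom[OF assms], of y Const x P]
    by (simp add: o_def)
qed

lemma eval_pol_in_subring:
  assumes "is_subring R" "P \<in> pol_over F V" "\<And>c. c \<in> F \<Longrightarrow> h c \<in> R" "\<And>v. v \<in> V \<Longrightarrow> x v \<in> R"
  shows "eval_pol h x P \<in> R"
  unfolding eval_pol_def
  using assms(3,4) pol_over_keys[OF assms(2)] pol_over_lookup[OF assms(2)]
  by (intro is_subring_sum is_subring_prod is_subringD is_subring_power assms(1)) auto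

section \<open>Change of coefficients\<close>

lemma lookup_map: "f 0 = 0 \<Longrightarrow> Poly_Mapping.lookup (Poly_Mapping.map f P) t = f (Poly_Mapping.lookup P t)"
  by (simp add: Poly_Mapping.map.rep_eq when_def)

lemma map_single: "f 0 = 0 \<Longrightarrow> Poly_Mapping.map f (Poly_Mapping.single t c) = Poly_Mapping.single t (f c)"
  by (rule poly_mapping_eqI) (auto simp: lookup_map lookup_single when_def)

lemma map_pol_over:
  "P \<in> pol_over F V \<Longrightarrow> f 0 = 0 \<Longrightarrow> (\<And>c. c \<in> F \<Longrightarrow> f c \<in> F') \<Longrightarrow> Poly_Mapping.map f P \<in> pol_over F' V"
  by (rule pol_overI) (auto simp: lookup_map pol_over_lookup in_keys_iff intro!: pol_over_keysD[of P F V])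

lemma eval_pol_map:
  assumes "f 0 = 0" "h 0 = 0"
  shows "eval_pol h x (Poly_Mapping.map f P) = eval_pol (\<lambda>c. h (f c)) x P"
proof -
  have "Poly_Mapping.keys (Poly_Mapping.map f P) \<subseteq> Poly_Mapping.keys P"
    using assms by (auto simp: lookup_map in_keys_iff)
  then show ?thesis
    using eval_pol_superset[of h "Poly_Mapping.keys P" "Poly_Mapping.map f P" x] assms by (simp add: lookup_map eval_pol_alt)
qed

text \<open>Change of coefficients is an evaluation at the generic point, so its additivity and
  multiplicativity are inherited from \<open>eval_pol\<close>.\<close>

lemma map_eq_eval:
  fixes f :: "'a::zero \<Rightarrow> 'b::comm_ring_1"
  shows "f 0 = 0 \<Longrightarrow> Poly_Mapping.map f P = eval_pol (\<lambda>c. Const (f c)) Var P"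
  using eval_pol_Const_Var[of "Poly_Mapping.map f P"] eval_pol_map[of f Const Var P] by simp

lemma hom_on_Const_comp: "hom_on F h \<Longrightarrow> hom_on F (\<lambda>c. Const (h c))"
  by (simp add: hom_on_def Const_add Const_mult)

lemma map_hom_mult:
  assumes "is_subring F" "hom_on F h" "P \<in> pol_over F V" "Q \<in> pol_over F W"
  shows "Poly_Mapping.map h (P * Q) = Poly_Mapping.map h P * Poly_Mapping.map h Q"
  using eval_pol_mult[OF assms(1) hom_on_Const_comp[OF assms(2)] assms(3,4), of Var] assms(2)
  by (simp add: map_eq_eval hom_on_def)

lemma map_hom_add:
  assumes "is_subring F" "hom_on F h" "P \<in> pol_over F V" "Q \<in> pol_over F W"
  shows "Poly_Mapping.map h (P + Q) = Poly_Mapping.map h P + Poly_Mapping.map h Q"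
  using eval_pol_add[OF assms(1) hom_on_Const_comp[OF assms(2)] assms(3,4), of Var] assms(2)
  by (simp add: map_eq_eval hom_on_def)

lemma map_0: "f 0 = 0 \<Longrightarrow> Poly_Mapping.map f 0 = 0"
  by (rule poly_mapping_eqI) (simp add: lookup_map)

lemma map_id_poly [simp]: "Poly_Mapping.map id P = P"
  by (rule poly_mapping_eqI) (simp add: lookup_map)

lemma lookup_Const_mult: "Poly_Mapping.lookup (Const b * Q) t = b * Poly_Mapping.lookup Q t"
  for Q :: "('v, 'a::comm_ring_1) mpol"
proof -
  have "Poly_Mapping.lookup (Const b * Poly_Mapping.single s c) t = b * Poly_Mapping.lookup (Poly_Mapping.single s c) t" for s c
    by (simp add: Const_def mult_single lookup_single when_def)
  then show ?thesis
    by (subst (1 2) mpol_expand[of Q]) (simp add: sum_distrib_left lookup_sum)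
qed

lemma map_Const [simp]: "f 0 = 0 \<Longrightarrow> Poly_Mapping.map f (Const c) = Const (f c)"
  by (simp add: Const_def map_single)

lemma map_Var [simp]: "f 0 = 0 \<Longrightarrow> f 1 = 1 \<Longrightarrow> Poly_Mapping.map f (Var v) = Var v"
  by (simp add: Var_def map_single)

section \<open>Derivations\<close>

definition derivation :: "('r::comm_ring_1 \<Rightarrow> 'r) \<Rightarrow> bool" where
  "derivation d \<longleftrightarrow> (\<forall>x y. d (x + y) = d x + d y \<and> d (x * y) = d x * y + x * d y)"

lemma is_derivation_eq: "is_derivation = derivation"
  by (auto simp: is_derivation_def derivation_def fun_eq_iff)

lemma derivationD:
  assumes "derivation d"
  shows "d (x + y) = d x + d y" "d (x * y) = d x * y + x * d y" "d 0 = 0" "d 1 = 0"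
    "d (- x) = - d x" "d (x - y) = d x - d y"
proof -
  show a: "d (x + y) = d x + d y" "d (x * y) = d x * y + x * d y" for x y
    using assms by (auto simp: derivation_def)
  show z: "d 0 = 0" using a(1)[of 0 0] by simp
  show "d 1 = 0" using a(2)[of 1 1] by simp
  show m: "d (- x) = - d x" for x using a(1)[of x "- x"] z by (simp add: eq_neg_iff_add_eq_0 add.commute)
  show "d (x - y) = d x - d y" using a(1)[of x "- y"] m by simp
qed

lemma derivation_sum: "derivation d \<Longrightarrow> d (sum f A) = (\<Sum>i\<in>A. d (f i))"
  by (induction A rule: infinite_finite_induct) (auto simp: derivationD)

lemma derivation_of_nat: "derivation d \<Longrightarrow> d (of_nat n) = 0"
  by (induction n) (auto simp: derivationD)

lemma derivation_power: "derivation d \<Longrightarrow> d (x ^ n) = of_nat n * x ^ (n - 1) * d x"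
proof (induction n)
  case (Suc n)
  then show ?case by (cases n) (simp_all add: derivationD algebra_simps)
qed (simp add: derivationD)

text \<open>The derivative of a single term, isolated so that the product rule can be checked term
  by term. The subtraction truncates only where the factor \<open>Poly_Mapping.lookup t v\<close> is
  0, so the index set can be enlarged.\<close>

definition dmon :: "('a::comm_ring_1 \<Rightarrow> 'a) \<Rightarrow> (nat \<times> 'v \<Rightarrow>\<^sub>0 nat) \<Rightarrow> 'a \<Rightarrow> (nat \<times> 'v, 'a) mpol" where
  "dmon \<delta> t c = Poly_Mapping.single t (\<delta> c) + (\<Sum>v\<in>Poly_Mapping.keys t.
     Poly_Mapping.single (t - Poly_Mapping.single v 1 + Poly_Mapping.single (Suc (fst v), snd v) 1)
       (of_nat (Poly_Mapping.lookup t v) * c))"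

lemma dmon_superset:
  assumes "finite A" "Poly_Mapping.keys t \<subseteq> A"
  shows "dmon \<delta> t c = Poly_Mapping.single t (\<delta> c) + (\<Sum>v\<in>A.
     Poly_Mapping.single (t - Poly_Mapping.single v 1 + Poly_Mapping.single (Suc (fst v), snd v) 1)
       (of_nat (Poly_Mapping.lookup t v) * c))"
  unfolding dmon_def using assms
  by (intro arg_cong2[where f = "(+)"] sum.mono_neutral_left) (auto simp: in_keys_iff)

lemma dmon_add: "derivation \<delta> \<Longrightarrow> dmon \<delta> t (c + c') = dmon \<delta> t c + dmon \<delta> t c'"
  by (simp add: dmon_def derivationD single_add distrib_left sum.distrib)

lemma dmon_0 [simp]: "derivation \<delta> \<Longrightarrow> dmon \<delta> t 0 = 0"
  by (simp add: dmon_def derivationD)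

lemma dmon_mult:
  assumes "derivation \<delta>"
  shows "dmon \<delta> (s + t) (a * b) = dmon \<delta> s a * Poly_Mapping.single t b + Poly_Mapping.single s a * dmon \<delta> t b"
proof -
  let ?A = "Poly_Mapping.keys s \<union> Poly_Mapping.keys t"
  let ?e = "\<lambda>v. Poly_Mapping.single v (1::nat)" and ?f = "\<lambda>v. Poly_Mapping.single (Suc (fst v), snd v) (1::nat)"
  let ?g = "\<lambda>t c v. Poly_Mapping.single (t - ?e v + ?f v) (of_nat (Poly_Mapping.lookup t v) * c)"
  \<comment> \<open>With truncated subtraction this fails when \<open>v\<close> does not occur in
    \<open>s\<close>; there the coefficient vanishes, whence the case distinctions below.\<close>
  have m: "s + t - ?e v + ?f v = (s - ?e v + ?f v) + t" if "Poly_Mapping.lookup s v \<noteq> 0" for s t and v :: "nat \<times> 'b"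
    using that by (intro poly_mapping_eqI) (auto simp: lookup_add lookup_minus lookup_single when_def)
  have k: "?g (s + t) (a * b) v = ?g s a v * Poly_Mapping.single t b + Poly_Mapping.single s a * ?g t b v" for v
  proof -
    have "Poly_Mapping.single (s + t - ?e v + ?f v) (of_nat (Poly_Mapping.lookup s v) * (a * b)) = ?g s a v * Poly_Mapping.single t b"
    proof (cases "Poly_Mapping.lookup s v = 0")
      case False
      show ?thesis unfolding m[OF False] by (simp add: mult_single mult_ac add.commute)
    qed simp
    moreover have "Poly_Mapping.single (s + t - ?e v + ?f v) (of_nat (Poly_Mapping.lookup t v) * (a * b)) = Poly_Mapping.single s a * ?g t b v"
    proof (cases "Poly_Mapping.lookup t v = 0")
      case False
      show ?thesis unfolding add.commute[of s t] m[OF False] by (simp add: mult_single mult_ac add.commute)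
    qed simp
    ultimately show ?thesis
      by (simp add: lookup_add distrib_right single_add)
  qed
  have "dmon \<delta> (s + t) (a * b) = Poly_Mapping.single (s + t) (\<delta> (a * b)) + (\<Sum>v\<in>?A. ?g (s + t) (a * b) v)"
    by (rule dmon_superset) (auto simp: Poly_Mapping.keys_add)
  also have "\<dots> = (Poly_Mapping.single s (\<delta> a) + (\<Sum>v\<in>?A. ?g s a v)) * Poly_Mapping.single t b
     + Poly_Mapping.single s a * (Poly_Mapping.single t (\<delta> b) + (\<Sum>v\<in>?A. ?g t b v))"
    unfolding k using assms
    by (simp add: derivationD single_add sum.distrib distrib_left distrib_right mult_single
        sum_distrib_left sum_distrib_right)
  also have "\<dots> = dmon \<delta> s a * Poly_Mapping.single t b + Poly_Mapping.single s a * dmon \<delta> t b"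
    using dmon_superset[of ?A s \<delta> a] dmon_superset[of ?A t \<delta> b] by simp
  finally show ?thesis .
qed

lemma dpol_deriv_alt:
  assumes "finite A" "Poly_Mapping.keys P \<subseteq> A" "derivation \<delta>"
  shows "dpol_deriv \<delta> P = (\<Sum>t\<in>A. dmon \<delta> t (Poly_Mapping.lookup P t))"
proof -
  have "dpol_deriv \<delta> P = (\<Sum>t\<in>Poly_Mapping.keys P. dmon \<delta> t (Poly_Mapping.lookup P t))"
    by (simp add: dpol_deriv_def dmon_def sum.distrib case_prod_unfold)
  also have "\<dots> = (\<Sum>t\<in>A. dmon \<delta> t (Poly_Mapping.lookup P t))"
    using assms by (intro sum.mono_neutral_left) (auto simp: in_keys_iff)
  finally show ?thesis .
qed

lemma dpol_deriv_single: "derivation \<delta> \<Longrightarrow> dpol_deriv \<delta> (Poly_Mapping.single t c) = dmon \<delta> t c"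
  by (subst dpol_deriv_alt[of "{t}"]) auto

lemma dpol_deriv_add:
  assumes "derivation \<delta>"
  shows "dpol_deriv \<delta> (P + Q) = dpol_deriv \<delta> P + dpol_deriv \<delta> Q"
proof -
  let ?A = "Poly_Mapping.keys P \<union> Poly_Mapping.keys Q"
  have "Poly_Mapping.keys (P + Q) \<subseteq> ?A" by (rule Poly_Mapping.keys_add)
  then show ?thesis
    using assms dpol_deriv_alt[of ?A "P + Q" \<delta>] dpol_deriv_alt[of ?A P \<delta>] dpol_deriv_alt[of ?A Q \<delta>]
    by (simp add: lookup_add dmon_add sum.distrib)
qed

lemma dpol_deriv_sum:
  assumes "derivation \<delta>"
  shows "dpol_deriv \<delta> (sum f A) = (\<Sum>i\<in>A. dpol_deriv \<delta> (f i))"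
  using assms
proof (induction A rule: infinite_finite_induct)
qed (auto simp: dpol_deriv_add, auto simp: dpol_deriv_def)

lemma derivation_dpol_deriv:
  assumes "derivation \<delta>"
  shows "derivation (dpol_deriv \<delta>)"
  unfolding derivation_def
proof (intro allI conjI)
  fix P Q
  show "dpol_deriv \<delta> (P + Q) = dpol_deriv \<delta> P + dpol_deriv \<delta> Q"
    by (rule dpol_deriv_add) fact
  let ?p = "Poly_Mapping.lookup P" let ?q = "Poly_Mapping.lookup Q"
  have "dpol_deriv \<delta> (P * Q) = (\<Sum>s\<in>Poly_Mapping.keys P. \<Sum>t\<in>Poly_Mapping.keys Q.
     dmon \<delta> s (?p s) * Poly_Mapping.single t (?q t) + Poly_Mapping.single s (?p s) * dmon \<delta> t (?q t))"
    using assms by (simp add: mpol_mult_expand[of P Q] dpol_deriv_sum dpol_deriv_single dmon_mult)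
  also have "\<dots> = (\<Sum>s\<in>Poly_Mapping.keys P. dmon \<delta> s (?p s)) * (\<Sum>t\<in>Poly_Mapping.keys Q. Poly_Mapping.single t (?q t))
     + (\<Sum>s\<in>Poly_Mapping.keys P. Poly_Mapping.single s (?p s)) * (\<Sum>t\<in>Poly_Mapping.keys Q. dmon \<delta> t (?q t))"
    by (simp add: sum_product sum.distrib)
  also have "\<dots> = dpol_deriv \<delta> P * Q + P * dpol_deriv \<delta> Q"
    using assms dpol_deriv_alt[of "Poly_Mapping.keys P" P \<delta>] dpol_deriv_alt[of "Poly_Mapping.keys Q" Q \<delta>]
    by (simp add: mpol_expand[symmetric])
  finally show "dpol_deriv \<delta> (P * Q) = dpol_deriv \<delta> P * Q + P * dpol_deriv \<delta> Q" .
qed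

lemma dpol_deriv_Const [simp]: "derivation \<delta> \<Longrightarrow> dpol_deriv \<delta> (Const c) = Const (\<delta> c)"
  by (simp add: Const_def dpol_deriv_single dmon_def)

lemma dpol_deriv_Var [simp]: "derivation \<delta> \<Longrightarrow> dpol_deriv \<delta> (Var (l, v)) = Var (Suc l, v)"
  by (simp add: Var_def dpol_deriv_single dmon_def derivationD)

text \<open>Both sides obey the same Leibniz rule along \<open>\<Phi>\<close>, so agreement on
  constants and on indeterminates propagates to all differential polynomials.\<close>

lemma hom_dpol_deriv:
  assumes "derivation \<delta>" "derivation d" "comm_ring_hom \<Phi>"
    and "\<And>c. \<Phi> (Const (\<delta> c)) = d (\<Phi> (Const c))" "\<And>l v. \<Phi> (Var (Suc l, v)) = d (\<Phi> (Var (l, v)))"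
  shows "\<Phi> (dpol_deriv \<delta> P) = d (\<Phi> P)"
proof -
  interpret comm_ring_hom \<Phi> by fact
  note D = derivationD[OF derivation_dpol_deriv[OF assms(1)]]
  show ?thesis
  proof (induction P rule: mpol_induct)
    case (Var v)
    then show ?case using assms by (cases v) simp
  qed (use assms in \<open>simp_all add: D derivationD[OF assms(2)] hom_add hom_mult\<close>)
qed

lemma jet_0 [simp]: "jet \<delta> y (0, v) = y v" and jet_Suc: "jet \<delta> y (Suc l, v) = \<delta> (jet \<delta> y (l, v))"
  by (auto simp: jet_def)

lemma eval_jet_dpol_deriv:
  assumes "derivation \<delta>" "derivation d" "comm_ring_hom h" "\<And>c. h (\<delta> c) = d (h c)"
  shows "eval_pol h (jet d y) (dpol_deriv \<delta> P) = d (eval_pol h (jet d y) P)"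
proof -
  interpret comm_ring_hom h by fact
  show ?thesis
    by (rule hom_dpol_deriv) (use assms eval_pol_comm_ring_hom[OF assms(3)] in \<open>auto simp: jet_Suc\<close>)
qed

lemma dpol_deriv_pol_over:
  assumes "derivation \<delta>" "is_subring F" "\<delta> ` F \<subseteq> F" "\<And>l v. (l, v) \<in> V \<Longrightarrow> (Suc l, v) \<in> V" "P \<in> pol_over F V"
  shows "dpol_deriv \<delta> P \<in> pol_over F V"
  using assms(5,2)
proof (induction P rule: pol_over_induct)
  case (Var v)
  then show ?case using assms by (cases v) (auto simp: pol_over_Var)
qed (use assms in \<open>auto simp: derivationD[OF derivation_dpol_deriv] pol_over_Const pol_over_mult pol_over_add\<close>)

lemma map_dpol_deriv:
  assumes "derivation \<delta>" "derivation d" "is_subring F" "\<delta> ` F \<subseteq> F" "hom_on F h" "\<And>c. c \<in> F \<Longrightarrow> h (\<delta> c) = d (h c)"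
    "P \<in> pol_over F V"
  shows "Poly_Mapping.map h (dpol_deriv \<delta> P) = dpol_deriv d (Poly_Mapping.map h P)"
proof -
  note D = derivationD[OF derivation_dpol_deriv[OF assms(1)]] derivationD[OF derivation_dpol_deriv[OF assms(2)]]
  have h: "h 0 = 0" "h 1 = 1" using assms by (auto simp: hom_on_def)
  have P: "P \<in> pol_over F UNIV" using assms(7) pol_over_mono[of F F V UNIV] by (metis subset_UNIV subset_refl subsetD)
  note E = dpol_deriv_pol_over[OF assms(1,3,4), of UNIV]
  show ?thesis
    using P assms(3)
  proof (induction P rule: pol_over_induct)
    case (Var v)
    then show ?case using assms h by (cases v) simp
  next
    case (add P Q)
    then show ?case using E[of P] E[of Q] by (simp add: D map_hom_add[OF assms(3,5), where V=UNIV and W=UNIV])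
  next
    case (mult P Q)
    then show ?case using E[of P] E[of Q]
      by (simp add: D map_hom_add[OF assms(3,5), where V=UNIV and W=UNIV]
          map_hom_mult[OF assms(3,5), where V=UNIV and W=UNIV] pol_over_mult assms(3))
  qed (use assms h in auto)
qed

section \<open>The basis theorem for systems of differential equations\<close>

text \<open>
  A differential ring generated by a field \<open>k\<close> and elements \<open>x\<^sub>0, x\<^sub>1, \<dots>\<close> on which the derivation acts as
  a shift by \<open>N\<close>: these are \<open>N\<close> differential generators with all their derivatives, in an orderly ranking.
\<close>
locale delta_finitely_generated =
  fixes D :: "'w::comm_ring_1 \<Rightarrow> 'w" and k :: "'w set" and x :: "nat \<Rightarrow> 'w" and N :: nat
  assumes D: "derivation D" and k: "is_subring k" "D ` k \<subseteq> k"
    and k_inverse: "\<And>c. c \<in> k \<Longrightarrow> c \<noteq> 0 \<Longrightarrow> \<exists>c'\<in>k. c * c' = 1"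
    and D_x: "\<And>i. D (x i) = x (i + N)" and N: "0 < N"
    and char_0: "\<And>n. 0 < n \<Longrightarrow> of_nat n \<noteq> (0::'w)"
begin

text \<open>This is the ring \<open>k[x 0, ..., x (n - 1)]\<close>. The chain of these rings plays
  the role of a ranking: an element of \<open>W (Suc n)\<close> is read as a univariate polynomial
  in its leader \<open>x n\<close> over \<open>W n\<close>. The \<open>x i\<close> may satisfy
  relations, so such a reading is not unique.\<close>

inductive_set W :: "nat \<Rightarrow> 'w set" for n where
  base: "c \<in> k \<Longrightarrow> c \<in> W n"
| x: "i < n \<Longrightarrow> x i \<in> W n"
| add: "a \<in> W n \<Longrightarrow> b \<in> W n \<Longrightarrow> a + b \<in> W n"
| mult: "a \<in> W n \<Longrightarrow> b \<in> W n \<Longrightarrow> a * b \<in> W n"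

definition R where "R = (\<Union>n. W n)"

lemma W_subring: "is_subring (W n)"
proof -
  have "- a \<in> W n" if "a \<in> W n" for a
    using W.mult[OF W.base[of "- 1" n] that] k by (simp add: is_subringD)
  then show ?thesis using k by (auto simp: is_subring_def intro: W.intros)
qed

lemma W_mono: "m \<le> n \<Longrightarrow> W m \<subseteq> W n"
proof
  fix a assume "m \<le> n" and a: "a \<in> W m"
  from a show "a \<in> W n"
    by induction (use \<open>m \<le> n\<close> in \<open>auto intro: W.intros\<close>)
qed

lemma W_mono': "a \<in> W m \<Longrightarrow> m \<le> n \<Longrightarrow> a \<in> W n"
  using W_mono by blast

lemma W_D: "a \<in> W n \<Longrightarrow> D a \<in> W (n + N)"
proof (induction rule: W.induct)
  case (mult a b)
  then show ?case using W_mono'[of _ n "n + N"]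
    by (simp add: derivationD[OF D]) (meson W.add W.mult le_add1)
next
  case (base c)
  then show ?case using k(2) by (auto intro: W.base)
qed (auto simp: derivationD[OF D] D_x intro: W.intros)

lemma W_0: "W 0 = k"
proof -
  have "a \<in> k" if "a \<in> W 0" for a
    using that by induction (auto simp: is_subringD k)
  then show ?thesis by (auto intro: W.base)
qed

lemma W_Suc: "a \<in> W (Suc n) \<Longrightarrow> \<exists>p. (\<forall>i. coeff p i \<in> W n) \<and> a = poly p (x n)"
proof (induction rule: W.induct)
  case (base c)
  then show ?case using W_subring[of n]
    by (intro exI[of _ "[:c:]"]) (auto simp: coeff_pCons is_subringD W.base split: nat.split)
next
  case (x i)
  show ?case
  proof (cases "i = n")
    case True
    then show ?thesis using W_subring[of n]
      by (intro exI[of _ "[:0, 1:]"]) (auto simp: coeff_pCons is_subringD split: nat.split)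
  next
    case False
    then show ?thesis using W_subring[of n] x
      by (intro exI[of _ "[:x i:]"]) (auto simp: coeff_pCons is_subringD W.x split: nat.split)
  qed
next
  case (add a b)
  then obtain p q where "\<forall>i. coeff p i \<in> W n" "a = poly p (x n)" "\<forall>i. coeff q i \<in> W n" "b = poly q (x n)"
    by blast
  then show ?case by (intro exI[of _ "p + q"]) (auto intro: W.add)
next
  case (mult a b)
  then obtain p q where "\<forall>i. coeff p i \<in> W n" "a = poly p (x n)" "\<forall>i. coeff q i \<in> W n" "b = poly q (x n)"
    by blast
  then show ?case
    by (intro exI[of _ "p * q"]) (auto simp: coeff_mult intro!: is_subring_sum[OF W_subring] W.mult)
qed

lemma R_subring: "is_subring R"
proof -
  have 1: "\<exists>n. a \<in> W n \<and> b \<in> W n" if "a \<in> R" "b \<in> R" for a b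
    using that unfolding R_def by (meson UN_E W_mono' max.cobounded1 max.cobounded2)
  have 2: "W n \<subseteq> R" for n by (auto simp: R_def)
  have "a + b \<in> R \<and> a * b \<in> R" if "a \<in> R" "b \<in> R" for a b
    using 1[OF that] 2 W.add W.mult by blast
  moreover have "- a \<in> R" if "a \<in> R" for a
    using that is_subringD(5)[OF W_subring] by (auto simp: R_def)
  ultimately show ?thesis
    using is_subringD(1,2)[OF W_subring[of 0]] 2[of 0] unfolding is_subring_def by blast
qed

lemma W_R: "a \<in> W n \<Longrightarrow> a \<in> R"
  by (auto simp: R_def)

lemma R_D: "a \<in> R \<Longrightarrow> D a \<in> R"
  unfolding R_def using W_D by blast

text \<open>The value at \<open>y\<close> of the formal derivative of \<open>p\<close>. The
  truncated exponent at \<open>i = 0\<close> does no harm, since its factor is 0.\<close>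

definition separant :: "'w poly \<Rightarrow> 'w \<Rightarrow> 'w" where
  "separant p y = (\<Sum>i\<le>degree p. of_nat i * coeff p i * y ^ (i - 1))"

text \<open>Chain rule. For \<open>y = x n\<close> the new leader \<open>x (n + N)\<close> occurs
  linearly and only in the first summand, with the separant as its coefficient.\<close>

lemma D_poly: "D (poly p y) = separant p y * D y + (\<Sum>i\<le>degree p. D (coeff p i) * y ^ i)"
  unfolding poly_altdef separant_def
  by (simp add: derivation_sum[OF D] derivationD[OF D] derivation_power[OF D] sum.distrib sum_distrib_left
      sum_distrib_right mult_ac add.commute)

end

section \<open>The characteristic set of a prime differential ideal\<close>

locale delta_prime_ideal = delta_finitely_generated +
  fixes P :: "'a set"
  assumes P_R: "P \<subseteq> R" and P_0: "0 \<in> P" and P_1: "1 \<notin> P"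
    and P_add: "\<And>a b. a \<in> P \<Longrightarrow> b \<in> P \<Longrightarrow> a + b \<in> P" and P_mult: "\<And>a b. a \<in> R \<Longrightarrow> b \<in> P \<Longrightarrow> a * b \<in> P"
    and P_D: "\<And>a. a \<in> P \<Longrightarrow> D a \<in> P"
    and P_prime: "\<And>a b. a \<in> R \<Longrightarrow> b \<in> R \<Longrightarrow> a * b \<in> P \<Longrightarrow> a \<in> P \<or> b \<in> P"
begin

text \<open>Such a \<open>p\<close> witnesses that \<open>x n\<close> is algebraic over the fraction
  field of \<open>W n\<close> modulo \<open>P\<close>. The leading coefficient must lie outside
  \<open>P\<close>, as otherwise \<open>p\<close> could degenerate modulo \<open>P\<close>.\<close>

definition dep :: "nat \<Rightarrow> 'a poly \<Rightarrow> bool" where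
  "dep n p \<longleftrightarrow> (\<forall>i. coeff p i \<in> W n) \<and> 0 < degree p \<and> lead_coeff p \<notin> P \<and> poly p (x n) \<in> P"

text \<open>A relation of least degree, the analogue of a minimal polynomial; it is meaningful only
  for those \<open>n\<close> that admit some \<open>dep n p\<close>.\<close>

definition f :: "nat \<Rightarrow> 'a poly" where
  "f n = arg_min degree (dep n)"

lemma f: "dep n p \<Longrightarrow> dep n (f n)" "dep n p \<Longrightarrow> degree (f n) \<le> degree p"
  unfolding f_def by (metis arg_min_natI) (metis arg_min_nat_le)

lemma x_W: "x n \<in> W (Suc n)"
  by (auto intro: W.x)

lemma x_R: "x n \<in> R"
  using W_R[OF x_W] .

lemma P_minus: "a \<in> P \<Longrightarrow> b \<in> P \<Longrightarrow> a - b \<in> P"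
  using P_add[of a "- b"] P_mult[of "- 1" b] R_subring by (simp add: is_subringD)

lemma separant_W: "(\<forall>i. coeff p i \<in> W n) \<Longrightarrow> separant p (x n) \<in> W (Suc n)"
  unfolding separant_def using W_mono'[of _ n "Suc n"]
  by (intro is_subring_sum is_subringD(4) is_subring_power is_subring_of_nat W_subring x_W) auto

text \<open>The separant has smaller degree, and its leading coefficient is a nonzero multiple of that of \<open>f n\<close>.\<close>
lemma separant_notin_P:
  assumes "dep n p"
  shows "separant (f n) (x n) \<notin> P"
proof
  assume s: "separant (f n) (x n) \<in> P"
  define d where "d = degree (f n)"
  have fn: "\<forall>i. coeff (f n) i \<in> W n" "0 < d" "coeff (f n) d \<notin> P"
    using f(1)[OF assms] by (auto simp: dep_def d_def)
  define q where "q = (\<Sum>i<d. monom (of_nat (Suc i) * coeff (f n) (Suc i)) i)"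
  have cq: "coeff q j = (if j < d then of_nat (Suc j) * coeff (f n) (Suc j) else 0)" for j
    by (simp add: q_def coeff_sum coeff_monom)
  have sq: "separant (f n) (x n) = poly q (x n)"
  proof -
    have "{..d} = insert 0 (Suc ` {..<d})" by (simp flip: lessThan_Suc_atMost add: lessThan_Suc_eq_insert_0)
    then show ?thesis
      by (simp add: separant_def q_def poly_sum poly_monom d_def[symmetric] sum.reindex)
  qed
  have "of_nat d * coeff (f n) d \<notin> P"
  proof
    assume a: "of_nat d * coeff (f n) d \<in> P"
    obtain c' where c': "c' \<in> k" "of_nat d * c' = 1"
      using k_inverse[of "of_nat d"] k(1) char_0[OF fn(2)] by (auto simp: is_subring_of_nat)
    have "c' * (of_nat d * coeff (f n) d) \<in> P"
      using P_mult[OF W_R[OF W.base[OF c'(1)]] a] .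
    moreover have "c' * (of_nat d * coeff (f n) d) = (of_nat d * c') * coeff (f n) d" by (simp add: mult_ac)
    ultimately show False using fn(3) c' by simp
  qed
  then have l: "coeff q (d - 1) \<notin> P" using fn(2) by (simp add: cq flip: of_nat_Suc)
  have deg: "degree q = d - 1"
    using l P_0 fn(2) by (intro antisym degree_le le_degree) (auto simp: cq)
  show False
  proof (cases "d = 1")
    \<comment> \<open>A constant derivative is excluded from \<open>dep\<close> by its degree; here
      its value is its leading coefficient, already known to lie outside \<open>P\<close>.\<close>
    case True
    then show False using l s sq cq deg by (auto simp: poly_altdef)
  next
    case False
    have "dep n q"
      unfolding dep_def using s l fn sq deg False
      by (auto simp: cq intro!: W.mult is_subring_of_nat W_subring is_subringD(1) simp del: of_nat_Suc)
    then show False using f(2)[of n q] deg fn(2) d_def by simp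
  qed
qed

definition dependent where "dependent = {n. \<exists>p. dep n p}"

text \<open>Differentiation carries a relation for \<open>n\<close> to one for \<open>n + N\<close>,
  so these indices generate \<open>dependent\<close>; the \<open>f i\<close> with \<open>i\<close>
  in \<open>minimal\<close> form the characteristic set.\<close>

definition minimal where "minimal = {n \<in> dependent. n < N \<or> n - N \<notin> dependent}"

text \<open>Each further application of \<open>D\<close> keeps the separant of \<open>f i\<close> as
  coefficient of the leader, since the derivative of the remainder involves only smaller
  variables.\<close>

lemma D_funpow_f:
  assumes "i \<in> dependent"
  shows "\<exists>r\<in>W (i + Suc q * N). (D ^^ Suc q) (poly (f i) (x i)) = separant (f i) (x i) * x (i + Suc q * N) + r"
proof (induction q)
  case 0
  have c: "\<forall>j. coeff (f i) j \<in> W i" using assms f(1) by (auto simp: dependent_def dep_def)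
  have "(\<Sum>j\<le>degree (f i). D (coeff (f i) j) * x i ^ j) \<in> W (i + N)"
    using c N by (intro is_subring_sum is_subringD(4) is_subring_power W_subring W_D W.x) auto
  then show ?case by (auto simp: D_poly D_x)
next
  case (Suc q)
  let ?n = "i + Suc q * N"
  obtain r where r: "r \<in> W ?n" "(D ^^ Suc q) (poly (f i) (x i)) = separant (f i) (x i) * x ?n + r"
    using Suc by blast
  have "separant (f i) (x i) \<in> W ?n"
    using separant_W[of "f i" i] assms f(1) N by (fastforce simp: dependent_def dep_def intro: W_mono'[of _ "Suc i"])
  then have "D (separant (f i) (x i)) * x ?n + D r \<in> W (?n + N)"
    using r N by (intro W.add W.mult W_D W.x) auto
  moreover have "(D ^^ Suc (Suc q)) (poly (f i) (x i)) =
      separant (f i) (x i) * x (?n + N) + (D (separant (f i) (x i)) * x ?n + D r)"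
    using r(2) by (simp add: derivationD[OF D] D_x algebra_simps)
  moreover have "?n + N = i + Suc (Suc q) * N" by simp
  ultimately show ?case by metis
qed

lemma D_funpow_P: "a \<in> P \<Longrightarrow> (D ^^ q) a \<in> P"
  by (induction q) (auto simp: P_D)

lemma poly_f_P: "i \<in> dependent \<Longrightarrow> poly (f i) (x i) \<in> P"
  using f(1) by (auto simp: dependent_def dep_def)

text \<open>Proper derivatives of \<open>f i\<close> are linear in their leader and hence
  automatically of least degree; one can pseudo-divide by them without knowing \<open>f\<close> at
  the later index.\<close>

lemma dependent_linear:
  assumes "i \<in> dependent"
  shows "\<exists>r\<in>W (i + Suc q * N). dep (i + Suc q * N) [:r, separant (f i) (x i):] \<and>
    poly [:r, separant (f i) (x i):] (x (i + Suc q * N)) = (D ^^ Suc q) (poly (f i) (x i))"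
proof -
  let ?n = "i + Suc q * N" and ?s = "separant (f i) (x i)"
  obtain r where r: "r \<in> W ?n" "(D ^^ Suc q) (poly (f i) (x i)) = ?s * x ?n + r"
    using D_funpow_f[OF assms] by blast
  have s: "?s \<notin> P" using assms separant_notin_P by (auto simp: dependent_def)
  have s': "?s \<in> W ?n"
    using separant_W[of "f i" i] assms f(1) N by (fastforce simp: dependent_def dep_def intro: W_mono'[of _ "Suc i"])
  have "dep ?n [:r, ?s:]"
    unfolding dep_def using s s' r P_0 D_funpow_P[OF poly_f_P[OF assms], of "Suc q"] W_subring[of ?n]
    by (auto simp: coeff_pCons is_subringD algebra_simps split: nat.split)
  then show ?thesis using r by (intro bexI[of _ r]) (auto simp: algebra_simps)
qed

lemma dependent_add: "i \<in> dependent \<Longrightarrow> i + q * N \<in> dependent"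
  using dependent_linear[of i] by (cases q) (auto simp: dependent_def simp del: mult_Suc)

text \<open>Two minimal indices congruent modulo \<open>N\<close> coincide, because
  \<open>dependent\<close> is closed under adding \<open>N\<close>; so there are at most
  \<open>N\<close> of them.\<close>

lemma finite_minimal: "finite minimal"
proof -
  have *: "i = j" if ij: "i \<in> minimal" "j \<in> minimal" "i mod N = j mod N" "i \<le> j" for i j
  proof (rule ccontr)
    assume "i \<noteq> j"
    have "N dvd j - i"
      using mod_eq_dvd_iff_nat[of i j N] ij(3,4) by simp
    then obtain q where q: "j - i = N * q" ..
    obtain q' where "q = Suc q'" using q \<open>i \<noteq> j\<close> ij(4) by (cases q) auto
    moreover have "j = i + N * q" using q ij(4) by simp
    ultimately have "j = i + q' * N + N" by simp
    then have "j - N = i + q' * N" "\<not> j < N" by simp_all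
    moreover have "i + q' * N \<in> dependent" using ij(1) dependent_add by (simp add: minimal_def)
    moreover have "j < N \<or> j - N \<notin> dependent" using ij(2) by (simp add: minimal_def)
    ultimately show False by simp
  qed
  have "inj_on (\<lambda>i. i mod N) minimal"
  proof (rule inj_onI)
    fix i j assume "i \<in> minimal" "j \<in> minimal" "i mod N = j mod N"
    then show "i = j" using *[of i j] *[of j i] by (cases "i \<le> j") auto
  qed
  moreover have "(\<lambda>i. i mod N) ` minimal \<subseteq> {..<N}" using N by auto
  ultimately show ?thesis by (meson finite_imageD finite_lessThan finite_subset)
qed

lemma dependent_minimal: "n \<in> dependent \<Longrightarrow> \<exists>i\<in>minimal. \<exists>q. n = i + q * N"
proof (induction n rule: less_induct)
  case (less n)
  show ?case
  proof (cases "n \<in> minimal")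
    case True
    then show ?thesis by (intro bexI[of _ n] exI[of _ 0]) auto
  next
    case False
    then have "n - N \<in> dependent" "N \<le> n" using less.prems by (auto simp: minimal_def)
    then obtain i q where "i \<in> minimal" "n - N = i + q * N" using less.IH[of "n - N"] N by force
    then show ?thesis using \<open>N \<le> n\<close> by (intro bexI[of _ i] exI[of _ "Suc q"]) auto
  qed
qed

text \<open>Ritt reduction: an element of \<open>P\<close> is pseudo-divided by the characteristic
  set and its derivatives. A nonconstant polynomial over \<open>W n\<close> with leading coefficient
  outside \<open>P\<close> and value in \<open>P\<close> has at least the least degree of a
  relation, so the division never gets stuck, and its multipliers do not vanish under
  \<open>\<phi>\<close>.\<close>

lemma zero_of_characteristic_set:
  fixes \<phi> :: "'a \<Rightarrow> 'b::idom"
  assumes \<phi>: "comm_ring_hom \<phi>" and \<phi>D: "\<And>a. \<phi> a = 0 \<Longrightarrow> \<phi> (D a) = 0"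
    and 0: "\<And>i. i \<in> minimal \<Longrightarrow> \<phi> (poly (f i) (x i)) = 0"
    and 1: "\<And>i. i \<in> minimal \<Longrightarrow> \<phi> (lead_coeff (f i) * separant (f i) (x i)) \<noteq> 0"
  shows "a \<in> P \<inter> W n \<Longrightarrow> \<phi> a = 0"
proof -
  interpret comm_ring_hom \<phi> by fact
  \<comment> \<open>For a minimal index this is \<open>f n\<close> itself, otherwise a derivative of
    some \<open>f i\<close>, whose degree 1 is the least possible and whose leading coefficient is
    the separant of \<open>f i\<close>.\<close>
  have red: "\<exists>p. dep n p \<and> (\<forall>q. dep n q \<longrightarrow> degree p \<le> degree q) \<and> \<phi> (lead_coeff p) \<noteq> 0 \<and> \<phi> (poly p (x n)) = 0"
    if nd: "n \<in> dependent" for n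
  proof -
    obtain i q where i: "i \<in> minimal" and n: "n = i + q * N" using dependent_minimal[OF nd] by blast
    have s: "\<phi> (lead_coeff (f i)) \<noteq> 0" "\<phi> (separant (f i) (x i)) \<noteq> 0" using 1[OF i] by (auto simp: hom_mult)
    show ?thesis
    proof (cases q)
      case q0: 0
      then show ?thesis using n s 0[OF i] nd f by (intro exI[of _ "f i"]) (auto simp: dependent_def)
    next
      case (Suc q')
      have id: "i \<in> dependent" using i by (simp add: minimal_def)
      obtain r where r: "dep n [:r, separant (f i) (x i):]"
        "poly [:r, separant (f i) (x i):] (x n) = (D ^^ q) (poly (f i) (x i))"
        using dependent_linear[OF id, of q'] n Suc by blast
      have "\<phi> ((D ^^ q) (poly (f i) (x i))) = 0"
        by (induction q) (use 0[OF i] \<phi>D in auto)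
      then show ?thesis using r s
        by (intro exI[of _ "[:r, separant (f i) (x i):]"]) (auto simp: dep_def)
    qed
  qed
  show "a \<in> P \<inter> W n \<Longrightarrow> \<phi> a = 0"
  proof (induction n arbitrary: a)
    case 0
    \<comment> \<open>\<open>W 0\<close> is the field \<open>k\<close>, and a unit in
      \<open>P\<close> would give \<open>1 \<in> P\<close>.\<close>
    have "a = 0"
    proof (rule ccontr)
      assume "a \<noteq> 0"
      then obtain c where "c \<in> k" "a * c = 1" using 0 k_inverse W_0 by auto
      then show False using P_mult[of c a] 0 W_R[OF W.base[of c 0]] P_1 by (simp add: mult.commute)
    qed
    then show ?case by simp
  next
    case (Suc n)
    have *: "degree p < e \<Longrightarrow> (\<forall>i. coeff p i \<in> W n) \<Longrightarrow> poly p (x n) \<in> P \<Longrightarrow> \<phi> (poly p (x n)) = 0" for e p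
    proof (induction e arbitrary: p)
      case (Suc e)
      note Wn = W_subring[of n]
      let ?l = "lead_coeff p"
      have l: "?l \<in> W n" using Suc.prems by simp
      show ?case
      proof (cases "degree p = 0")
        case True
        then have "poly p (x n) = coeff p 0" by (simp add: poly_altdef)
        then show ?thesis using Suc.prems \<open>\<And>a. a \<in> P \<inter> W n \<Longrightarrow> \<phi> a = 0\<close> by simp
      next
        case dp: False
        show ?thesis
        proof (cases "?l \<in> P")
          case True
          define p' where "p' = p - monom ?l (degree p)"
          have "degree p' \<le> degree p - 1"
            by (rule degree_le) (use dp in \<open>auto simp: p'_def coeff_monom le_degree intro: coeff_eq_0\<close>)
          moreover have "\<forall>i. coeff p' i \<in> W n"
            using Suc.prems l Wn by (auto simp: p'_def coeff_monom is_subringD)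
          moreover have lm: "?l * x n ^ degree p \<in> P"
            using P_mult[OF is_subring_power[OF R_subring x_R, of n "degree p"] True] by (simp add: mult.commute)
          then have "poly p' (x n) \<in> P"
            using Suc.prems by (simp add: p'_def poly_monom P_minus)
          ultimately have "\<phi> (poly p' (x n)) = 0" using Suc.IH[of p'] Suc.prems dp by simp
          moreover have "\<phi> ?l = 0" using True l \<open>\<And>a. a \<in> P \<inter> W n \<Longrightarrow> \<phi> a = 0\<close> by blast
          ultimately show ?thesis by (simp add: p'_def poly_monom hom_minus hom_mult)
        next
          case False
          then have "dep n p" using Suc.prems dp by (auto simp: dep_def)
          then obtain q where q: "dep n q" "degree q \<le> degree p" "\<phi> (lead_coeff q) \<noteq> 0" "\<phi> (poly q (x n)) = 0"
            using red[of n] by (auto simp: dependent_def)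
          define m where "m = degree p - degree q"
          \<comment> \<open>One step of pseudo-division: the leading terms cancel, and since
            \<open>\<phi> (lead_coeff q) \<noteq> 0\<close> the factor put on \<open>p\<close> can
            be removed in the integral domain.\<close>
          define p' where "p' = smult (lead_coeff q) p - monom ?l m * q"
          have qW: "\<forall>i. coeff q i \<in> W n" and qP: "poly q (x n) \<in> P" using q by (auto simp: dep_def)
          have "degree p' \<le> degree p - 1"
          proof (rule degree_le, intro allI impI)
            fix i assume "degree p - 1 < i"
            then consider "i = degree p" | "i > degree p" by linarith
            then show "coeff p' i = 0"
              by cases (use q in \<open>auto simp: p'_def coeff_monom_mult m_def coeff_eq_0 mult.commute[of "lead_coeff q"]\<close>)
          qed
          moreover have "\<forall>i. coeff p' i \<in> W n"
            using Suc.prems l Wn qW by (auto simp: p'_def coeff_monom_mult is_subringD)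
          moreover have "lead_coeff q * poly p (x n) - ?l * x n ^ m * poly q (x n) \<in> P"
            using Suc.prems qP qW l
            by (intro P_minus P_mult is_subringD(4)[OF R_subring] is_subring_power[OF R_subring x_R]) (auto intro: W_R)
          then have "poly p' (x n) \<in> P" by (simp add: p'_def poly_monom)
          ultimately have "\<phi> (poly p' (x n)) = 0" using Suc.IH[of p'] Suc.prems dp by simp
          then show ?thesis using q by (simp add: p'_def poly_monom hom_minus hom_mult)
        qed
      qed
    qed simp
    obtain p where "\<forall>i. coeff p i \<in> W n" "a = poly p (x n)" using W_Suc Suc.prems by blast
    then show ?case using *[of p "Suc (degree p)"] Suc.prems by simp
  qed
qed

end

section \<open>Systems with the same zeros as a finite subsystem\<close>

context delta_finitely_generated
begin

text \<open>The basis property phrased through common zeros in \<open>\<Phi>\<close> instead of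
  radical differential ideals, which is the form in which it is applied to the equations of the
  group.\<close>

definition finitely_determined :: "('w \<Rightarrow> 'b::idom) set \<Rightarrow> 'w set \<Rightarrow> bool" where
  "finitely_determined \<Phi> \<Sigma> \<longleftrightarrow>
     (\<exists>S. finite S \<and> S \<subseteq> \<Sigma> \<and> (\<forall>\<phi>\<in>\<Phi>. (\<forall>s\<in>S. \<phi> s = 0) \<longrightarrow> (\<forall>s\<in>\<Sigma>. \<phi> s = 0)))"

lemma finitely_determinedI:
  assumes "finite S" "S \<subseteq> \<Sigma>" "\<And>\<phi> s. \<phi> \<in> \<Phi> \<Longrightarrow> \<forall>s\<in>S. \<phi> s = 0 \<Longrightarrow> s \<in> \<Sigma> \<Longrightarrow> \<phi> s = 0"
  shows "finitely_determined \<Phi> \<Sigma>"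
  unfolding finitely_determined_def using assms by blast

text \<open>
  A maximal set that is not finitely determined would be a prime differential ideal; its zeros are
  then those of a characteristic set, together with the zeros satisfying one more equation.
\<close>
theorem basis_theorem:
  fixes \<Phi> :: "('w \<Rightarrow> 'b::idom) set"
  assumes hom: "\<And>\<phi>. \<phi> \<in> \<Phi> \<Longrightarrow> comm_ring_hom \<phi>"
    and homD: "\<And>\<phi> a. \<phi> \<in> \<Phi> \<Longrightarrow> \<phi> a = 0 \<Longrightarrow> \<phi> (D a) = 0"
    and "\<Sigma> \<subseteq> R"
  shows "finitely_determined \<Phi> \<Sigma>"
proof (rule ccontr)
  define bad where "bad = {\<Sigma>. \<Sigma> \<subseteq> R \<and> \<not> finitely_determined \<Phi> \<Sigma>}"
  assume "\<not> finitely_determined \<Phi> \<Sigma>"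
  then have ne: "bad \<noteq> {}" using assms(3) by (auto simp: bad_def)
  have "\<Union>C \<in> bad" if C: "C \<noteq> {}" "subset.chain bad C" for C
  proof -
    have CR: "\<Sigma> \<subseteq> R \<and> \<not> finitely_determined \<Phi> \<Sigma>" if "\<Sigma> \<in> C" for \<Sigma>
      using C(2) that by (auto simp: subset.chain_def bad_def)
    have "\<not> finitely_determined \<Phi> (\<Union>C)"
    proof
      assume "finitely_determined \<Phi> (\<Union>C)"
      then obtain S where S: "finite S" "S \<subseteq> \<Union>C" "\<forall>\<phi>\<in>\<Phi>. (\<forall>s\<in>S. \<phi> s = 0) \<longrightarrow> (\<forall>s\<in>\<Union>C. \<phi> s = 0)"
        by (auto simp: finitely_determined_def)
      obtain B where "B \<in> C" "S \<subseteq> B"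
        using finite_subset_Union_chain[OF S(1,2) C] by blast
      then have "finitely_determined \<Phi> B" using S unfolding finitely_determined_def by (intro exI[of _ S]) auto
      then show False using CR \<open>B \<in> C\<close> by blast
    qed
    then show ?thesis using CR by (auto simp: bad_def)
  qed
  then obtain P where P: "P \<in> bad" and max: "\<And>X. X \<in> bad \<Longrightarrow> P \<subseteq> X \<Longrightarrow> X = P"
    using subset_Zorn_nonempty[OF ne] by blast
  have PR: "P \<subseteq> R" and nfd: "\<not> finitely_determined \<Phi> P" using P by (auto simp: bad_def)
  \<comment> \<open>\<open>S\<close> suffices for \<open>P\<close> once the single equation
    \<open>a = 0\<close> is added; by maximality of \<open>P\<close> such an \<open>S\<close> exists
    for every \<open>a\<close> in \<open>R\<close> outside \<open>P\<close>.\<close>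
  define determines where "determines a S \<longleftrightarrow> finite S \<and> S \<subseteq> P \<and>
      (\<forall>\<phi>\<in>\<Phi>. \<phi> a = 0 \<longrightarrow> (\<forall>s\<in>S. \<phi> s = 0) \<longrightarrow> (\<forall>s\<in>P. \<phi> s = 0))" for a S
  have detD: "finite S" "S \<subseteq> P" "\<And>\<phi> s. \<phi> \<in> \<Phi> \<Longrightarrow> \<phi> a = 0 \<Longrightarrow> (\<And>s. s \<in> S \<Longrightarrow> \<phi> s = 0) \<Longrightarrow> s \<in> P \<Longrightarrow> \<phi> s = 0"
    if "determines a S" for a S
    using that unfolding determines_def by blast+
  have ext: "\<exists>S. determines a S" if "a \<in> R" "a \<notin> P" for a
  proof -
    have "finitely_determined \<Phi> (insert a P)"
      using max[of "insert a P"] that PR by (auto simp: bad_def)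
    then obtain S where S: "finite S" "S \<subseteq> insert a P" "\<forall>\<phi>\<in>\<Phi>. (\<forall>s\<in>S. \<phi> s = 0) \<longrightarrow> (\<forall>s\<in>insert a P. \<phi> s = 0)"
      by (auto simp: finitely_determined_def)
    have "determines a (S - {a})"
      unfolding determines_def using S(1,2) S(3) by blast
    then show ?thesis ..
  qed
  \<comment> \<open>A consequence of finitely many elements of \<open>P\<close> already lies in
    \<open>P\<close>. Closure of \<open>P\<close> under sums, multiples and \<open>D\<close> are
    instances of this.\<close>
  have closed: "a \<in> P"
    if a: "a \<in> R" "finite T" "T \<subseteq> P" "\<And>\<phi>. \<phi> \<in> \<Phi> \<Longrightarrow> (\<forall>s\<in>T. \<phi> s = 0) \<Longrightarrow> \<phi> a = 0" for a T
  proof (rule ccontr)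
    assume "a \<notin> P"
    from ext[OF a(1) this] obtain S where "determines a S" ..
    note S = detD[OF this]
    have z: "\<phi> s = 0" if "\<phi> \<in> \<Phi>" "\<forall>s\<in>S \<union> T. \<phi> s = 0" "s \<in> P" for \<phi> s
      by (rule S(3)[OF that(1) a(4)[OF that(1)] _ that(3)]) (use that(2) in auto)
    have "finite (S \<union> T)" "S \<union> T \<subseteq> P" using S(1,2) a(2,3) by auto
    then have "finitely_determined \<Phi> P" by (rule finitely_determinedI) (rule z)
    then show False using nfd by simp
  qed
  have h: "\<phi> (a + b) = \<phi> a + \<phi> b" "\<phi> (a * b) = \<phi> a * \<phi> b" "\<phi> 0 = 0" "\<phi> 1 = 1" if "\<phi> \<in> \<Phi>" for \<phi> a b
    using hom[OF that] unfolding hom_on_UNIV[symmetric] by (auto simp: hom_on_def)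
  interpret delta_prime_ideal D k x N P
  proof
    show "P \<subseteq> R" by fact
    show "0 \<in> P" by (rule closed[of _ "{}"]) (auto simp: h is_subringD R_subring)
    show "1 \<notin> P"
    proof
      assume "1 \<in> P"
      then have "finitely_determined \<Phi> P"
        unfolding finitely_determined_def by (intro exI[of _ "{1}"]) (auto simp: h)
      then show False using nfd by simp
    qed
    show "a + b \<in> P" if "a \<in> P" "b \<in> P" for a b
      by (rule closed[of _ "{a, b}"]) (use that PR R_subring in \<open>auto simp: h is_subringD subset_iff\<close>)
    show "a * b \<in> P" if "a \<in> R" "b \<in> P" for a b
      by (rule closed[of _ "{b}"]) (use that PR R_subring in \<open>auto simp: h is_subringD subset_iff\<close>)
    show "D a \<in> P" if "a \<in> P" for a
      by (rule closed[of _ "{a}"]) (use that PR R_D homD in auto)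
    show "a \<in> P \<or> b \<in> P" if "a \<in> R" "b \<in> R" "a * b \<in> P" for a b
    proof (rule ccontr)
      assume "\<not> (a \<in> P \<or> b \<in> P)"
      then have "a \<notin> P" "b \<notin> P" by auto
      from ext[OF that(1) this(1)] obtain S where "determines a S" ..
      note S = detD[OF this]
      from ext[OF that(2) \<open>b \<notin> P\<close>] obtain T where "determines b T" ..
      note T = detD[OF this]
      \<comment> \<open>A zero of \<open>a * b\<close> is a zero of \<open>a\<close> or of
        \<open>b\<close>, as the values lie in a domain; each alternative is settled by one of the
        two finite sets.\<close>
      have z: "\<phi> s = 0" if "\<phi> \<in> \<Phi>" "\<forall>s\<in>insert (a * b) (S \<union> T). \<phi> s = 0" "s \<in> P" for \<phi> s
      proof -
        have "\<phi> a = 0 \<or> \<phi> b = 0" using that(2) h(2)[OF that(1), of a b] by simp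
        then show ?thesis using S(3)[OF that(1) _ _ that(3)] T(3)[OF that(1) _ _ that(3)] that(2) by blast
      qed
      have "finite (insert (a * b) (S \<union> T))" "insert (a * b) (S \<union> T) \<subseteq> P" using S(1,2) T(1,2) that(3) by auto
      then have "finitely_determined \<Phi> P" by (rule finitely_determinedI) (rule z)
      then show False using nfd by simp
    qed
  qed
  \<comment> \<open>The product of all initials and separants lies outside the prime
    \<open>P\<close>. Points at which it vanishes are controlled by \<open>ext\<close>, the others
    by the characteristic set.\<close>
  define c where "c i = lead_coeff (f i) * separant (f i) (x i)" for i
  define b where "b = prod c minimal"
  have c: "c i \<in> R" "c i \<notin> P" if "i \<in> minimal" for i
  proof -
    have "\<exists>p. dep i p" using that by (auto simp: minimal_def dependent_def)
    then have d: "dep i (f i)" "separant (f i) (x i) \<notin> P" using f(1) separant_notin_P by auto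
    then have "lead_coeff (f i) \<in> R" "lead_coeff (f i) \<notin> P" "separant (f i) (x i) \<in> R"
      using separant_W[of "f i" i] by (auto simp: dep_def intro: W_R)
    then show "c i \<in> R" "c i \<notin> P"
      unfolding c_def using P_prime d(2) is_subringD(4)[OF R_subring] by blast+
  qed
  have "prod c A \<in> R - P" if "finite A" "A \<subseteq> minimal" for A
    using that
  proof (induction A rule: finite_induct)
    case empty
    then show ?case using P_1 is_subringD(2)[OF R_subring] by simp
  next
    case (insert i A)
    then have i: "c i \<in> R" "c i \<notin> P" "prod c A \<in> R" "prod c A \<notin> P" using c by auto
    then have "c i * prod c A \<in> R" "c i * prod c A \<notin> P"
      using P_prime[of "c i" "prod c A"] is_subringD(4)[OF R_subring] by blast+
    then show ?case using insert.hyps by simp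
  qed
  then have bR: "b \<in> R" and "b \<notin> P" using finite_minimal by (auto simp: b_def)
  from ext[OF this] obtain S where "determines b S" ..
  note S = detD[OF this]
  let ?F = "(\<lambda>i. poly (f i) (x i)) ` minimal"
  have z: "\<phi> s = 0" if \<phi>: "\<phi> \<in> \<Phi>" "\<forall>s\<in>S \<union> ?F. \<phi> s = 0" and s: "s \<in> P" for \<phi> s
  proof (cases "\<phi> b = 0")
    case True
    then show ?thesis using S(3)[OF \<phi>(1) _ _ s] \<phi>(2) by blast
  next
    case False
    interpret \<phi>: comm_ring_hom \<phi> using hom \<phi> by blast
    obtain n where "s \<in> W n" using s PR by (auto simp: R_def)
    then show ?thesis
    proof (intro zero_of_characteristic_set[OF hom[OF \<phi>(1)], of s n])
      show "\<phi> (lead_coeff (f i) * separant (f i) (x i)) \<noteq> 0" if "i \<in> minimal" for i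
        using False that finite_minimal by (auto simp: b_def c_def \<phi>.hom_prod)
      show "\<phi> (poly (f i) (x i)) = 0" if "i \<in> minimal" for i
        using \<phi>(2) that by blast
    qed (use \<phi>(1) homD s in blast)+
  qed
  have "finite (S \<union> ?F)" "S \<union> ?F \<subseteq> P"
    using S(1,2) finite_minimal by (auto simp: poly_f_P minimal_def)
  then have "finitely_determined \<Phi> P" by (rule finitely_determinedI) (rule z)
  then show False using nfd by simp
qed

end

section \<open>Coordinates with respect to a subfield\<close>

text \<open>The \<open>F\<close>-linear functionals on the target field, a vector space over
  \<open>F\<close> via \<open>\<iota>\<close>. They take the place of tensor products in all base
  changes below.\<close>

definition flinear :: "'a::field set \<Rightarrow> ('a \<Rightarrow> 'b::field) \<Rightarrow> ('b \<Rightarrow> 'a) \<Rightarrow> bool" where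
  "flinear F \<iota> \<mu> \<longleftrightarrow> (\<forall>u v. \<mu> (u + v) = \<mu> u + \<mu> v) \<and> (\<forall>a\<in>F. \<forall>u. \<mu> (\<iota> a * u) = a * \<mu> u) \<and> (\<forall>u. \<mu> u \<in> F)"

lemma flinearD:
  assumes "flinear F \<iota> \<mu>"
  shows "\<mu> (u + v) = \<mu> u + \<mu> v" "a \<in> F \<Longrightarrow> \<mu> (\<iota> a * u) = a * \<mu> u" "\<mu> u \<in> F" "\<mu> 0 = 0"
    "\<mu> (\<Sum>i\<in>A. f i) = (\<Sum>i\<in>A. \<mu> (f i))"
proof -
  show a: "\<mu> (u + v) = \<mu> u + \<mu> v" for u v using assms by (auto simp: flinear_def)
  show z: "\<mu> 0 = 0" using a[of 0 0] by (simp only: add_0_left add_cancel_right_right)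
  show "\<mu> (\<Sum>i\<in>A. f i) = (\<Sum>i\<in>A. \<mu> (f i))"
    by (induction A rule: infinite_finite_induct) (auto simp: z a)
qed (use assms in \<open>auto simp: flinear_def\<close>)

lemma flinear_mult: "flinear F \<iota> \<mu> \<Longrightarrow> flinear F \<iota> (\<lambda>u. \<mu> (w * u))"
  by (simp add: flinear_def distrib_left mult.left_commute[of w])

text \<open>One notion for three base changes: \<open>K\<close> into \<open>U\<close>,
  \<open>K\<close> into \<open>L\<close> by the identity, and the fixed field into
  \<open>U\<close>.\<close>

locale field_embedding =
  fixes F :: "'a::field set" and \<iota> :: "'a \<Rightarrow> 'b::field"
  assumes subfield: "is_subfield F" and hom: "hom_on F \<iota>"
begin

lemma subring: "is_subring F"
  using subfield by (rule is_subfield_imp_is_subring)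

lemma inverse_mem: "a \<in> F \<Longrightarrow> inverse a \<in> F"
  using subfield by (simp add: is_subfield_def)

lemma \<iota>: "\<iota> 0 = 0" "\<iota> 1 = 1" "a \<in> F \<Longrightarrow> b \<in> F \<Longrightarrow> \<iota> (a + b) = \<iota> a + \<iota> b" "a \<in> F \<Longrightarrow> b \<in> F \<Longrightarrow> \<iota> (a * b) = \<iota> a * \<iota> b"
  using hom by (auto simp: hom_on_def)

lemma \<iota>_minus: "a \<in> F \<Longrightarrow> \<iota> (- a) = - \<iota> a"
  using \<iota>(3)[of a "- a"] \<iota>(1) subring by (simp add: is_subringD eq_neg_iff_add_eq_0 add.commute)

definition indep :: "'b set \<Rightarrow> bool" where
  "indep B \<longleftrightarrow> (\<forall>A c. finite A \<longrightarrow> A \<subseteq> B \<longrightarrow> (\<forall>b\<in>A. c b \<in> F) \<longrightarrow> (\<Sum>b\<in>A. \<iota> (c b) * b) = 0 \<longrightarrow> (\<forall>b\<in>A. c b = 0))"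

lemma indepD: "indep B \<Longrightarrow> finite A \<Longrightarrow> A \<subseteq> B \<Longrightarrow> (\<And>b. b \<in> A \<Longrightarrow> c b \<in> F) \<Longrightarrow> (\<Sum>b\<in>A. \<iota> (c b) * b) = 0 \<Longrightarrow> b \<in> A \<Longrightarrow> c b = 0"
  unfolding indep_def by blast

lemma maximal_indep: "\<exists>B. indep B \<and> (\<forall>B'. indep B' \<longrightarrow> B \<subseteq> B' \<longrightarrow> B' = B)"
proof -
  have "\<exists>M\<in>Collect indep. \<forall>X\<in>Collect indep. M \<subseteq> X \<longrightarrow> X = M"
  proof (rule subset_Zorn_nonempty)
    show "Collect indep \<noteq> {}" by (auto simp: indep_def intro: exI[of _ "{}"])
    fix C assume C: "C \<noteq> {}" "subset.chain (Collect indep) C"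
    have "indep (\<Union>C)"
      unfolding indep_def
    proof (intro allI impI)
      fix A c assume A: "finite A" "A \<subseteq> \<Union>C" "\<forall>b\<in>A. c b \<in> F" "(\<Sum>b\<in>A. \<iota> (c b) * b) = 0"
      obtain B where "B \<in> C" "A \<subseteq> B"
        using finite_subset_Union_chain[OF A(1,2) C] by blast
      moreover have "indep B" using C(2) \<open>B \<in> C\<close> by (auto simp: subset.chain_def)
      ultimately show "\<forall>b\<in>A. c b = 0" using A unfolding indep_def by blast
    qed
    then show "\<Union>C \<in> Collect indep" by simp
  qed
  then show ?thesis by auto
qed

definition represents :: "'b set \<Rightarrow> 'b \<Rightarrow> ('b \<Rightarrow> 'a) \<Rightarrow> bool" where
  "represents B u c \<longleftrightarrow> (\<forall>b. c b \<in> F) \<and>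
     (\<exists>A. finite A \<and> A \<subseteq> B \<and> (\<forall>b. b \<notin> A \<longrightarrow> c b = 0) \<and> u = (\<Sum>b\<in>A. \<iota> (c b) * b))"

lemma represents_superset:
  assumes "finite A'" "A \<subseteq> A'" "\<forall>b. b \<notin> A \<longrightarrow> c b = 0" "u = (\<Sum>b\<in>A. \<iota> (c b) * b)"
  shows "u = (\<Sum>b\<in>A'. \<iota> (c b) * b)"
  unfolding assms(4) by (rule sum.mono_neutral_left) (use assms in \<open>auto simp: \<iota>\<close>)

lemma represents_add:
  assumes "represents B u c" "represents B v d"
  shows "represents B (u + v) (\<lambda>b. c b + d b)"
proof -
  obtain A where A: "finite A" "A \<subseteq> B" "\<forall>b. b \<notin> A \<longrightarrow> c b = 0" "u = (\<Sum>b\<in>A. \<iota> (c b) * b)"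
    using assms(1) by (auto simp: represents_def)
  obtain A' where A': "finite A'" "A' \<subseteq> B" "\<forall>b. b \<notin> A' \<longrightarrow> d b = 0" "v = (\<Sum>b\<in>A'. \<iota> (d b) * b)"
    using assms(2) by (auto simp: represents_def)
  have F: "c b \<in> F" "d b \<in> F" for b using assms by (auto simp: represents_def)
  have "u = (\<Sum>b\<in>A \<union> A'. \<iota> (c b) * b)" "v = (\<Sum>b\<in>A \<union> A'. \<iota> (d b) * b)"
    using represents_superset[of "A \<union> A'" A c u] represents_superset[of "A \<union> A'" A' d v] A A' by auto
  then have "u + v = (\<Sum>b\<in>A \<union> A'. \<iota> (c b + d b) * b)"
    by (simp add: \<iota> F distrib_right sum.distrib)
  then show ?thesis unfolding represents_def
    using A A' F is_subringD(3)[OF subring] by (intro conjI allI exI[of _ "A \<union> A'"]) auto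
qed

lemma represents_scale:
  assumes "represents B u c" "a \<in> F"
  shows "represents B (\<iota> a * u) (\<lambda>b. a * c b)"
proof -
  obtain A where A: "finite A" "A \<subseteq> B" "\<forall>b. b \<notin> A \<longrightarrow> c b = 0" "u = (\<Sum>b\<in>A. \<iota> (c b) * b)"
    using assms(1) by (auto simp: represents_def)
  have F: "c b \<in> F" for b using assms by (auto simp: represents_def)
  have "\<iota> a * u = (\<Sum>b\<in>A. \<iota> (a * c b) * b)"
    by (simp add: A(4) \<iota> F assms(2) sum_distrib_left mult.assoc)
  then show ?thesis unfolding represents_def
    using A F assms(2) is_subringD(4)[OF subring] by (intro conjI allI exI[of _ A]) auto
qed

lemma represents_0:
  assumes "indep B" "represents B 0 c"
  shows "c b = 0"
proof -
  obtain A where A: "finite A" "A \<subseteq> B" "\<forall>b. b \<notin> A \<longrightarrow> c b = 0" "0 = (\<Sum>b\<in>A. \<iota> (c b) * b)"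
    using assms(2) by (auto simp: represents_def)
  have "c b \<in> F" for b using assms(2) by (auto simp: represents_def)
  then show ?thesis using indepD[OF assms(1) A(1,2) _ A(4)[symmetric]] A(3) by blast
qed

lemma represents_unique:
  assumes "indep B" "represents B u c" "represents B u d"
  shows "c = d"
proof
  fix b
  have "represents B (\<iota> (- 1) * u) (\<lambda>b. - 1 * d b)"
    by (rule represents_scale) (use assms(3) subring in \<open>auto simp: is_subringD\<close>)
  then have "represents B (\<iota> (- 1) * u + u) (\<lambda>b. - 1 * d b + c b)"
    by (rule represents_add) fact
  moreover have "\<iota> (- 1) * u + u = 0" using \<iota>_minus[of 1] subring by (simp add: \<iota> is_subringD)
  ultimately show "c b = d b" using represents_0[OF assms(1), of _ b] by fastforce
qed

lemma represents_exists:
  assumes B: "indep B" and max: "\<forall>B'. indep B' \<longrightarrow> B \<subseteq> B' \<longrightarrow> B' = B"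
  shows "\<exists>c. represents B u c"
proof (cases "u \<in> B")
  case True
  have "represents B u (\<lambda>b. if b = u then 1 else 0)"
    unfolding represents_def using subring True
    by (auto simp: is_subringD \<iota> intro!: exI[of _ "{u}"])
  then show ?thesis by (intro exI)
next
  case False
  then have "\<not> indep (insert u B)" using max by blast
  then obtain A c b0 where A: "finite A" "A \<subseteq> insert u B" "\<forall>b\<in>A. c b \<in> F" "(\<Sum>b\<in>A. \<iota> (c b) * b) = 0"
    and b0: "b0 \<in> A" "c b0 \<noteq> 0"
    unfolding indep_def by blast
  have u: "u \<in> A"
  proof (rule ccontr)
    assume "u \<notin> A"
    then have "A \<subseteq> B" using A(2) by blast
    from indepD[OF B A(1) this _ A(4) b0(1)] show False using A(3) b0(2) by blast
  qed
  define A' where "A' = A - {u}"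
  have A': "finite A'" "A' \<subseteq> B" "u \<notin> A'" "A = insert u A'" using A u by (auto simp: A'_def)
  have s: "\<iota> (c u) * u + (\<Sum>b\<in>A'. \<iota> (c b) * b) = 0" using A(4) A' by simp
  have cu: "c u \<noteq> 0"
  proof
    assume "c u = 0"
    then have s': "(\<Sum>b\<in>A'. \<iota> (c b) * b) = 0" using s by (simp add: \<iota>)
    have "c b = 0" if "b \<in> A'" for b
      using indepD[OF B A'(1,2) _ s' that] A(3) A'(4) by blast
    then show False using b0 A'(4) \<open>c u = 0\<close> by blast
  qed
  define d where "d b = (if b \<in> A' then - (inverse (c u) * c b) else 0)" for b
  have i: "inverse (c u) \<in> F" "c u \<in> F" using A(3) u inverse_mem by auto
  have dF: "d b \<in> F" for b using A(3) A'(4) i subring by (auto simp: d_def is_subringD)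
  have "\<iota> (inverse (c u)) * \<iota> (c u) = 1" using i cu \<iota> by (metis left_inverse)
  then have "u = \<iota> (inverse (c u)) * (\<iota> (c u) * u)" by (simp add: mult.assoc[symmetric])
  also have "\<iota> (c u) * u = - (\<Sum>b\<in>A'. \<iota> (c b) * b)" using s by (simp only: eq_neg_iff_add_eq_0)
  also have "\<iota> (inverse (c u)) * - (\<Sum>b\<in>A'. \<iota> (c b) * b) = (\<Sum>b\<in>A'. \<iota> (d b) * b)"
    unfolding mult_minus_right sum_distrib_left sum_negf[symmetric]
    by (rule sum.cong) (use A(3) A'(4) i subring in \<open>auto simp: d_def \<iota>_minus \<iota> is_subringD\<close>)
  finally have "represents B u d"
    unfolding represents_def using dF A' by (intro conjI allI exI[of _ A']) (auto simp: d_def)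
  then show ?thesis by (intro exI)
qed

text \<open>A maximal independent set is a basis; for \<open>b\<close> outside it the coordinate is
  constantly 0, so the functionals can be indexed by all elements of the field.\<close>

theorem coordinates:
  obtains coord where "\<And>b. flinear F \<iota> (coord b)" "\<And>u. finite {b. coord b u \<noteq> 0}"
    "\<And>u. u = (\<Sum>b | coord b u \<noteq> 0. \<iota> (coord b u) * b)"
proof -
  obtain B where B: "indep B" "\<forall>B'. indep B' \<longrightarrow> B \<subseteq> B' \<longrightarrow> B' = B" using maximal_indep by blast
  obtain rep where rep: "\<And>u. represents B u (rep u)" using represents_exists[OF B] by metis
  show ?thesis
  proof (rule that[of "\<lambda>b u. rep u b"])
    fix b
    show "flinear F \<iota> (\<lambda>u. rep u b)"
      unfolding flinear_def
    proof (intro conjI allI ballI)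
      fix u v
      show "rep (u + v) b = rep u b + rep v b"
        using represents_unique[OF B(1) rep represents_add[OF rep rep], of u v] by simp
      show "rep u b \<in> F" using rep[of u] by (simp add: represents_def)
      fix a assume "a \<in> F"
      show "rep (\<iota> a * u) b = a * rep u b"
        using represents_unique[OF B(1) rep represents_scale[OF rep \<open>a \<in> F\<close>], of u] by simp
    qed
  next
    fix u
    obtain A where A: "finite A" "\<forall>b. b \<notin> A \<longrightarrow> rep u b = 0" "u = (\<Sum>b\<in>A. \<iota> (rep u b) * b)"
      using rep[of u] by (auto simp: represents_def)
    have sub: "{b. rep u b \<noteq> 0} \<subseteq> A" using A(2) by blast
    show "finite {b. rep u b \<noteq> 0}" by (rule finite_subset[OF sub A(1)])
    have "(\<Sum>b | rep u b \<noteq> 0. \<iota> (rep u b) * b) = (\<Sum>b\<in>A. \<iota> (rep u b) * b)"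
      by (rule sum.mono_neutral_left) (use A(1) sub \<iota>(1) in auto)
    then show "u = (\<Sum>b | rep u b \<noteq> 0. \<iota> (rep u b) * b)" using A(3) by simp
  qed
qed

lemma eq_0_if_flinear:
  assumes "\<And>\<mu>. flinear F \<iota> \<mu> \<Longrightarrow> \<mu> u = 0"
  shows "u = 0"
proof (rule coordinates)
  fix coord assume c: "\<And>b. flinear F \<iota> (coord b)" "\<And>u. u = (\<Sum>b | coord b u \<noteq> 0. \<iota> (coord b u) * b)"
  have "coord b u = 0" for b using assms[OF c(1)] .
  then show "u = 0" using c(2)[of u] by simp
qed

text \<open>All coefficients are expanded in one basis; finitely many basis elements suffice because
  there are finitely many coefficients.\<close>

lemma mpol_coordinates:
  obtains A \<mu> where "finite A" "\<And>b. flinear F \<iota> (\<mu> b)"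
    "P = (\<Sum>b\<in>A. Const b * Poly_Mapping.map \<iota> (Poly_Mapping.map (\<mu> b) P))"
proof -
  obtain \<mu> where l: "\<And>b. flinear F \<iota> (\<mu> b)" "\<And>u. finite {b. \<mu> b u \<noteq> 0}"
    "\<And>u. u = (\<Sum>b | \<mu> b u \<noteq> 0. \<iota> (\<mu> b u) * b)"
    by (rule coordinates) (rule that)
  define A where "A = (\<Union>t\<in>Poly_Mapping.keys P. {b. \<mu> b (Poly_Mapping.lookup P t) \<noteq> 0})"
  have A: "finite A" using l(2) by (auto simp: A_def)
  have l0: "\<mu> b 0 = 0" for b using flinearD(4)[OF l(1)] .
  have "P = (\<Sum>b\<in>A. Const b * Poly_Mapping.map \<iota> (Poly_Mapping.map (\<mu> b) P))"
  proof (rule poly_mapping_eqI)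
    fix t
    let ?u = "Poly_Mapping.lookup P t"
    have "{b. \<mu> b ?u \<noteq> 0} \<subseteq> A"
      by (cases "t \<in> Poly_Mapping.keys P") (auto simp: A_def in_keys_iff l0)
    then have "(\<Sum>b | \<mu> b ?u \<noteq> 0. \<iota> (\<mu> b ?u) * b) = (\<Sum>b\<in>A. \<iota> (\<mu> b ?u) * b)"
      by (intro sum.mono_neutral_left A) (auto simp: \<iota>)
    then show "?u = Poly_Mapping.lookup (\<Sum>b\<in>A. Const b * Poly_Mapping.map \<iota> (Poly_Mapping.map (\<mu> b) P)) t"
      using l(3)[of ?u] by (simp add: lookup_sum lookup_Const_mult lookup_map l0 \<iota> mult.commute)
  qed
  then show ?thesis using that A l(1) by blast
qed

end

section \<open>Extension of ideals\<close>

definition is_ideal_in :: "'r::comm_ring_1 set \<Rightarrow> 'r set \<Rightarrow> bool" where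
  "is_ideal_in R I \<longleftrightarrow> I \<subseteq> R \<and> 0 \<in> I \<and> (\<forall>x\<in>I. \<forall>y\<in>I. x + y \<in> I) \<and> (\<forall>r\<in>R. \<forall>x\<in>I. r * x \<in> I)"

lemma is_ideal_inD:
  assumes "is_ideal_in R I"
  shows "x \<in> I \<Longrightarrow> x \<in> R" "0 \<in> I" "x \<in> I \<Longrightarrow> y \<in> I \<Longrightarrow> x + y \<in> I" "r \<in> R \<Longrightarrow> x \<in> I \<Longrightarrow> r * x \<in> I"
  using assms by (auto simp: is_ideal_in_def)

lemma is_ideal_in_sum: "is_ideal_in R I \<Longrightarrow> (\<And>i. i \<in> A \<Longrightarrow> f i \<in> I) \<Longrightarrow> sum f A \<in> I"
  by (induction A rule: infinite_finite_induct) (auto simp: is_ideal_inD)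

lemma ideal_generated_is_ideal:
  assumes R: "is_subring R" and S: "S \<subseteq> R"
  shows "is_ideal_in R (ideal_generated R S)"
  unfolding is_ideal_in_def
proof (intro conjI ballI subsetI)
  note rs = is_subringD[OF R]
  show "x \<in> R" if "x \<in> ideal_generated R S" for x
    using that S rs(4) unfolding ideal_generated_def by (auto intro!: is_subring_sum[OF R])
  show "0 \<in> ideal_generated R S"
    unfolding ideal_generated_def by (intro CollectI exI[of _ "{}"]) auto
  show "x + y \<in> ideal_generated R S" if xy: "x \<in> ideal_generated R S" "y \<in> ideal_generated R S" for x y
  proof -
    obtain T c where T: "finite T" "T \<subseteq> S" "\<forall>p\<in>T. c p \<in> R" "x = (\<Sum>p\<in>T. c p * p)"
      using xy(1) unfolding ideal_generated_def by blast
    obtain T' c' where T': "finite T'" "T' \<subseteq> S" "\<forall>p\<in>T'. c' p \<in> R" "y = (\<Sum>p\<in>T'. c' p * p)"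
      using xy(2) unfolding ideal_generated_def by blast
    define d where "d p = (if p \<in> T then c p else 0) + (if p \<in> T' then c' p else 0)" for p
    have "x = (\<Sum>p\<in>T \<union> T'. (if p \<in> T then c p else 0) * p)"
      unfolding T(4) by (rule sum.mono_neutral_cong_left) (use T T' in auto)
    moreover have "y = (\<Sum>p\<in>T \<union> T'. (if p \<in> T' then c' p else 0) * p)"
      unfolding T'(4) by (rule sum.mono_neutral_cong_left) (use T T' in auto)
    ultimately have "x + y = (\<Sum>p\<in>T \<union> T'. d p * p)"
      by (simp only: d_def distrib_right sum.distrib)
    moreover have "d p \<in> R" if "p \<in> T \<union> T'" for p
      using T(3) T'(3) rs that by (auto simp: d_def)
    ultimately show ?thesis
      unfolding ideal_generated_def using T(1,2) T'(1,2) by (intro CollectI exI[of _ "T \<union> T'"] exI[of _ d]) auto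
  qed
  show "r * x \<in> ideal_generated R S" if rx: "r \<in> R" "x \<in> ideal_generated R S" for r x
  proof -
    obtain T c where T: "finite T" "T \<subseteq> S" "\<forall>p\<in>T. c p \<in> R" "x = (\<Sum>p\<in>T. c p * p)"
      using rx(2) unfolding ideal_generated_def by blast
    then show ?thesis unfolding ideal_generated_def using rx(1) rs(4)
      by (intro CollectI exI[of _ T] exI[of _ "\<lambda>p. r * c p"]) (auto simp: sum_distrib_left mult.assoc)
  qed
qed

lemma ideal_generated_mem: "s \<in> S \<Longrightarrow> r \<in> R \<Longrightarrow> r * s \<in> ideal_generated R S"
  unfolding ideal_generated_def by (intro CollectI exI[of _ "{s}"] exI[of _ "\<lambda>_. r"]) auto

context field_embedding
begin

lemma map_\<iota>_pol_over: "P \<in> pol_over F V \<Longrightarrow> Poly_Mapping.map \<iota> P \<in> pol_over UNIV V"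
  by (erule map_pol_over) (auto simp: \<iota>)

lemma map_flinear_pol_over: "flinear F \<iota> \<mu> \<Longrightarrow> P \<in> pol_over UNIV V \<Longrightarrow> Poly_Mapping.map \<mu> P \<in> pol_over F V"
  by (erule map_pol_over) (auto simp: flinearD)

lemma map_flinear_sum: "flinear F \<iota> \<mu> \<Longrightarrow> Poly_Mapping.map \<mu> (\<Sum>i\<in>A. P i) = (\<Sum>i\<in>A. Poly_Mapping.map \<mu> (P i))"
  by (rule poly_mapping_eqI) (simp add: lookup_map lookup_sum flinearD)

text \<open>A functional applied to the coefficients is not multiplicative in general, but it is
  linear over the polynomials with coefficients in \<open>F\<close>.\<close>

lemma map_flinear_mult:
  assumes l: "flinear F \<iota> \<mu>" and P: "P \<in> pol_over F V"
  shows "Poly_Mapping.map \<mu> (Q * Poly_Mapping.map \<iota> P) = Poly_Mapping.map \<mu> Q * P"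
proof -
  note l0 = flinearD(4)[OF l]
  have 1: "Poly_Mapping.map \<iota> P = (\<Sum>t\<in>Poly_Mapping.keys P. Poly_Mapping.single t (\<iota> (Poly_Mapping.lookup P t)))"
    by (rule poly_mapping_eqI) (auto simp: lookup_map lookup_sum lookup_single when_def \<iota> in_keys_iff)
  have 2: "\<mu> (u * \<iota> (Poly_Mapping.lookup P t)) = \<mu> u * Poly_Mapping.lookup P t" for u t
    using flinearD(2)[OF l pol_over_lookup[OF P]] by (simp add: mult.commute)
  have "Poly_Mapping.map \<mu> (Poly_Mapping.single s u * Poly_Mapping.map \<iota> P) = Poly_Mapping.single s (\<mu> u) * P" for s u
    unfolding 1 by (subst (3) mpol_expand[of P])
      (simp add: sum_distrib_left map_flinear_sum[OF l] mult_single map_single l0 2)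
  then show ?thesis
    by (subst (1 2) mpol_expand[of Q]) (simp add: sum_distrib_right map_flinear_sum[OF l] map_single l0)
qed

text \<open>The polynomial ring over the large field is free over the one over \<open>F\<close>, on
  a basis of the field extension, and the extended ideal consists of the elements with all
  coordinates in \<open>I\<close>. Membership can thus be tested without generators of
  \<open>I\<close>.\<close>

lemma mem_extend_ideal:
  assumes I: "is_ideal_in (pol_over F V) I"
  shows "P \<in> extend_ideal \<iota> V I \<longleftrightarrow> P \<in> pol_over UNIV V \<and> (\<forall>\<mu>. flinear F \<iota> \<mu> \<longrightarrow> Poly_Mapping.map \<mu> P \<in> I)"
proof
  note U = is_subring_pol_over[OF is_subring_UNIV, of V]
  have S: "Poly_Mapping.map \<iota> ` I \<subseteq> pol_over UNIV V"
    using is_ideal_inD(1)[OF I] map_\<iota>_pol_over by blast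
  note ig = ideal_generated_is_ideal[OF U S]
  {
    assume P: "P \<in> extend_ideal \<iota> V I"
    have "Poly_Mapping.map \<mu> P \<in> I" if l: "flinear F \<iota> \<mu>" for \<mu>
    proof -
      obtain T c where T: "T \<subseteq> Poly_Mapping.map \<iota> ` I" "\<forall>p\<in>T. c p \<in> pol_over UNIV V" "P = (\<Sum>p\<in>T. c p * p)"
        using P unfolding extend_ideal_def ideal_generated_def by blast
      have "Poly_Mapping.map \<mu> (c p * p) \<in> I" if p: "p \<in> T" for p
      proof -
        obtain q where q: "q \<in> I" "p = Poly_Mapping.map \<iota> q" using T(1) p by blast
        show ?thesis
          unfolding q(2) map_flinear_mult[OF l is_ideal_inD(1)[OF I q(1)]]
          using is_ideal_inD(4)[OF I map_flinear_pol_over[OF l] q(1)] T(2) p q(2) by simp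
      qed
      then show ?thesis unfolding T(3) map_flinear_sum[OF l] by (rule is_ideal_in_sum[OF I])
    qed
    then show "P \<in> pol_over UNIV V \<and> (\<forall>\<mu>. flinear F \<iota> \<mu> \<longrightarrow> Poly_Mapping.map \<mu> P \<in> I)"
      using P is_ideal_inD(1)[OF ig] by (auto simp: extend_ideal_def)
  }
  assume P: "P \<in> pol_over UNIV V \<and> (\<forall>\<mu>. flinear F \<iota> \<mu> \<longrightarrow> Poly_Mapping.map \<mu> P \<in> I)"
  obtain A \<mu> where A: "finite A" "\<And>b. flinear F \<iota> (\<mu> b)"
    "P = (\<Sum>b\<in>A. Const b * Poly_Mapping.map \<iota> (Poly_Mapping.map (\<mu> b) P))"
    by (rule mpol_coordinates[of P]) (rule that)
  have "(\<Sum>b\<in>A. Const b * Poly_Mapping.map \<iota> (Poly_Mapping.map (\<mu> b) P)) \<in> extend_ideal \<iota> V I"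
    unfolding extend_ideal_def
    by (intro is_ideal_in_sum[OF ig] ideal_generated_mem imageI pol_over_Const) (use P A(2) in auto)
  then show "P \<in> extend_ideal \<iota> V I" using A(3) by simp
qed

lemma extend_ideal_is_ideal:
  assumes "is_ideal_in (pol_over F V) I"
  shows "is_ideal_in (pol_over UNIV V) (extend_ideal \<iota> V I)"
  unfolding extend_ideal_def
  using is_ideal_inD(1)[OF assms] map_\<iota>_pol_over
  by (intro ideal_generated_is_ideal is_subring_pol_over) auto

lemma map_mem_extend_ideal:
  "p \<in> I \<Longrightarrow> Poly_Mapping.map \<iota> p \<in> extend_ideal \<iota> V I"
  using ideal_generated_mem[of "Poly_Mapping.map \<iota> p" "Poly_Mapping.map \<iota> ` I" 1 "pol_over UNIV V"]
    is_subringD(2)[OF is_subring_pol_over[OF is_subring_UNIV]] by (auto simp: extend_ideal_def)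

lemma extend_ideal_expand:
  assumes "is_ideal_in (pol_over F V) I" "P \<in> extend_ideal \<iota> V I"
  obtains A p where "finite A" "\<And>b. p b \<in> I" "P = (\<Sum>b\<in>A. Const b * Poly_Mapping.map \<iota> (p b))"
proof -
  obtain A \<mu> where A: "finite A" "\<And>b. flinear F \<iota> (\<mu> b)"
    "P = (\<Sum>b\<in>A. Const b * Poly_Mapping.map \<iota> (Poly_Mapping.map (\<mu> b) P))"
    by (rule mpol_coordinates[of P]) (rule that)
  have "Poly_Mapping.map (\<mu> b) P \<in> I" for b
    using mem_extend_ideal[OF assms(1)] assms(2) A(2)[of b] by blast
  from that[OF A(1) this A(3)] show ?thesis .
qed

lemma eval_map_\<iota>: "eval_pol id y (Poly_Mapping.map \<iota> P) = eval_pol \<iota> y P"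
  by (subst eval_pol_map) (auto simp: \<iota>)

end

lemma vanishing_ideal_is_ideal:
  assumes "is_subring F"
  shows "is_ideal_in (pol_over F V) (vanishing_ideal F V x)"
proof -
  have h: "hom_on F id" by (simp add: hom_on_def)
  note a = eval_pol_add[OF assms h, of _ V _ V x] and m = eval_pol_mult[OF assms h, of _ V _ V x]
  show ?thesis using assms
    by (auto simp: is_ideal_in_def vanishing_ideal_def a m pol_over_add pol_over_mult pol_over_0)
qed

section \<open>Prime differential ideals\<close>

definition is_delta_ideal :: "('r::comm_ring_1 \<Rightarrow> 'r) \<Rightarrow> 'r set \<Rightarrow> bool" where
  "is_delta_ideal d I \<longleftrightarrow> is_ideal_in UNIV I \<and> d ` I \<subseteq> I"

lemma is_delta_idealD:
  assumes "is_delta_ideal d I"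
  shows "0 \<in> I" "x \<in> I \<Longrightarrow> y \<in> I \<Longrightarrow> x + y \<in> I" "x \<in> I \<Longrightarrow> r * x \<in> I" "x \<in> I \<Longrightarrow> x * r \<in> I" "x \<in> I \<Longrightarrow> d x \<in> I"
    "x \<in> I \<Longrightarrow> - x \<in> I" "x \<in> I \<Longrightarrow> y \<in> I \<Longrightarrow> x - y \<in> I"
proof -
  show a: "0 \<in> I" "x \<in> I \<Longrightarrow> y \<in> I \<Longrightarrow> x + y \<in> I" "x \<in> I \<Longrightarrow> r * x \<in> I" "x \<in> I \<Longrightarrow> d x \<in> I" for x y r
    using assms by (auto simp: is_delta_ideal_def is_ideal_in_def)
  show "x \<in> I \<Longrightarrow> x * r \<in> I" using a(3)[of x r] by (simp add: mult.commute)
  show m: "x \<in> I \<Longrightarrow> - x \<in> I" for x using a(3)[of x "- 1"] by simp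
  show "x \<in> I \<Longrightarrow> y \<in> I \<Longrightarrow> x - y \<in> I" using a(2)[of x "- y"] m by simp
qed

lemma is_delta_idealI:
  assumes "0 \<in> I" "\<And>x y. x \<in> I \<Longrightarrow> y \<in> I \<Longrightarrow> x + y \<in> I" "\<And>r x. x \<in> I \<Longrightarrow> r * x \<in> I" "\<And>x. x \<in> I \<Longrightarrow> d x \<in> I"
  shows "is_delta_ideal d I"
  using assms by (auto simp: is_delta_ideal_def is_ideal_in_def)

context
  fixes d :: "'r::comm_ring_1 \<Rightarrow> 'r"
  assumes d: "derivation d" and char_0: "\<And>n. 0 < n \<Longrightarrow> \<exists>c. of_nat n * c = (1::'r)"
begin

text \<open>Differentiating \<open>a ^ Suc e * d a ^ (2 * k)\<close> and multiplying by
  \<open>d a\<close> trades one factor \<open>a\<close> for two factors \<open>d a\<close>; the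
  positive integer \<open>Suc e\<close> is then inverted. The case \<open>k = n\<close> leaves a
  power of \<open>d a\<close> alone.\<close>

lemma delta_ideal_power_deriv:
  assumes I: "is_delta_ideal d I" and "a ^ n \<in> I"
  shows "k \<le> n \<Longrightarrow> a ^ (n - k) * d a ^ (2 * k) \<in> I"
proof (induction k)
  case (Suc k)
  note Id = is_delta_idealD[OF I]
  define e where "e = n - Suc k"
  have e: "n - k = Suc e" using Suc.prems by (simp add: e_def)
  let ?b = "d a"
  have IH: "a ^ Suc e * ?b ^ (2 * k) \<in> I" using Suc e by simp
  have "d (a ^ Suc e * ?b ^ (2 * k)) * ?b =
      of_nat (Suc e) * (a ^ e * ?b ^ (2 * Suc k)) + of_nat (2 * k) * d ?b * (a ^ Suc e * (?b ^ (2 * k - 1) * ?b))"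
    by (simp only: derivationD[OF d] derivation_power[OF d]) (simp add: algebra_simps)
  also have "of_nat (2 * k) * d ?b * (a ^ Suc e * (?b ^ (2 * k - 1) * ?b)) = of_nat (2 * k) * d ?b * (a ^ Suc e * ?b ^ (2 * k))"
    by (cases k) (simp_all add: algebra_simps)
  finally have eq: "of_nat (Suc e) * (a ^ e * ?b ^ (2 * Suc k)) =
      d (a ^ Suc e * ?b ^ (2 * k)) * ?b - of_nat (2 * k) * d ?b * (a ^ Suc e * ?b ^ (2 * k))" by simp
  have "of_nat (Suc e) * (a ^ e * ?b ^ (2 * Suc k)) \<in> I"
    unfolding eq by (intro Id(7) Id(4) Id(3) Id(5) IH)
  then have "c * (of_nat (Suc e) * (a ^ e * ?b ^ (2 * Suc k))) \<in> I" for c by (rule Id(3))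
  moreover obtain c where "of_nat (Suc e) * c = (1::'r)" using char_0[of "Suc e"] by auto
  moreover have "c * (of_nat (Suc e) * (a ^ e * ?b ^ (2 * Suc k))) = (of_nat (Suc e) * c) * (a ^ e * ?b ^ (2 * Suc k))"
    by (simp only: mult_ac)
  ultimately have "1 * (a ^ e * ?b ^ (2 * Suc k)) \<in> I" by metis
  then have "a ^ e * ?b ^ (2 * Suc k) \<in> I" by (simp only: mult_1_left)
  then show ?case by (simp only: e_def)
qed (use assms in simp)

lemma is_delta_ideal_radical:
  assumes I: "is_delta_ideal d I"
  shows "is_delta_ideal d {a. \<exists>n. a ^ n \<in> I}"
proof (rule is_delta_idealI)
  note Id = is_delta_idealD[OF I]
  show "0 \<in> {a. \<exists>n. a ^ n \<in> I}" using Id(1) by (auto intro: exI[of _ 1])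
  show "x + y \<in> {a. \<exists>n. a ^ n \<in> I}" if xy: "x \<in> {a. \<exists>n. a ^ n \<in> I}" "y \<in> {a. \<exists>n. a ^ n \<in> I}" for x y
  proof -
    obtain m n where mn: "x ^ m \<in> I" "y ^ n \<in> I" using xy by auto
    have "of_nat (m + n choose k) * x ^ k * y ^ (m + n - k) \<in> I" if "k \<le> m + n" for k
    proof (cases "m \<le> k")
      case True
      then have "x ^ k = x ^ (k - m) * x ^ m" by (simp flip: power_add)
      then have "of_nat (m + n choose k) * x ^ k * y ^ (m + n - k) =
          (of_nat (m + n choose k) * x ^ (k - m) * y ^ (m + n - k)) * x ^ m"
        by (simp only: mult_ac)
      then show ?thesis using Id(3)[OF mn(1)] by (simp only:)
    next
      case False
      then have "y ^ (m + n - k) = y ^ (m - k) * y ^ n" by (simp flip: power_add)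
      then have "of_nat (m + n choose k) * x ^ k * y ^ (m + n - k) =
          (of_nat (m + n choose k) * x ^ k * y ^ (m - k)) * y ^ n"
        by (simp only: mult_ac)
      then show ?thesis using Id(3)[OF mn(2)] by (simp only:)
    qed
    then have "(x + y) ^ (m + n) \<in> I"
      unfolding binomial_ring using I is_ideal_in_sum[of UNIV I "{..m + n}"]
      by (auto simp: is_delta_ideal_def)
    then show ?thesis by auto
  qed
  show "r * x \<in> {a. \<exists>n. a ^ n \<in> I}" if "x \<in> {a. \<exists>n. a ^ n \<in> I}" for r x
    using that Id(3) by (auto simp: power_mult_distrib)
  show "d x \<in> {a. \<exists>n. a ^ n \<in> I}" if x: "x \<in> {a. \<exists>n. a ^ n \<in> I}" for x
  proof -
    obtain n where "x ^ n \<in> I" using x by auto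
    then have "d x ^ (2 * n) \<in> I" using delta_ideal_power_deriv[OF I, of x n n] by simp
    then show ?thesis by blast
  qed
qed

text \<open>The square of \<open>d x * b\<close> is a combination of \<open>x * b\<close> and
  \<open>d (x * b)\<close>, which is enough since \<open>I\<close> is radical.\<close>

lemma is_delta_ideal_quotient:
  assumes I: "is_delta_ideal d I" and rad: "\<And>a n. a ^ n \<in> I \<Longrightarrow> a \<in> I"
  shows "is_delta_ideal d {x. x * b \<in> I}"
proof (rule is_delta_idealI)
  note Id = is_delta_idealD[OF I]
  show "0 \<in> {x. x * b \<in> I}" using Id by simp
  show "x + y \<in> {x. x * b \<in> I}" if "x \<in> {x. x * b \<in> I}" "y \<in> {x. x * b \<in> I}" for x y
    using that Id by (simp add: distrib_right)
  show "r * x \<in> {x. x * b \<in> I}" if "x \<in> {x. x * b \<in> I}" for r x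
    using that Id by (simp add: mult.assoc)
  show "d x \<in> {x. x * b \<in> I}" if "x \<in> {x. x * b \<in> I}" for x
  proof -
    have x: "x * b \<in> I" using that by simp
    have "(d x * b) ^ 2 = d (x * b) * (d x * b) - (x * b) * (d x * d b)"
      by (simp add: derivationD[OF d] power2_eq_square algebra_simps)
    also have "\<dots> \<in> I" by (rule Id(7)[OF Id(4)[OF Id(5)[OF x]] Id(4)[OF x]])
    finally show ?thesis using rad by blast
  qed
qed

text \<open>A differential ideal maximal among those containing \<open>I\<close> and no power of
  \<open>g\<close> is prime: by maximality it equals its radical, and then its quotient by any
  \<open>b\<close> is either the ideal itself or meets the powers of \<open>g\<close>.\<close>

theorem prime_delta_ideal_avoiding:
  assumes I: "is_delta_ideal d I" and g: "\<And>n. g ^ n \<notin> I"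
  obtains P where "is_delta_ideal d P" "I \<subseteq> P" "g \<notin> P" "1 \<notin> P" "\<And>a b. a * b \<in> P \<Longrightarrow> a \<in> P \<or> b \<in> P"
proof -
  define S where "S = {J. is_delta_ideal d J \<and> I \<subseteq> J \<and> (\<forall>n. g ^ n \<notin> J)}"
  have "\<exists>M\<in>S. \<forall>X\<in>S. M \<subseteq> X \<longrightarrow> X = M"
  proof (rule subset_Zorn_nonempty)
    show "S \<noteq> {}" using I g by (auto simp: S_def)
    fix C assume C: "C \<noteq> {}" "subset.chain S C"
    have CS: "is_delta_ideal d J" "I \<subseteq> J" "g ^ n \<notin> J" if "J \<in> C" for J n
      using C(2) that by (auto simp: subset.chain_def S_def)
    have "is_delta_ideal d (\<Union>C)"
    proof (rule is_delta_idealI)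
      show "0 \<in> \<Union>C" using C(1) is_delta_idealD(1)[OF CS(1)] by blast
      show "x + y \<in> \<Union>C" if "x \<in> \<Union>C" "y \<in> \<Union>C" for x y
      proof -
        have "{x, y} \<subseteq> \<Union>C" using that by auto
        then obtain B where "B \<in> C" "{x, y} \<subseteq> B"
          using finite_subset_Union_chain[OF _ _ C, of "{x, y}"] by blast
        then show ?thesis using is_delta_idealD(2)[OF CS(1)] by blast
      qed
      show "r * x \<in> \<Union>C" if "x \<in> \<Union>C" for r x
        using that is_delta_idealD(3)[OF CS(1)] by blast
      show "d x \<in> \<Union>C" if "x \<in> \<Union>C" for x
        using that is_delta_idealD(5)[OF CS(1)] by blast
    qed
    then show "\<Union>C \<in> S" using C(1) CS(2,3) unfolding S_def by blast
  qed
  then obtain P where P: "P \<in> S" and max: "\<And>X. X \<in> S \<Longrightarrow> P \<subseteq> X \<Longrightarrow> X = P" by blast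
  have Pd: "is_delta_ideal d P" and IP: "I \<subseteq> P" and gP: "g ^ n \<notin> P" for n using P by (auto simp: S_def)
  note Id = is_delta_idealD[OF Pd]
  have rad: "a \<in> P" if "a ^ n \<in> P" for a n
  proof -
    let ?J = "{a. \<exists>n. a ^ n \<in> P}"
    have sub: "P \<subseteq> ?J" by (auto intro: exI[of _ 1])
    have "?J \<in> S"
      unfolding S_def using is_delta_ideal_radical[OF Pd] IP sub gP by (auto simp flip: power_mult)
    then have "?J = P" using sub by (rule max)
    then show ?thesis using that by blast
  qed
  have quot: "\<exists>n. g ^ n * b \<in> P" if "a * b \<in> P" "a \<notin> P" for a b
  proof (rule ccontr)
    assume n: "\<not> (\<exists>n. g ^ n * b \<in> P)"
    let ?J = "{x. x * b \<in> P}"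
    have sub: "P \<subseteq> ?J" using Id(4) by blast
    have "is_delta_ideal d ?J" by (rule is_delta_ideal_quotient[OF Pd rad])
    moreover have "I \<subseteq> ?J" using IP sub by (rule subset_trans)
    ultimately have "?J \<in> S" using n by (simp add: S_def)
    then have "?J = P" using sub by (rule max)
    then show False using that by blast
  qed
  have "a \<in> P \<or> b \<in> P" if ab: "a * b \<in> P" for a b
  proof (rule ccontr)
    assume n: "\<not> (a \<in> P \<or> b \<in> P)"
    then have "a \<notin> P" by simp
    from quot[OF ab this] obtain i where "g ^ i * b \<in> P" ..
    then have "b * g ^ i \<in> P" by (simp add: mult.commute)
    moreover have "b \<notin> P" using n by simp
    ultimately have "\<exists>j. g ^ j * g ^ i \<in> P" by (rule quot)
    then obtain j where "g ^ j * g ^ i \<in> P" ..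
    then show False using gP by (simp flip: power_add)
  qed
  moreover have "g \<notin> P" "1 \<notin> P" using gP[of 1] gP[of 0] by auto
  ultimately show ?thesis using that[OF Pd IP] by simp
qed

end

section \<open>The differential field of fractions modulo a prime differential ideal\<close>

locale prime_delta_ideal =
  fixes d :: "'r::comm_ring_1 \<Rightarrow> 'r" and P :: "'r set"
  assumes d: "derivation d" and P: "is_delta_ideal d P" and P_1: "1 \<notin> P"
    and prime: "\<And>a b. a * b \<in> P \<Longrightarrow> a \<in> P \<or> b \<in> P"
begin

lemmas P_ideal = is_delta_idealD[OF P]

definition cls :: "'r \<times> 'r \<Rightarrow> ('r \<times> 'r) set" where
  "cls p = {q. snd q \<notin> P \<and> fst p * snd q - fst q * snd p \<in> P}"

definition frac_carrier where "frac_carrier = cls ` {p. snd p \<notin> P}"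

lemma cls_eq_iff:
  assumes "snd p \<notin> P" "snd q \<notin> P"
  shows "cls p = cls q \<longleftrightarrow> fst p * snd q - fst q * snd p \<in> P"
proof
  assume "cls p = cls q"
  moreover have "q \<in> cls q" using assms P_ideal(1) by (simp add: cls_def)
  ultimately have "q \<in> cls p" by simp
  then show "fst p * snd q - fst q * snd p \<in> P" by (simp add: cls_def)
next
  \<comment> \<open>As in any localization the middle denominator \<open>snd q\<close> has to be
    cancelled; primality of \<open>P\<close> permits it.\<close>
  have trans: "cls q \<subseteq> cls p" if pq: "snd q \<notin> P" "fst p * snd q - fst q * snd p \<in> P" for p q
  proof
    fix r assume r: "r \<in> cls q"
    let ?e = "fst q * snd r - fst r * snd q"
    have "snd q * (fst p * snd r - fst r * snd p) = snd r * (fst p * snd q - fst q * snd p) + snd p * ?e"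
      by (simp add: algebra_simps)
    moreover have "\<dots> \<in> P" using r pq by (intro P_ideal(2,3)) (auto simp: cls_def)
    ultimately have "snd q * (fst p * snd r - fst r * snd p) \<in> P" by simp
    then show "r \<in> cls p" using prime pq(1) r by (auto simp: cls_def)
  qed
  assume e: "fst p * snd q - fst q * snd p \<in> P"
  then have "fst q * snd p - fst p * snd q \<in> P" using P_ideal(6)[OF e] by simp
  then show "cls p = cls q" using trans[of q p] trans[of p q] assms e by blast
qed

lemma clsI:
  "snd p \<notin> P \<Longrightarrow> snd q \<notin> P \<Longrightarrow> fst p * snd q - fst q * snd p \<in> P \<Longrightarrow> cls p = cls q"
  by (simp add: cls_eq_iff)

definition rep :: "('r \<times> 'r) set \<Rightarrow> 'r \<times> 'r" where
  "rep X = (SOME p. snd p \<notin> P \<and> cls p = X)"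

lemma rep:
  assumes "X \<in> frac_carrier"
  shows "snd (rep X) \<notin> P" "cls (rep X) = X"
proof -
  have "\<exists>p. snd p \<notin> P \<and> cls p = X" using assms unfolding frac_carrier_def by blast
  from someI_ex[OF this] show "snd (rep X) \<notin> P" "cls (rep X) = X" by (auto simp: rep_def)
qed

definition fadd where "fadd p q = (fst p * snd q + fst q * snd p, snd p * snd q)" for p q :: "'r \<times> 'r"
definition fmul where "fmul p q = (fst p * fst q, snd p * snd q)" for p q :: "'r \<times> 'r"
definition fderiv where "fderiv p = (d (fst p) * snd p - fst p * d (snd p), snd p * snd p)" for p

lemma snd_ops: "snd p \<notin> P \<Longrightarrow> snd q \<notin> P \<Longrightarrow> snd (fadd p q) \<notin> P" "snd p \<notin> P \<Longrightarrow> snd q \<notin> P \<Longrightarrow> snd (fmul p q) \<notin> P"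
  "snd p \<notin> P \<Longrightarrow> snd (fderiv p) \<notin> P"
  using prime by (auto simp: fadd_def fmul_def fderiv_def)

definition Frac :: "('r \<times> 'r) set ring" where
  "Frac = \<lparr>carrier = frac_carrier, mult = (\<lambda>X Y. cls (fmul (rep X) (rep Y))), one = cls (1, 1),
     zero = cls (0, 1), add = (\<lambda>X Y. cls (fadd (rep X) (rep Y)))\<rparr>"

definition frac_deriv where "frac_deriv X = cls (fderiv (rep X))"

definition frac_embed :: "'r \<Rightarrow> ('r \<times> 'r) set" where "frac_embed a = cls (a, 1)"

lemma rep_cls: "snd p \<notin> P \<Longrightarrow> snd (rep (cls p)) \<notin> P \<and> fst (rep (cls p)) * snd p - fst p * snd (rep (cls p)) \<in> P"
  using rep[of "cls p"] cls_eq_iff[of "rep (cls p)" p] by (auto simp: frac_carrier_def)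

lemma cls_fadd:
  assumes "snd p \<notin> P" "snd q \<notin> P"
  shows "cls (fadd (rep (cls p)) (rep (cls q))) = cls (fadd p q)"
proof (rule clsI)
  let ?p = "rep (cls p)" and ?q = "rep (cls q)"
  have "fst (fadd ?p ?q) * snd (fadd p q) - fst (fadd p q) * snd (fadd ?p ?q) =
      snd q * snd ?q * (fst ?p * snd p - fst p * snd ?p) + snd p * snd ?p * (fst ?q * snd q - fst q * snd ?q)"
    by (simp add: fadd_def algebra_simps)
  also have "\<dots> \<in> P" by (intro P_ideal(2) P_ideal(3)) (simp_all add: rep_cls assms)
  finally show "fst (fadd ?p ?q) * snd (fadd p q) - fst (fadd p q) * snd (fadd ?p ?q) \<in> P" .
qed (simp_all add: rep_cls snd_ops assms)

lemma cls_fmul: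
  assumes "snd p \<notin> P" "snd q \<notin> P"
  shows "cls (fmul (rep (cls p)) (rep (cls q))) = cls (fmul p q)"
proof (rule clsI)
  let ?p = "rep (cls p)" and ?q = "rep (cls q)"
  have "fst (fmul ?p ?q) * snd (fmul p q) - fst (fmul p q) * snd (fmul ?p ?q) =
      fst ?q * snd q * (fst ?p * snd p - fst p * snd ?p) + fst p * snd ?p * (fst ?q * snd q - fst q * snd ?q)"
    by (simp add: fmul_def algebra_simps)
  also have "\<dots> \<in> P" by (intro P_ideal(2) P_ideal(3)) (simp_all add: rep_cls assms)
  finally show "fst (fmul ?p ?q) * snd (fmul p q) - fst (fmul p q) * snd (fmul ?p ?q) \<in> P" .
qed (simp_all add: rep_cls snd_ops assms)

text \<open>The quotient rule respects equality of fractions because \<open>P\<close> is closed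
  under \<open>d\<close>: the difference is a combination of the defect \<open>?e\<close> and its
  derivative.\<close>

lemma cls_fderiv:
  assumes "snd p \<notin> P"
  shows "cls (fderiv (rep (cls p))) = cls (fderiv p)"
proof (rule clsI)
  let ?p = "rep (cls p)"
  let ?e = "fst ?p * snd p - fst p * snd ?p"
  have "fst (fderiv ?p) * snd (fderiv p) - fst (fderiv p) * snd (fderiv ?p) =
      snd p * snd ?p * d ?e - (snd p * d (snd ?p) + snd ?p * d (snd p)) * ?e"
    by (simp add: fderiv_def derivationD[OF d] algebra_simps)
  also have "\<dots> \<in> P"
    using rep_cls[OF assms] by (intro P_ideal(7)[OF P_ideal(3)[OF P_ideal(5)] P_ideal(3)]) simp_all
  finally show "fst (fderiv ?p) * snd (fderiv p) - fst (fderiv p) * snd (fderiv ?p) \<in> P" .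
qed (simp_all add: rep_cls snd_ops assms)

lemma Frac_simps:
  "carrier Frac = frac_carrier" "\<one>\<^bsub>Frac\<^esub> = cls (1, 1)" "\<zero>\<^bsub>Frac\<^esub> = cls (0, 1)"
  "snd p \<notin> P \<Longrightarrow> snd q \<notin> P \<Longrightarrow> cls p \<oplus>\<^bsub>Frac\<^esub> cls q = cls (fadd p q)"
  "snd p \<notin> P \<Longrightarrow> snd q \<notin> P \<Longrightarrow> cls p \<otimes>\<^bsub>Frac\<^esub> cls q = cls (fmul p q)"
  "snd p \<notin> P \<Longrightarrow> frac_deriv (cls p) = cls (fderiv p)"
  by (simp_all add: Frac_def cls_fadd cls_fmul frac_deriv_def cls_fderiv)

lemma cls_carrier: "snd p \<notin> P \<Longrightarrow> cls p \<in> frac_carrier"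
  by (auto simp: frac_carrier_def)

lemma frac_carrierE:
  assumes "X \<in> frac_carrier"
  obtains a b where "X = cls (a, b)" "b \<notin> P"
  using assms by (auto simp: frac_carrier_def)

lemma cls_eqI: "b \<notin> P \<Longrightarrow> b' \<notin> P \<Longrightarrow> a * b' = a' * b \<Longrightarrow> cls (a, b) = cls (a', b')"
  using clsI[of "(a, b)" "(a', b')"] P_ideal(1) by simp

lemma cls_eq_0: "b \<notin> P \<Longrightarrow> cls (a, b) = cls (0, 1) \<longleftrightarrow> a \<in> P"
  using cls_eq_iff[of "(a, b)" "(0, 1)"] P_1 by simp

lemma prime_notin: "a \<notin> P \<Longrightarrow> b \<notin> P \<Longrightarrow> a * b \<notin> P"
  using prime by blast

lemma Frac_ops:
  assumes "b \<notin> P" "b' \<notin> P"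
  shows "cls (a, b) \<oplus>\<^bsub>Frac\<^esub> cls (a', b') = cls (a * b' + a' * b, b * b')"
    "cls (a, b) \<otimes>\<^bsub>Frac\<^esub> cls (a', b') = cls (a * a', b * b')"
    "frac_deriv (cls (a, b)) = cls (d a * b - a * d b, b * b)"
  using Frac_simps(4,5)[of "(a, b)" "(a', b')"] Frac_simps(6)[of "(a, b)"] assms
  by (simp_all add: fadd_def fmul_def fderiv_def)

lemma cring_Frac: "cring Frac"
proof (rule cringI)
  note c = Frac_simps(1-3) cls_carrier P_1 prime_notin Frac_ops
  show "abelian_group Frac"
  proof (rule abelian_groupI)
    fix x y z assume "x \<in> carrier Frac" "y \<in> carrier Frac" "z \<in> carrier Frac"
    then obtain a b a' b' a'' b'' where *: "x = cls (a, b)" "y = cls (a', b')" "z = cls (a'', b'')" "b \<notin> P" "b' \<notin> P" "b'' \<notin> P"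
      by (metis Frac_simps(1) frac_carrierE)
    show "x \<oplus>\<^bsub>Frac\<^esub> y \<oplus>\<^bsub>Frac\<^esub> z = x \<oplus>\<^bsub>Frac\<^esub> (y \<oplus>\<^bsub>Frac\<^esub> z)"
      using * by (simp add: c) (simp add: algebra_simps)
    show "x \<oplus>\<^bsub>Frac\<^esub> y = y \<oplus>\<^bsub>Frac\<^esub> x"
      using * by (simp add: c) (simp add: algebra_simps)
    show "x \<oplus>\<^bsub>Frac\<^esub> y \<in> carrier Frac" using * by (simp add: c)
  next
    fix x assume "x \<in> carrier Frac"
    then obtain a b where *: "x = cls (a, b)" "b \<notin> P" by (metis Frac_simps(1) frac_carrierE)
    show "\<zero>\<^bsub>Frac\<^esub> \<oplus>\<^bsub>Frac\<^esub> x = x" using * by (simp add: c)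
    show "\<exists>y\<in>carrier Frac. y \<oplus>\<^bsub>Frac\<^esub> x = \<zero>\<^bsub>Frac\<^esub>"
      using * by (intro bexI[of _ "cls (- a, b)"]) (simp_all add: c cls_eq_0 P_ideal(1))
  qed (simp add: c)
  show "comm_monoid Frac"
  proof (rule comm_monoidI)
    fix x y z assume "x \<in> carrier Frac" "y \<in> carrier Frac" "z \<in> carrier Frac"
    then obtain a b a' b' a'' b'' where *: "x = cls (a, b)" "y = cls (a', b')" "z = cls (a'', b'')" "b \<notin> P" "b' \<notin> P" "b'' \<notin> P"
      by (metis Frac_simps(1) frac_carrierE)
    show "x \<otimes>\<^bsub>Frac\<^esub> y \<otimes>\<^bsub>Frac\<^esub> z = x \<otimes>\<^bsub>Frac\<^esub> (y \<otimes>\<^bsub>Frac\<^esub> z)" using * by (simp add: c mult.assoc)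
    show "x \<otimes>\<^bsub>Frac\<^esub> y = y \<otimes>\<^bsub>Frac\<^esub> x" using * by (simp add: c mult.commute)
    show "x \<otimes>\<^bsub>Frac\<^esub> y \<in> carrier Frac" using * by (simp add: c)
  next
    fix x assume "x \<in> carrier Frac"
    then obtain a b where *: "x = cls (a, b)" "b \<notin> P" by (metis Frac_simps(1) frac_carrierE)
    show "\<one>\<^bsub>Frac\<^esub> \<otimes>\<^bsub>Frac\<^esub> x = x" using * by (simp add: c)
  qed (simp add: c)
  fix x y z assume "x \<in> carrier Frac" "y \<in> carrier Frac" "z \<in> carrier Frac"
  then obtain a b a' b' a'' b'' where *: "x = cls (a, b)" "y = cls (a', b')" "z = cls (a'', b'')" "b \<notin> P" "b' \<notin> P" "b'' \<notin> P"
    by (metis Frac_simps(1) frac_carrierE)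
  show "(x \<oplus>\<^bsub>Frac\<^esub> y) \<otimes>\<^bsub>Frac\<^esub> z = x \<otimes>\<^bsub>Frac\<^esub> z \<oplus>\<^bsub>Frac\<^esub> y \<otimes>\<^bsub>Frac\<^esub> z"
  proof -
    have "cls ((a * b' + a' * b) * a'', b * b' * b'') = cls (a * a'' * (b' * b'') + a' * a'' * (b * b''), b * b'' * (b' * b''))"
      using *(4-6) by (intro cls_eqI prime_notin) (assumption | simp add: algebra_simps)+
    then show ?thesis using * by (simp add: c)
  qed
qed

lemma field_Frac: "field Frac"
proof (rule cring.cring_fieldI2[OF cring_Frac])
  show "\<zero>\<^bsub>Frac\<^esub> \<noteq> \<one>\<^bsub>Frac\<^esub>" using cls_eq_0[of 1 1] P_1 by (auto simp: Frac_simps)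
  fix x assume "x \<in> carrier Frac" "x \<noteq> \<zero>\<^bsub>Frac\<^esub>"
  then obtain a b where *: "x = cls (a, b)" "b \<notin> P" "a \<notin> P"
    by (metis Frac_simps(1,3) frac_carrierE cls_eq_0)
  then show "\<exists>y\<in>carrier Frac. x \<otimes>\<^bsub>Frac\<^esub> y = \<one>\<^bsub>Frac\<^esub>"
    by (intro bexI[of _ "cls (b, a)"]) (simp_all add: Frac_simps(1-3) Frac_ops cls_carrier, (rule cls_eqI; simp add: prime_notin P_1))
qed

lemma is_delta_field_Frac: "is_delta_field Frac frac_deriv"
  unfolding is_delta_field_def
proof (intro conjI ballI funcsetI)
  show "field Frac" by (rule field_Frac)
  show "frac_deriv x \<in> carrier Frac" if "x \<in> carrier Frac" for x
    using that by (auto simp: Frac_simps(1) Frac_ops cls_carrier prime_notin elim!: frac_carrierE)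
  fix x y assume "x \<in> carrier Frac" "y \<in> carrier Frac"
  then obtain a b a' b' where *: "x = cls (a, b)" "y = cls (a', b')" "b \<notin> P" "b' \<notin> P"
    by (metis Frac_simps(1) frac_carrierE)
  show "frac_deriv (x \<oplus>\<^bsub>Frac\<^esub> y) = frac_deriv x \<oplus>\<^bsub>Frac\<^esub> frac_deriv y"
    "frac_deriv (x \<otimes>\<^bsub>Frac\<^esub> y) = (frac_deriv x \<otimes>\<^bsub>Frac\<^esub> y) \<oplus>\<^bsub>Frac\<^esub> (x \<otimes>\<^bsub>Frac\<^esub> frac_deriv y)"
    using * by (simp_all add: Frac_ops prime_notin derivationD[OF d]) ((intro cls_eqI prime_notin; (assumption | simp add: algebra_simps))+)
qed

lemma frac_embed_hom:
  "frac_embed \<in> ring_hom \<lparr>carrier = UNIV, mult = (*), one = 1, zero = 0, add = (+)\<rparr> Frac"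
  by (rule ring_hom_memI) (auto simp: frac_embed_def Frac_simps(1-3) Frac_ops cls_carrier P_1)

lemma frac_embed_deriv: "frac_embed (d a) = frac_deriv (frac_embed a)"
  using Frac_ops(3)[OF P_1 P_1, of a] by (simp add: frac_embed_def derivationD[OF d])

lemma frac_embed_eq_0: "frac_embed a = \<zero>\<^bsub>Frac\<^esub> \<longleftrightarrow> a \<in> P"
  by (simp add: frac_embed_def Frac_simps cls_eq_0 P_1)

end

section \<open>Substitution of matrices\<close>

lemma GL_I: "A \<in> carrier_mat N N \<Longrightarrow> B \<in> carrier_mat N N \<Longrightarrow> A * B = 1\<^sub>m N \<Longrightarrow> A \<in> GL N"
  using mat_mult_left_right_inverse[of A N B]
  by (auto simp: GL_def invertible_mat_def inverts_mat_def square_mat.simps intro!: exI[of _ B])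

lemma GL_E:
  assumes "A \<in> GL N"
  obtains B where "A \<in> carrier_mat N N" "B \<in> carrier_mat N N" "A * B = 1\<^sub>m N" "B * A = 1\<^sub>m N"
proof -
  obtain B where B: "A \<in> carrier_mat N N" "inverts_mat A B" "inverts_mat B A"
    using assms by (auto simp: GL_def invertible_mat_def)
  then have 1: "A * B = 1\<^sub>m N" "B * A = 1\<^sub>m (dim_row B)" by (auto simp: inverts_mat_def)
  have "dim_row B = N" using arg_cong[OF 1(2), of dim_col] B(1) by simp
  moreover have "dim_col B = N" using arg_cong[OF 1(1), of dim_col] by simp
  ultimately show ?thesis using that[of B] B(1) 1 by auto
qed

lemma GL_iff_det: "A \<in> GL N \<longleftrightarrow> A \<in> carrier_mat N N \<and> det A \<noteq> 0"
proof
  assume "A \<in> GL N"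
  then obtain B where "A \<in> carrier_mat N N" "B \<in> carrier_mat N N" "A * B = 1\<^sub>m N" by (rule GL_E)
  then show "A \<in> carrier_mat N N \<and> det A \<noteq> 0" using det_mult[of A N B] by auto
next
  assume A: "A \<in> carrier_mat N N \<and> det A \<noteq> 0"
  have "A * (inverse (det A) \<cdot>\<^sub>m adj_mat A) = inverse (det A) \<cdot>\<^sub>m (det A \<cdot>\<^sub>m 1\<^sub>m N)"
    using adj_mat[of A N] A by (simp add: mult_smult_distrib[of _ N N])
  also have "\<dots> = 1\<^sub>m N" using A by (intro eq_matI) auto
  finally show "A \<in> GL N" using A adj_mat(1)[of A N] by (intro GL_I) auto
qed

lemma eval_mat_cong:
  assumes "P \<in> pol_over F (mat_vars N)" "\<And>i j. i < N \<Longrightarrow> j < N \<Longrightarrow> x (i, j) = y (i, j)"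
  shows "eval_pol h x P = eval_pol h y P"
  by (rule eval_pol_cong[OF assms(1)]) (use assms(2) in \<open>auto simp: mat_vars_def\<close>)

lemma hom_eval_mat:
  assumes "comm_ring_hom \<Phi>" "A \<in> carrier_mat N N" "P \<in> pol_over F (mat_vars N)"
  shows "\<Phi> (eval_pol h (($$) A) P) = eval_pol (\<Phi> \<circ> h) (($$) (map_mat \<Phi> A)) P"
  unfolding hom_eval_pol[OF assms(1)]
  by (rule eval_mat_cong[OF assms(3)]) (use assms(2) in auto)

lemma eval_mat_eval_mat:
  assumes "comm_ring_hom h" "A \<in> carrier_mat N N" "P \<in> pol_over F (mat_vars N)"
  shows "eval_pol h y (eval_pol Const (($$) A) P) = eval_pol h (($$) (map_mat (eval_pol h y) A)) P"
proof -
  interpret comm_ring_hom h by fact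
  show ?thesis
    using hom_eval_mat[OF eval_pol_comm_ring_hom[OF assms(1)] assms(2,3), of y Const] by (simp add: o_def)
qed

lemma map_mat_eval_Const:
  assumes "comm_ring_hom h"
  shows "map_mat (eval_pol h y) (map_mat Const A) = map_mat h A"
proof -
  interpret comm_ring_hom h by fact
  show ?thesis by (rule eq_matI) auto
qed

lemma map_mat_eval_Var:
  assumes "comm_ring_hom h" "Y \<in> carrier_mat N N"
  shows "map_mat (eval_pol h (($$) Y)) (mat N N Var) = Y"
proof -
  interpret comm_ring_hom h by fact
  show ?thesis using assms(2) by (intro eq_matI) auto
qed

lemma map_mat_hom_mult:
  assumes "comm_ring_hom h" "A \<in> carrier_mat n m" "B \<in> carrier_mat m l"
  shows "map_mat h (A * B) = map_mat h A * map_mat h B"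
proof -
  interpret comm_ring_hom h by fact
  show ?thesis by (rule mat_hom_mult[OF assms(2,3)])
qed

lemma eval_mat_Var:
  fixes P :: "(nat \<times> nat, 'a::comm_ring_1) mpol"
  assumes "P \<in> pol_over F (mat_vars N)"
  shows "eval_pol Const (($$) (mat N N Var)) P = P"
  using eval_mat_cong[OF assms, of "($$) (mat N N Var)" Var Const] by simp

lemma msubst_alt: "msubst N M = eval_pol Const (($$) (mat N N Var * map_mat Const M))"
  by (simp add: msubst_def case_prod_unfold)

lemma eval_msubst:
  assumes "comm_ring_hom h" "Y \<in> carrier_mat N N" "M \<in> carrier_mat N N" "P \<in> pol_over F (mat_vars N)"
  shows "eval_pol h (($$) Y) (msubst N M P) = eval_pol h (($$) (Y * map_mat h M)) P"
proof -
  have "mat N N Var * map_mat Const M \<in> carrier_mat N N" using assms(3) by (intro mult_carrier_mat[of _ _ N]) auto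
  note 1 = eval_mat_eval_mat[OF assms(1) this assms(4)]
  have "map_mat (eval_pol h (($$) Y)) (mat N N Var * map_mat Const M) = Y * map_mat h M"
    using map_mat_hom_mult[OF eval_pol_comm_ring_hom[OF assms(1)], of "mat N N Var" N N "map_mat Const M" N] assms
    by (simp add: map_mat_eval_Const map_mat_eval_Var)
  then show ?thesis by (simp add: msubst_alt 1)
qed

lemma entry_mult_mat:
  "i < N \<Longrightarrow> j < N \<Longrightarrow> A \<in> carrier_mat N N \<Longrightarrow> B \<in> carrier_mat N N \<Longrightarrow>
   (A * B) $$ (i, j) = (\<Sum>d<N. A $$ (i, d) * B $$ (d, j))"
  by (auto simp: scalar_prod_def lessThan_atLeast0 intro!: sum.cong)

lemma msubst_hom: "comm_ring_hom (msubst N M)"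
  unfolding msubst_alt by (rule eval_pol_comm_ring_hom[OF comm_ring_hom_Const])

lemma msubst_Const [simp]: "msubst N M (Const c) = Const c"
  by (simp add: msubst_alt)

lemma Var_mult_mat:
  assumes "M \<in> carrier_mat N N" "i < N" "j < N"
  shows "(mat N N Var * map_mat Const M) $$ (i, j) = (\<Sum>d<N. Var (i, d) * Const (M $$ (d, j)))"
  using assms by (subst entry_mult_mat[of i N j]) auto

lemma msubst_pol_over:
  assumes "M \<in> carrier_mat N N" "P \<in> pol_over UNIV (mat_vars N)"
  shows "msubst N M P \<in> pol_over UNIV (mat_vars N)"
  unfolding msubst_alt
proof (rule eval_pol_in_subring[OF is_subring_pol_over[OF is_subring_UNIV] assms(2)])
  note R = is_subring_pol_over[OF is_subring_UNIV, of "mat_vars N"]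
  fix v assume "v \<in> mat_vars N"
  then obtain i j where v: "v = (i, j)" "i < N" "j < N" by (auto simp: mat_vars_def)
  have "(mat N N Var * map_mat Const M) $$ (i, j) = (\<Sum>d<N. Var (i, d) * Const (M $$ (d, j)))"
    using assms(1) v by (intro Var_mult_mat)
  also have "\<dots> \<in> pol_over UNIV (mat_vars N)"
    using v by (intro is_subring_sum R is_subringD(4)[OF R] pol_over_Const pol_over_Var) (auto simp: mat_vars_def)
  finally show "(mat N N Var * map_mat Const M) $$ v \<in> pol_over UNIV (mat_vars N)" by (simp add: v)
qed (simp add: pol_over_Const)

lemma msubst_msubst:
  assumes "M \<in> carrier_mat N N" "M' \<in> carrier_mat N N" "P \<in> pol_over UNIV (mat_vars N)"
  shows "msubst N M (msubst N M' P) = msubst N (M * M') P"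
proof -
  have c: "mat N N Var * map_mat Const M \<in> carrier_mat N N" using assms(1) by (intro mult_carrier_mat[of _ _ N]) auto
  have "msubst N M (msubst N M' P) = eval_pol Const (($$) (mat N N Var * map_mat Const M * map_mat Const M')) P"
    unfolding msubst_alt[of N M] by (rule eval_msubst[OF comm_ring_hom_Const c assms(2,3)])
  also have "mat N N Var * map_mat Const M * map_mat Const M' = mat N N Var * map_mat Const (M * M')"
    using assms by (simp add: map_mat_hom_mult[OF comm_ring_hom_Const, of _ N N _ N] assoc_mult_mat[of _ N N _ N _ N])
  finally show ?thesis by (simp add: msubst_alt)
qed

lemma msubst_one: "P \<in> pol_over UNIV (mat_vars N) \<Longrightarrow> msubst N (1\<^sub>m N) P = P"
proof -
  assume P: "P \<in> pol_over UNIV (mat_vars N)"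
  have "map_mat Const (1\<^sub>m N) = (1\<^sub>m N :: (nat \<times> nat, 'a) mpol mat)" by (intro eq_matI) auto
  then show ?thesis by (simp add: msubst_alt eval_mat_Var[OF P] right_mult_one_mat[of _ N N])
qed

section \<open>Invariant subspaces of polynomials\<close>

lemma finite_mat_vars: "finite (mat_vars N)"
proof -
  have "mat_vars N = {..<N} \<times> {..<N}" by (auto simp: mat_vars_def)
  then show ?thesis by simp
qed

text \<open>For finite \<open>V\<close> a finite set, whose span over the coefficient field consists
  of the polynomials in \<open>V\<close> of degree at most \<open>d\<close>.\<close>

fun low_monomials :: "'v set \<Rightarrow> nat \<Rightarrow> ('v, 'a::comm_ring_1) mpol set" where
  "low_monomials V 0 = {1}"
| "low_monomials V (Suc d) = low_monomials V d \<union> (\<lambda>(v, g). Var v * g) ` (V \<times> low_monomials V d)"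

lemma vector_space_mpol: "vector_space (\<lambda>(c::'a::field) (P::('v, 'a) mpol). Const c * P)"
  by unfold_locales (auto simp: Const_add Const_mult algebra_simps)

text \<open>
  A linear substitution preserves the finite dimensional spaces of polynomials of bounded degree. Hence
  a subspace that it maps into itself is mapped onto itself: the iterates of one polynomial are linearly dependent.
\<close>
lemma msubst_invariant_imp_onto:
  fixes M :: "'u::field mat"
  assumes M: "M \<in> carrier_mat N N" "M' \<in> carrier_mat N N" "M * M' = 1\<^sub>m N" "M' * M = 1\<^sub>m N"
    and I: "I \<subseteq> pol_over UNIV (mat_vars N)" "0 \<in> I" "\<And>P Q. P \<in> I \<Longrightarrow> Q \<in> I \<Longrightarrow> P + Q \<in> I" "\<And>c P. P \<in> I \<Longrightarrow> Const c * P \<in> I"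
    and inv: "\<And>P. P \<in> I \<Longrightarrow> msubst N M P \<in> I"
  shows "msubst N M ` I = I"
proof -
  let ?V = "mat_vars N"
  interpret vs: vector_space "\<lambda>(c::'u) (P::(nat \<times> nat, 'u) mpol). Const c * P" by (rule vector_space_mpol)
  interpret t: comm_ring_hom "msubst N M" by (rule msubst_hom)
  interpret t': comm_ring_hom "msubst N M'" by (rule msubst_hom)
  define G where "G = (\<lambda>d. low_monomials ?V d :: (nat \<times> nat, 'u) mpol set)"
  have G0: "G 0 = {1}" and GS: "G (Suc d) = G d \<union> (\<lambda>(v, g). Var v * g) ` (?V \<times> G d)" for d
    by (auto simp: G_def)
  have finG: "finite (G d)" for d
    by (induction d) (auto simp: G0 GS finite_mat_vars)
  have G_mono: "vs.span (G d) \<subseteq> vs.span (G e)" if "d \<le> e" for d e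
  proof (rule vs.span_mono)
    show "G d \<subseteq> G e" using that by (induction e rule: dec_induct) (auto simp: GS)
  qed
  have one: "1 \<in> G d" for d by (induction d) (auto simp: G0 GS)
  have Const_span: "Const c \<in> vs.span (G d)" for c d
    using vs.span_scale[OF vs.span_base[OF one[of d]], of c] by simp
  have Var_mult: "Var v * h \<in> vs.span (G (Suc d))" if "v \<in> ?V" "h \<in> vs.span (G d)" for v h d
    using that(2)
  proof (induction rule: vs.span_induct_alt)
    case base
    then show ?case by (simp add: vs.span_zero)
  next
    case (step c x y)
    have "Var v * x \<in> vs.span (G (Suc d))" using step(1) that(1) by (intro vs.span_base) (auto simp: GS)
    then have "Const c * (Var v * x) + Var v * y \<in> vs.span (G (Suc d))"
      by (intro vs.span_add vs.span_scale step(2))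
    then show ?case by (simp add: algebra_simps)
  qed
  have mult_base: "g * h \<in> vs.span (G (d + e))" if "g \<in> G d" "h \<in> vs.span (G e)" for g h d e
    using that(1)
  proof (induction d arbitrary: g)
    case 0
    then show ?case using that(2) by (simp add: G0)
  next
    case (Suc d)
    then consider "g \<in> G d" | v g' where "v \<in> ?V" "g' \<in> G d" "g = Var v * g'" by (auto simp: GS)
    then show ?case
    proof cases
      case 1
      then show ?thesis using Suc.IH G_mono[of "d + e" "Suc d + e"] by auto
    next
      case 2
      then show ?thesis using Var_mult[OF 2(1) Suc.IH[OF 2(2)]] by (simp add: mult.assoc)
    qed
  qed
  have mult_span: "g * h \<in> vs.span (G (d + e))" if "g \<in> vs.span (G d)" "h \<in> vs.span (G e)" for g h d e
    using that(1)
  proof (induction rule: vs.span_induct_alt)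
    case base
    then show ?case by (simp add: vs.span_zero)
  next
    case (step c x y)
    have "Const c * (x * h) + y * h \<in> vs.span (G (d + e))"
      by (intro vs.span_add vs.span_scale step(2) mult_base that(2) step(1))
    then show ?case by (simp add: algebra_simps)
  qed
  have all: "\<exists>d. P \<in> vs.span (G d)" if "P \<in> pol_over UNIV ?V" for P
    using that is_subring_UNIV
  proof (induction P rule: pol_over_induct)
    case (Const c)
    then show ?case using Const_span by blast
  next
    case (Var v)
    then show ?case using Var_mult[OF Var Const_span[of 1 0]] by auto
  next
    case (add P Q)
    then obtain d e where "P \<in> vs.span (G d)" "Q \<in> vs.span (G e)" by blast
    then have "P + Q \<in> vs.span (G (max d e))"
      using G_mono[of d "max d e"] G_mono[of e "max d e"] by (intro vs.span_add) auto
    then show ?case ..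
  next
    case (mult P Q)
    then show ?case using mult_span by blast
  qed
  \<comment> \<open>Each entry of \<open>Z * M\<close> is a linear form, so the degree bound is
    kept.\<close>
  have tG: "msubst N M g \<in> vs.span (G d)" if "g \<in> G d" for g d
    using that
  proof (induction d arbitrary: g)
    case 0
    then show ?case by (simp add: G0 vs.span_base)
  next
    case (Suc d)
    then consider "g \<in> G d" | v g' where "v \<in> ?V" "g' \<in> G d" "g = Var v * g'" by (auto simp: GS)
    then show ?case
    proof cases
      case 1
      then show ?thesis using Suc.IH G_mono[of d "Suc d"] by auto
    next
      case 2
      obtain i j where v: "v = (i, j)" "i < N" "j < N" using 2(1) by (auto simp: mat_vars_def)
      have "msubst N M (Var v) = (\<Sum>a<N. Var (i, a) * Const (M $$ (a, j)))"
        using Var_mult_mat[OF M(1) v(2,3)] unfolding msubst_alt v(1) by (simp only: eval_pol_Var Const_0 Const_1)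
      then have "msubst N M g = (\<Sum>a<N. Const (M $$ (a, j)) * (Var (i, a) * msubst N M g'))"
        by (simp add: 2(3) t.hom_mult sum_distrib_left sum_distrib_right mult_ac)
      also have "\<dots> \<in> vs.span (G (Suc d))"
        using v Suc.IH[OF 2(2)] by (intro vs.span_sum vs.span_scale Var_mult) (auto simp: mat_vars_def)
      finally show ?thesis .
    qed
  qed
  have t_span: "msubst N M g \<in> vs.span (G d)" if "g \<in> vs.span (G d)" for g d
    using that
  proof (induction rule: vs.span_induct_alt)
    case base
    then show ?case by (simp add: vs.span_zero)
  next
    case (step c x y)
    have "Const c * msubst N M x + msubst N M y \<in> vs.span (G d)"
      by (intro vs.span_add vs.span_scale step(2) tG step(1))
    then show ?case by (simp add: t.hom_add t.hom_mult)
  qed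
  have t_t': "msubst N M (msubst N M' P) = P" "msubst N M' (msubst N M P) = P" if "P \<in> pol_over UNIV ?V" for P
    using msubst_msubst[OF M(1,2) that] msubst_msubst[OF M(2,1) that] M(3,4) msubst_one[OF that] by auto
  have "msubst N M' P \<in> I" if P: "P \<in> I" for P
  proof -
    \<comment> \<open>It remains to show that the inverse substitution also preserves
      \<open>I\<close>. All iterates of \<open>R\<close> except possibly \<open>R\<close> itself lie
      in \<open>I\<close>.\<close>
    define R where "R = msubst N M' P"
    define f where "f i = (msubst N M ^^ i) R" for i
    have RV: "R \<in> pol_over UNIV ?V" using P I(1) M(2) by (auto simp: R_def intro!: msubst_pol_over)
    have fV: "f i \<in> pol_over UNIV ?V" for i
      by (induction i) (auto simp: f_def RV intro!: msubst_pol_over M(1))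
    have f1: "f 1 = P" using t_t' P I(1) by (auto simp: f_def R_def)
    have fI: "f (Suc i) \<in> I" for i
      by (induction i) (use f1 P inv in \<open>auto simp: f_def\<close>)
    have cancel: "(msubst N M' ^^ j) (f (j + i)) = f i" for i j
    proof (induction j)
      case (Suc j)
      have "(msubst N M' ^^ Suc j) (f (Suc j + i)) = (msubst N M' ^^ j) (msubst N M' (msubst N M (f (j + i))))"
        by (simp add: funpow_swap1 f_def)
      then show ?case using Suc t_t'(2)[OF fV] by simp
    qed simp
    have t'0: "(msubst N M' ^^ j) 0 = 0" for j by (induction j) auto
    obtain d where d: "R \<in> vs.span (G d)" using all RV by blast
    have fd: "f i \<in> vs.span (G d)" for i
      by (induction i) (use d t_span in \<open>auto simp: f_def\<close>)
    define n where "n = card (G d)"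
    have "\<exists>a. (\<exists>i\<le>n. a i \<noteq> 0) \<and> (\<Sum>i\<le>n. Const (a i) * f i) = 0"
    proof (cases "inj_on f {..n}")
      case True
      have "\<not> vs.independent (f ` {..n})"
      proof
        assume "vs.independent (f ` {..n})"
        moreover have "f ` {..n} \<subseteq> vs.span (G d)" using fd by auto
        ultimately have "card (f ` {..n}) \<le> card (G d)"
          using vs.independent_span_bound[OF finG] by blast
        then show False using True by (simp add: card_image n_def)
      qed
      then obtain u where u: "\<exists>v\<in>f ` {..n}. u v \<noteq> 0" "(\<Sum>v\<in>f ` {..n}. Const (u v) * v) = 0"
        using vs.dependent_finite[of "f ` {..n}"] by auto
      then show ?thesis
        by (intro exI[of _ "\<lambda>i. u (f i)"]) (auto simp: sum.reindex[OF True])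
    next
      \<comment> \<open>A repetition among the iterates is itself a dependence relation.\<close>
      case False
      then obtain i j where ij: "i \<le> n" "j \<le> n" "i \<noteq> j" "f i = f j" by (auto simp: inj_on_def)
      define a where "a l = (if l = i then 1 else if l = j then - 1 else (0::'u))" for l
      have "(\<Sum>l\<le>n. Const (a l) * f l) = (\<Sum>l\<in>{i, j}. Const (a l) * f l)"
        by (rule sum.mono_neutral_right) (use ij in \<open>auto simp: a_def\<close>)
      also have "\<dots> = f i + Const (- 1) * f i" using ij by (simp add: a_def)
      also have "\<dots> = 0" by (simp add: Const_uminus)
      finally show ?thesis using ij by (intro exI[of _ a]) (auto simp: a_def)
    qed
    then obtain a where a: "\<exists>i\<le>n. a i \<noteq> 0" "(\<Sum>i\<le>n. Const (a i) * f i) = 0" by blast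
    \<comment> \<open>Applying the inverse \<open>m\<close> times to the relation shifts its first
      nonzero term to \<open>R\<close>, which becomes a combination of later iterates.\<close>
    define m where "m = (LEAST i. i \<le> n \<and> a i \<noteq> 0)"
    have m: "m \<le> n" "a m \<noteq> 0" using LeastI_ex[of "\<lambda>i. i \<le> n \<and> a i \<noteq> 0"] a(1) by (auto simp: m_def)
    have am: "a i = 0" if "i < m" for i
      using not_less_Least[of i "\<lambda>i. i \<le> n \<and> a i \<noteq> 0"] that m(1) by (auto simp: m_def)
    have t'm: "(msubst N M' ^^ j) (\<Sum>i\<in>A. Const (c i) * g i) = (\<Sum>i\<in>A. Const (c i) * (msubst N M' ^^ j) (g i))"
      for j c g and A :: "nat set"
      by (induction j) (simp_all add: t'.hom_sum t'.hom_mult)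
    have "(\<Sum>i\<le>n. Const (a i) * f i) = (\<Sum>i\<in>{m..n}. Const (a i) * f i)"
      by (rule sum.mono_neutral_right) (use am in \<open>auto simp: not_le\<close>)
    then have "0 = (msubst N M' ^^ m) (\<Sum>i\<in>{m..n}. Const (a i) * f i)" using a(2) t'0 by simp
    also have "\<dots> = (\<Sum>i\<in>{m..n}. Const (a i) * f (i - m))"
      unfolding t'm
    proof (rule sum.cong[OF refl])
      fix i assume "i \<in> {m..n}"
      then show "Const (a i) * (msubst N M' ^^ m) (f i) = Const (a i) * f (i - m)"
        using cancel[of m "i - m"] by simp
    qed
    also have "\<dots> = Const (a m) * R + (\<Sum>i\<in>{Suc m..n}. Const (a i) * f (i - m))"
      using m(1) by (simp add: sum.atLeast_Suc_atMost f_def)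
    finally have eq: "Const (a m) * R = - (\<Sum>i\<in>{Suc m..n}. Const (a i) * f (i - m))"
      by (simp add: eq_neg_iff_add_eq_0)
    have sumI: "sum g A \<in> I" if "\<And>i. i \<in> A \<Longrightarrow> g i \<in> I" for g and A :: "nat set"
      using that by (induction A rule: infinite_finite_induct) (auto simp: I)
    have "(\<Sum>i\<in>{Suc m..n}. Const (a i) * f (i - m)) \<in> I"
    proof (intro sumI I(4))
      fix i assume "i \<in> {Suc m..n}"
      then have "i - m = Suc (i - Suc m)" by auto
      then show "f (i - m) \<in> I" using fI by simp
    qed
    then have "Const (- inverse (a m)) * (\<Sum>i\<in>{Suc m..n}. Const (a i) * f (i - m)) \<in> I" by (rule I(4))
    also have "Const (- inverse (a m)) * (\<Sum>i\<in>{Suc m..n}. Const (a i) * f (i - m)) = Const (inverse (a m)) * (Const (a m) * R)"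
      unfolding eq by (simp add: Const_uminus)
    also have "\<dots> = R" using m(2) by (simp add: mult.assoc[symmetric] flip: Const_mult)
    finally show ?thesis by (simp add: R_def)
  qed
  then show ?thesis
    using t_t'(1) I(1) inv by (auto simp: image_iff) (metis subsetD)
qed

section \<open>Galois groups of difference systems\<close>

lemma poly_mapping_monomial_induct [consumes 1, case_names zero add]:
  assumes "Poly_Mapping.keys t \<subseteq> V" "R 0" "\<And>t v. v \<in> V \<Longrightarrow> R t \<Longrightarrow> R (t + Poly_Mapping.single v (1::nat))"
  shows "R t"
  using assms(1)
\<comment> \<open>Evaluation at 2 everywhere gives 2 to the power of the total degree, which drops
  when a variable is removed.\<close>
proof (induction "eval_mon (\<lambda>_. 2::nat) t" arbitrary: t rule: less_induct)
  case less
  show ?case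
  proof (cases "t = 0")
    case False
    then obtain v where v: "v \<in> Poly_Mapping.keys t" using keys_eq_empty by blast
    define s where "s = t - Poly_Mapping.single v 1"
    have t: "t = s + Poly_Mapping.single v 1"
      using v by (intro poly_mapping_eqI) (auto simp: s_def lookup_add lookup_minus lookup_single when_def in_keys_iff)
    have k: "Poly_Mapping.keys s \<subseteq> V"
      using less.prems by (auto simp: s_def in_keys_iff lookup_minus subset_iff)
    have "0 < eval_mon (\<lambda>_. 2::nat) s" by (simp add: eval_mon_def prod_pos)
    then have "eval_mon (\<lambda>_. 2) s < eval_mon (\<lambda>_. 2::nat) t"
      by (simp add: t eval_mon_add)
    then show ?thesis using less.hyps[of s] k assms(3)[of v s] v less.prems t by auto
  qed (use assms(2) in simp)
qed

text \<open>Meant for \<open>f t\<close> that are additive in the coefficient without being linear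
  over the coefficient ring, as happens for maps of the form
  \<open>id \<otimes> \<mu>\<close>.\<close>

definition functional :: "(('v \<Rightarrow>\<^sub>0 nat) \<Rightarrow> 'a::comm_ring_1 \<Rightarrow> 'b::comm_ring_1) \<Rightarrow> ('v, 'a) mpol \<Rightarrow> 'b" where
  "functional f Q = (\<Sum>t\<in>Poly_Mapping.keys Q. f t (Poly_Mapping.lookup Q t))"

lemma functional_superset:
  assumes "\<And>t. f t 0 = 0" "finite A" "Poly_Mapping.keys Q \<subseteq> A"
  shows "functional f Q = (\<Sum>t\<in>A. f t (Poly_Mapping.lookup Q t))"
  unfolding functional_def by (rule sum.mono_neutral_left) (use assms in \<open>auto simp: in_keys_iff\<close>)

context
  fixes f :: "('v \<Rightarrow>\<^sub>0 nat) \<Rightarrow> 'a::comm_ring_1 \<Rightarrow> 'b::comm_ring_1"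
  assumes add: "\<And>t a b. f t (a + b) = f t a + f t b"
begin

lemma functional_coeff_0: "f t 0 = 0"
  using add[of t 0 0] by (simp only: add_0_left add_cancel_right_right)

lemma functional_add: "functional f (P + Q) = functional f P + functional f Q"
proof -
  let ?A = "Poly_Mapping.keys P \<union> Poly_Mapping.keys Q"
  have "functional f (P + Q) = (\<Sum>t\<in>?A. f t (Poly_Mapping.lookup (P + Q) t))"
    by (rule functional_superset) (auto simp: functional_coeff_0 Poly_Mapping.keys_add)
  also have "\<dots> = (\<Sum>t\<in>?A. f t (Poly_Mapping.lookup P t)) + (\<Sum>t\<in>?A. f t (Poly_Mapping.lookup Q t))"
    by (simp add: lookup_add add sum.distrib)
  also have "\<dots> = functional f P + functional f Q"
    using functional_superset[of f ?A P] functional_superset[of f ?A Q] functional_coeff_0 by simp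
  finally show ?thesis .
qed

lemma functional_sum: "functional f (\<Sum>i\<in>A. P i) = (\<Sum>i\<in>A. functional f (P i))"
  by (induction A rule: infinite_finite_induct) (auto simp: functional_add, auto simp: functional_def)

lemma functional_single: "functional f (Poly_Mapping.single t c) = f t c"
  using functional_superset[of f "{t}" "Poly_Mapping.single t c"] functional_coeff_0 by simp

lemma functional_mult_single:
  "functional f (Q * Poly_Mapping.single s c) = functional (\<lambda>t u. f (t + s) (u * c)) Q"
proof -
  have "Q * Poly_Mapping.single s c = (\<Sum>t\<in>Poly_Mapping.keys Q. Poly_Mapping.single (t + s) (Poly_Mapping.lookup Q t * c))"
    by (subst mpol_expand[of Q]) (simp add: sum_distrib_right mult_single)
  then show ?thesis by (simp add: functional_sum functional_single) (simp add: functional_def)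
qed

end

lemma functional_cmult: "functional (\<lambda>t u. c * f t u) Q = c * functional f Q"
  by (simp add: functional_def sum_distrib_left)

text \<open>A single linear difference system of arbitrary size, later instantiated for every order
  \<open>n\<close> with the prolongations of \<open>X\<close> and \<open>A\<close>. At this level
  there is no derivation.\<close>

locale difference_system =
  fixes \<sigma> :: "'l::field \<Rightarrow> 'l" and K :: "'l set" and N :: nat and \<X> \<X>' \<A> :: "'l mat" and \<iota> :: "'l \<Rightarrow> 'u::field"
  assumes \<sigma>: "comm_ring_hom \<sigma>" and K: "is_subfield K" and \<iota>_hom: "hom_on K \<iota>"
    and fixed: "\<And>x. \<sigma> x = x \<Longrightarrow> x \<in> K" and \<sigma>K: "\<And>x. x \<in> K \<Longrightarrow> \<sigma> x \<in> K"
    and \<X>: "\<X> \<in> carrier_mat N N" "\<X>' \<in> carrier_mat N N" "\<X> * \<X>' = 1\<^sub>m N" "\<X>' * \<X> = 1\<^sub>m N"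
    and \<A>: "\<A> \<in> carrier_mat N N" "\<And>i j. i < N \<Longrightarrow> j < N \<Longrightarrow> \<A> $$ (i, j) \<in> K"
    and \<sigma>\<X>: "map_mat \<sigma> \<X> = \<A> * \<X>"
begin

interpretation \<sigma>: comm_ring_hom \<sigma> by (rule \<sigma>)

sublocale KU: field_embedding K \<iota> by unfold_locales (rule K \<iota>_hom)+

sublocale KL: field_embedding K "id :: 'l \<Rightarrow> 'l" by unfold_locales (auto simp: K hom_on_def)

abbreviation V where "V \<equiv> mat_vars N"

definition C where "C = {x. \<sigma> x = x}"

definition I where "I = vanishing_ideal K V (($$) \<X>)"

definition IL where "IL = extend_ideal (id :: 'l \<Rightarrow> 'l) V I"

definition IU where "IU = extend_ideal \<iota> V I"

text \<open>Represents the inverse of the fundamental matrix times the generic matrix, before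
  reduction modulo \<open>IL\<close>. Substitution of \<open>XT\<close> undoes substitution of
  \<open>T0\<close>.\<close>

definition T0 :: "(nat \<times> nat, 'l) mpol mat" where "T0 = map_mat Const \<X>' * mat N N Var"

definition XT :: "(nat \<times> nat, 'l) mpol mat" where "XT = map_mat Const \<X> * mat N N Var"

definition J where "J = {q \<in> pol_over C V. eval_pol Const (($$) T0) q \<in> IL}"

lemma T0_carrier: "T0 \<in> carrier_mat N N" and XT_carrier: "XT \<in> carrier_mat N N"
  using \<X> by (auto simp: T0_def XT_def intro!: mult_carrier_mat[of _ _ N])

lemma I_ideal: "is_ideal_in (pol_over K V) I"
  unfolding I_def by (rule vanishing_ideal_is_ideal[OF KU.subring])

lemma C_K: "C \<subseteq> K" using fixed by (auto simp: C_def)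

lemma C_subring: "is_subring C"
  by (auto simp: is_subring_def C_def \<sigma>.hom_add \<sigma>.hom_mult \<sigma>.hom_uminus)

lemma eval_const_mat_Var:
  assumes "B \<in> carrier_mat N N" "P \<in> pol_over F V" "comm_ring_hom h" "Y \<in> carrier_mat N N"
  shows "eval_pol h (($$) Y) (eval_pol Const (($$) (map_mat Const B * mat N N Var)) P) =
    eval_pol h (($$) (map_mat h B * Y)) P"
proof -
  have c: "map_mat Const B * mat N N Var \<in> carrier_mat N N"
    using assms(1) by (intro mult_carrier_mat[of _ _ N]) auto
  have "map_mat (eval_pol h (($$) Y)) (map_mat Const B * mat N N Var) = map_mat h B * Y"
    using map_mat_hom_mult[OF eval_pol_comm_ring_hom[OF assms(3)], of "map_mat Const B" N N "mat N N Var" N] assms(1)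
    by (simp add: map_mat_eval_Const[OF assms(3)] map_mat_eval_Var[OF assms(3,4)])
  then show ?thesis by (simp add: eval_mat_eval_mat[OF assms(3) c assms(2)])
qed

lemma const_mat_cancel:
  assumes "A \<in> carrier_mat N N" "B \<in> carrier_mat N N" "A * B = 1\<^sub>m N"
  shows "map_mat Const A * (map_mat Const B * mat N N Var) = (mat N N Var :: (nat \<times> nat, 'l) mpol mat)"
proof -
  interpret comm_ring_hom "Const :: 'l \<Rightarrow> (nat \<times> nat, 'l) mpol" by (rule comm_ring_hom_Const)
  have "map_mat Const A * (map_mat Const B * mat N N Var) = map_mat Const (A * B) * (mat N N Var :: (nat \<times> nat, 'l) mpol mat)"
    using assms(1,2) by (simp add: mat_hom_mult[of _ N N _ N] assoc_mult_mat[of _ N N _ N _ N])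
  also have "\<dots> = mat N N Var"
    unfolding assms(3) mat_hom_one by (rule left_mult_one_mat[of _ N N]) simp
  finally show ?thesis .
qed

lemma eval_T0_XT:
  assumes "P \<in> pol_over F V"
  shows "eval_pol Const (($$) T0) (eval_pol Const (($$) XT) P) = P"
    "eval_pol Const (($$) XT) (eval_pol Const (($$) T0) P) = P"
  using eval_const_mat_Var[OF \<X>(1) assms comm_ring_hom_Const T0_carrier]
    eval_const_mat_Var[OF \<X>(2) assms comm_ring_hom_Const XT_carrier]
  by (simp_all add: T0_def XT_def const_mat_cancel \<X> eval_mat_Var[OF assms])

lemma eval_const_mat_pol_over:
  assumes "is_subring F" "B \<in> carrier_mat N N" "\<And>i j. i < N \<Longrightarrow> j < N \<Longrightarrow> B $$ (i, j) \<in> F"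
    "P \<in> pol_over F' V" "\<And>c. c \<in> F' \<Longrightarrow> h c \<in> pol_over F V"
  shows "eval_pol h (($$) (map_mat Const B * mat N N Var)) P \<in> pol_over F V"
proof (rule eval_pol_in_subring[OF is_subring_pol_over[OF assms(1)] assms(4)])
  note R = is_subring_pol_over[OF assms(1), of V]
  fix v assume "v \<in> V"
  then obtain i j where v: "v = (i, j)" "i < N" "j < N" by (auto simp: mat_vars_def)
  have "(map_mat Const B * mat N N Var) $$ (i, j) = (\<Sum>d<N. Const (B $$ (i, d)) * Var (d, j))"
    using assms(2) v by (subst entry_mult_mat[of i N j]) auto
  also have "\<dots> \<in> pol_over F V"
    using v assms(1,3) by (intro is_subring_sum R is_subringD(4)[OF R] pol_over_Const pol_over_Var) (auto simp: mat_vars_def)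
  finally show "(map_mat Const B * mat N N Var) $$ v \<in> pol_over F V" by (simp add: v)
qed (rule assms(5))

section \<open>The extension of \<sigma> to polynomials and descent to its fixed field\<close>

definition \<Sigma> where "\<Sigma> = eval_pol (Const \<circ> \<sigma>) (($$) (map_mat Const \<A> * mat N N Var))"

lemma \<Sigma>_hom: "comm_ring_hom \<Sigma>"
  unfolding \<Sigma>_def by (intro eval_pol_comm_ring_hom comm_ring_hom_comp comm_ring_hom_Const \<sigma>)

text \<open>\<open>\<Sigma>\<close> treats \<open>Z\<close> as \<open>\<sigma>\<close> treats
  \<open>\<X>\<close>, so evaluation at \<open>\<X>\<close> intertwines the two and relations of
  \<open>\<X>\<close> go to relations.\<close>

lemma \<Sigma>_I:
  assumes "p \<in> I"
  shows "\<Sigma> p \<in> I"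
proof -
  have p: "p \<in> pol_over K V" "eval_pol id (($$) \<X>) p = 0" using assms by (auto simp: I_def vanishing_ideal_def)
  have 1: "\<Sigma> p \<in> pol_over K V"
    unfolding \<Sigma>_def by (rule eval_const_mat_pol_over) (use \<A> p(1) \<sigma>K KU.subring in \<open>auto intro: pol_over_Const\<close>)
  have c: "map_mat Const \<A> * mat N N Var \<in> carrier_mat N N"
    using \<A>(1) by (intro mult_carrier_mat[of _ _ N]) auto
  have "eval_pol id (($$) \<X>) (\<Sigma> p) = eval_pol (eval_pol id (($$) \<X>) \<circ> (Const \<circ> \<sigma>)) (($$) (map_mat (eval_pol id (($$) \<X>)) (map_mat Const \<A> * mat N N Var))) p"
    unfolding \<Sigma>_def by (rule hom_eval_mat[OF eval_pol_comm_ring_hom[OF comm_ring_hom_id] c p(1)])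
  also have "map_mat (eval_pol id (($$) \<X>)) (map_mat Const \<A> * mat N N Var) = map_mat \<sigma> \<X>"
    using map_mat_hom_mult[OF eval_pol_comm_ring_hom[OF comm_ring_hom_id], of "map_mat Const \<A>" N N "mat N N Var" N "($$) \<X>"] \<A>(1)
    by (simp add: map_mat_eval_Const[OF comm_ring_hom_id] map_mat_eval_Var[OF comm_ring_hom_id \<X>(1)] \<sigma>\<X>)
      (intro arg_cong2[where f = "(*)"] eq_matI; simp)
  also have "eval_pol id (($$) \<X>) \<circ> (Const \<circ> \<sigma>) = \<sigma> \<circ> id" by auto
  also have "eval_pol (\<sigma> \<circ> id) (($$) (map_mat \<sigma> \<X>)) p = \<sigma> (eval_pol id (($$) \<X>) p)"
    by (rule hom_eval_mat[OF \<sigma> \<X>(1) p(1), symmetric])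
  finally have "eval_pol id (($$) \<X>) (\<Sigma> p) = 0" by (simp only: p(2) \<sigma>.hom_zero)
  then show ?thesis using 1 by (simp add: I_def vanishing_ideal_def)
qed

lemma IL_ideal: "is_ideal_in (pol_over UNIV V) IL"
  unfolding IL_def by (rule KL.extend_ideal_is_ideal[OF I_ideal])

lemma IU_ideal: "is_ideal_in (pol_over UNIV V) IU"
  unfolding IU_def by (rule KU.extend_ideal_is_ideal[OF I_ideal])

lemma I_IL: "p \<in> I \<Longrightarrow> p \<in> IL"
  using KL.map_mem_extend_ideal[of p I V] by (simp add: IL_def)

lemma \<Sigma>_IL:
  assumes "P \<in> IL"
  shows "\<Sigma> P \<in> IL"
proof -
  interpret S: comm_ring_hom \<Sigma> by (rule \<Sigma>_hom)
  obtain A p where A: "finite A" "\<And>b. p b \<in> I" "P = (\<Sum>b\<in>A. Const b * Poly_Mapping.map id (p b))"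
    using KL.extend_ideal_expand[OF I_ideal, of P] assms by (auto simp: IL_def)
  have "\<Sigma> P = (\<Sum>b\<in>A. Const (\<sigma> b) * \<Sigma> (p b))"
    by (simp add: A(3) S.hom_sum S.hom_mult) (simp add: \<Sigma>_def)
  also have "\<dots> \<in> IL"
    by (intro is_ideal_in_sum[OF IL_ideal] is_ideal_inD(4)[OF IL_ideal] pol_over_Const I_IL \<Sigma>_I A(2)) auto
  finally show ?thesis .
qed

text \<open>An \<open>L\<close>-subspace that turns out to be stable under \<open>\<sigma>\<close>
  acting on coefficients, so that descent applies to it; \<open>J\<close> is its part with
  coefficients in \<open>C\<close>.\<close>

definition \<AA> where "\<AA> = {Q \<in> pol_over UNIV V. eval_pol Const (($$) T0) Q \<in> IL}"

text \<open>Applying \<open>\<sigma>\<close> to \<open>\<X>' * \<X> = 1\<close> shows that the image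
  of \<open>\<X>'\<close> times \<open>\<A>\<close> is \<open>\<X>'\<close>, which absorbs the
  factor \<open>\<A>\<close> that \<open>\<Sigma>\<close> puts in front of \<open>Z\<close>.\<close>

lemma map_mat_\<Sigma>_T0: "map_mat \<Sigma> T0 = T0"
proof -
  let ?s = "map_mat \<sigma> \<X>'"
  interpret c: comm_ring_hom "Const :: 'l \<Rightarrow> (nat \<times> nat, 'l) mpol" by (rule comm_ring_hom_Const)
  have s: "?s \<in> carrier_mat N N" using \<X> by simp
  have "?s * (\<A> * \<X>) = 1\<^sub>m N"
    using \<sigma>.mat_hom_mult[OF \<X>(2,1)] \<sigma>.mat_hom_one[of N] by (simp add: \<sigma>\<X> \<X>(4))
  then have "?s * \<A> * \<X> = 1\<^sub>m N" using s \<A>(1) \<X>(1) by (simp add: assoc_mult_mat[of _ N N _ N _ N])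
  then have "?s * \<A> * \<X> * \<X>' = \<X>'" using \<X> by simp
  then have "?s * \<A> * (\<X> * \<X>') = \<X>'" using s \<A>(1) \<X> by (simp add: assoc_mult_mat[of _ N N _ N _ N])
  then have sA: "?s * \<A> = \<X>'" using s \<A>(1) \<X> by (simp add: right_mult_one_mat[of _ N N])
  have 1: "map_mat \<Sigma> (map_mat Const \<X>') = map_mat Const ?s"
    by (rule eq_matI) (auto simp: \<Sigma>_def)
  have 2: "map_mat \<Sigma> (mat N N Var) = map_mat Const \<A> * mat N N Var"
    using \<A>(1) by (intro eq_matI) (auto simp: \<Sigma>_def)
  have "map_mat \<Sigma> T0 = map_mat Const ?s * (map_mat Const \<A> * mat N N Var)"
    unfolding T0_def using map_mat_hom_mult[OF \<Sigma>_hom, of "map_mat Const \<X>'" N N "mat N N Var" N] \<X>(2)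
    by (simp add: 1 2)
  also have "\<dots> = map_mat Const (?s * \<A>) * mat N N Var"
    using s \<A>(1) by (simp add: c.mat_hom_mult[of _ N N _ N] assoc_mult_mat[of _ N N _ N _ N])
  finally show ?thesis by (simp add: sA T0_def)
qed

lemma \<AA>_\<sigma>:
  assumes "Q \<in> \<AA>"
  shows "Poly_Mapping.map \<sigma> Q \<in> \<AA>"
proof -
  have Q: "Q \<in> pol_over UNIV V" using assms by (simp add: \<AA>_def)
  have "eval_pol Const (($$) T0) (Poly_Mapping.map \<sigma> Q) = eval_pol (\<lambda>c. Const (\<sigma> c)) (($$) T0) Q"
    by (rule eval_pol_map) auto
  also have "\<dots> = eval_pol (\<Sigma> \<circ> Const) (($$) (map_mat \<Sigma> T0)) Q"
    by (simp add: map_mat_\<Sigma>_T0) (simp add: \<Sigma>_def o_def)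
  also have "\<dots> = \<Sigma> (eval_pol Const (($$) T0) Q)"
    by (rule hom_eval_mat[OF \<Sigma>_hom T0_carrier Q, symmetric])
  finally show ?thesis
    using assms \<Sigma>_IL map_pol_over[OF Q, of \<sigma> UNIV] by (simp add: \<AA>_def)
qed

lemma \<AA>_subspace: "0 \<in> \<AA>" "P \<in> \<AA> \<Longrightarrow> Q \<in> \<AA> \<Longrightarrow> P + Q \<in> \<AA>" "P \<in> \<AA> \<Longrightarrow> Const c * P \<in> \<AA>" "P \<in> \<AA> \<Longrightarrow> Q \<in> \<AA> \<Longrightarrow> P - Q \<in> \<AA>"
proof -
  interpret e: comm_ring_hom "eval_pol Const (($$) T0)" by (rule eval_pol_comm_ring_hom[OF comm_ring_hom_Const])
  note R = is_subring_pol_over[OF is_subring_UNIV, of V]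
  show "0 \<in> \<AA>" by (simp add: \<AA>_def is_subringD[OF R] is_ideal_inD[OF IL_ideal])
  show a: "P + Q \<in> \<AA>" if "P \<in> \<AA>" "Q \<in> \<AA>" for P Q
    using that by (simp add: \<AA>_def is_subringD[OF R] is_ideal_inD[OF IL_ideal] e.hom_add)
  show c: "Const c * P \<in> \<AA>" if "P \<in> \<AA>" for P c
    using that by (simp add: \<AA>_def is_subringD[OF R] is_ideal_inD[OF IL_ideal] e.hom_mult pol_over_Const)
  show "P - Q \<in> \<AA>" if "P \<in> \<AA>" "Q \<in> \<AA>"
    using a[OF that(1) c[OF that(2), of "- 1"]] by (simp add: Const_def single_uminus)
qed

text \<open>A nonzero element of minimal support with one coefficient 1 is fixed by \<open>\<sigma>\<close>.\<close>
lemma descent: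
  assumes "P \<in> \<AA>"
  shows "\<exists>(n::nat) l q. (\<forall>i<n. q i \<in> J) \<and> P = (\<Sum>i<n. Const (l i) * q i)"
  using assms
proof (induction "card (Poly_Mapping.keys P)" arbitrary: P rule: less_induct)
  case less
  show ?case
  proof (cases "P = 0")
    case True
    then show ?thesis by (intro exI[of _ 0]) auto
  next
    case False
    define W where "W = {w \<in> \<AA>. w \<noteq> 0 \<and> Poly_Mapping.keys w \<subseteq> Poly_Mapping.keys P}"
    have "P \<in> W" using less.prems False by (simp add: W_def)
    then obtain w where w: "w \<in> W" "\<And>w'. w' \<in> W \<Longrightarrow> card (Poly_Mapping.keys w) \<le> card (Poly_Mapping.keys w')"
      using arg_min_natI[of "\<lambda>w. w \<in> W" P "\<lambda>w. card (Poly_Mapping.keys w)"]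
        arg_min_nat_le[of "\<lambda>w. w \<in> W" _ "\<lambda>w. card (Poly_Mapping.keys w)"] by blast
    then have "w \<noteq> 0" by (simp add: W_def)
    then obtain t where t: "t \<in> Poly_Mapping.keys w" using keys_eq_empty by blast
    define w' where "w' = Const (inverse (Poly_Mapping.lookup w t)) * w"
    have l: "Poly_Mapping.lookup w' s = inverse (Poly_Mapping.lookup w t) * Poly_Mapping.lookup w s" for s
      by (simp add: w'_def lookup_Const_mult)
    have lt: "Poly_Mapping.lookup w' t = 1" using t by (simp add: l in_keys_iff)
    have kw: "Poly_Mapping.keys w' = Poly_Mapping.keys w" using t by (auto simp: l in_keys_iff)
    have w'A: "w' \<in> \<AA>" using w(1) \<AA>_subspace(3) by (simp add: w'_def W_def)
    \<comment> \<open>The coefficient at \<open>t\<close> cancels because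
      \<open>\<sigma> 1 = 1\<close>, so \<open>v\<close> has smaller support than the minimal
      \<open>w\<close> and must be 0.\<close>
    define v where "v = Poly_Mapping.map \<sigma> w' - w'"
    have lv: "Poly_Mapping.lookup v s = \<sigma> (Poly_Mapping.lookup w' s) - Poly_Mapping.lookup w' s" for s
      by (simp add: v_def lookup_minus lookup_map)
    have "Poly_Mapping.keys v \<subseteq> Poly_Mapping.keys w - {t}"
      using lt by (auto simp: in_keys_iff lv kw[symmetric])
    moreover have "v \<in> \<AA>" using \<AA>_subspace(4)[OF \<AA>_\<sigma>[OF w'A] w'A] by (simp add: v_def)
    moreover have "card (Poly_Mapping.keys w - {t}) < card (Poly_Mapping.keys w)"
      using t by (intro psubset_card_mono) auto
    ultimately have v: "Poly_Mapping.keys v \<subseteq> Poly_Mapping.keys w - {t}" "v \<in> \<AA>"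
      "card (Poly_Mapping.keys w - {t}) < card (Poly_Mapping.keys w)" by auto
    have "v = 0"
    proof (rule ccontr)
      assume "v \<noteq> 0"
      then have "v \<in> W" using v(1,2) w(1) by (auto simp: W_def)
      then have "card (Poly_Mapping.keys w) \<le> card (Poly_Mapping.keys v)" by (rule w(2))
      also have "\<dots> \<le> card (Poly_Mapping.keys w - {t})" by (rule card_mono[OF _ v(1)]) simp
      finally show False using v(3) by simp
    qed
    then have "\<sigma> (Poly_Mapping.lookup w' s) = Poly_Mapping.lookup w' s" for s using lv[of s] by simp
    then have w'J: "w' \<in> J"
      using w'A by (auto simp: J_def \<AA>_def C_def pol_over_def)
    define P' where "P' = P - Const (Poly_Mapping.lookup P t) * w'"
    have "Poly_Mapping.keys w' \<subseteq> Poly_Mapping.keys P" using kw w(1) by (simp add: W_def)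
    then have "Poly_Mapping.lookup w' s = 0" if "Poly_Mapping.lookup P s = 0" for s
      using that by (meson in_keys_iff subsetD)
    then have "Poly_Mapping.keys P' \<subseteq> Poly_Mapping.keys P - {t}"
      using lt by (auto simp: P'_def in_keys_iff lookup_minus lookup_Const_mult)
    moreover have "t \<in> Poly_Mapping.keys P" using t w(1) by (auto simp: W_def)
    ultimately have "card (Poly_Mapping.keys P') < card (Poly_Mapping.keys P)"
      by (intro psubset_card_mono) auto
    moreover have "P' \<in> \<AA>" using \<AA>_subspace less.prems w'A by (simp add: P'_def)
    ultimately obtain n l q where n: "\<forall>i<n::nat. q i \<in> J" "P' = (\<Sum>i<n. Const (l i) * q i)"
      using less.hyps by blast
    have "P = (\<Sum>i<Suc n. Const ((l(n := Poly_Mapping.lookup P t)) i) * (q(n := w')) i)"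
      using n(2) by (simp add: P'_def algebra_simps)
    moreover have "\<forall>i<Suc n. (q(n := w')) i \<in> J" using n(1) w'J by (simp add: less_Suc_eq)
    ultimately show ?thesis by blast
  qed
qed

text \<open>In terms of \<open>L \<otimes>\<^sub>K U\<close> this is
  \<open>id \<otimes> \<mu>\<close> applied to the value at \<open>\<X>\<close> of a polynomial over
  \<open>U\<close>; the next definition is \<open>id \<otimes> \<mu>\<close> applied to the value at
  \<open>M\<close> of a polynomial over \<open>L\<close>.\<close>

definition eval_via_X where "eval_via_X \<mu> = functional (\<lambda>t u. \<mu> u * eval_mon (($$) \<X>) t)" for \<mu> :: "'u \<Rightarrow> 'l"

definition eval_via_M where "eval_via_M \<mu> M = functional (\<lambda>t l. l * \<mu> (eval_mon (($$) M) t))" for \<mu> :: "'u \<Rightarrow> 'l" and M :: "'u mat"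

context
  fixes \<mu> :: "'u \<Rightarrow> 'l"
  assumes \<mu>: "flinear K \<iota> \<mu>"
begin

lemma eval_via_X_sum: "eval_via_X \<mu> (sum P A) = (\<Sum>i\<in>A. eval_via_X \<mu> (P i))"
  unfolding eval_via_X_def by (rule functional_sum) (simp add: flinearD[OF \<mu>] distrib_right)

lemma eval_via_X_Var: "eval_via_X \<mu> (Q * Var v) = (\<X> $$ v) * eval_via_X \<mu> Q"
  unfolding eval_via_X_def Var_def
  by (subst functional_mult_single) (simp_all add: flinearD[OF \<mu>] distrib_left distrib_right eval_mon_add mult_ac flip: functional_cmult)

lemma eval_via_X_Const: "eval_via_X \<mu> (Q * Const c) = eval_via_X (\<lambda>u. \<mu> (c * u)) Q"
  unfolding eval_via_X_def Const_def
  by (subst functional_mult_single) (simp_all add: flinearD[OF \<mu>] distrib_right mult.commute[of _ c])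

lemma eval_via_X_Const_K: "c \<in> K \<Longrightarrow> eval_via_X \<mu> (Q * Const (\<iota> c)) = c * eval_via_X \<mu> Q"
  unfolding eval_via_X_Const by (simp add: eval_via_X_def flinearD(2)[OF \<mu>] mult.assoc functional_cmult)

lemma eval_via_M_sum: "eval_via_M \<mu> M (sum P A) = (\<Sum>i\<in>A. eval_via_M \<mu> M (P i))"
  unfolding eval_via_M_def by (rule functional_sum) (simp add: distrib_right)

lemma eval_via_M_Const: "eval_via_M \<mu> M (Q * Const c) = c * eval_via_M \<mu> M Q"
  unfolding eval_via_M_def Const_def
  by (subst functional_mult_single) (simp_all add: distrib_right mult_ac flip: functional_cmult)

lemma eval_via_M_Var: "eval_via_M \<mu> M (Q * Var v) = eval_via_M (\<lambda>u. \<mu> (M $$ v * u)) M Q"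
  unfolding eval_via_M_def Var_def
  by (subst functional_mult_single) (simp_all add: distrib_right eval_mon_add mult.commute[of _ "M $$ v"])

lemma eval_via_X_eval: "eval_via_X \<mu> Q = eval_pol id (($$) \<X>) (Poly_Mapping.map \<mu> Q)"
  by (subst eval_pol_map) (auto simp: eval_via_X_def functional_def eval_pol_alt flinearD(4)[OF \<mu>])

lemma eval_via_M_eval:
  assumes "q \<in> pol_over C V"
  shows "eval_via_M \<mu> M q = \<mu> (eval_pol \<iota> (($$) M) q)"
proof -
  have "\<mu> (\<iota> (Poly_Mapping.lookup q t) * u) = Poly_Mapping.lookup q t * \<mu> u" for t u
    using pol_over_lookup[OF assms] C_K by (intro flinearD(2)[OF \<mu>]) auto
  then show ?thesis by (simp add: eval_via_M_def functional_def eval_pol_alt flinearD(5)[OF \<mu>])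
qed

end

text \<open>The functional is kept arbitrary in the induction: multiplication by an entry of
  \<open>M\<close> is absorbed by composing \<open>\<mu>\<close> with that multiplication, which is
  again \<open>K\<close>-linear.\<close>

lemma functionals_agree_mon:
  assumes M: "M \<in> carrier_mat N N" and t: "Poly_Mapping.keys t \<subseteq> V" and \<mu>: "flinear K \<iota> \<mu>"
  shows "eval_via_X \<mu> (eval_mon (($$) (mat N N Var * map_mat Const M)) t) = eval_via_M \<mu> M (eval_mon (($$) XT) t)"
  using t \<mu>
proof (induction t arbitrary: \<mu> rule: poly_mapping_monomial_induct)
  case (zero \<mu>)
  show ?case
    using functional_single[of "\<lambda>t u. \<mu> u * eval_mon (($$) \<X>) t" 0 1]
      functional_single[of "\<lambda>t l. l * \<mu> (eval_mon (($$) M) t)" 0 1]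
    by (simp add: eval_via_X_def eval_via_M_def distrib_right flinearD[OF zero])
next
  case (add t v \<mu>)
  obtain r c where v: "v = (r, c)" "r < N" "c < N" using add.hyps by (auto simp: mat_vars_def)
  let ?Q = "eval_mon (($$) (mat N N Var * map_mat Const M)) t"
  let ?Q' = "eval_mon (($$) XT) t"
  have ZM: "(mat N N Var * map_mat Const M) $$ v = (\<Sum>d<N. Var (r, d) * Const (M $$ (d, c)))"
    unfolding v(1) by (rule Var_mult_mat[OF M v(2,3)])
  have XT: "XT $$ v = (\<Sum>d<N. Const (\<X> $$ (r, d)) * Var (d, c))"
    unfolding v(1) XT_def using v(2,3) \<X>(1) by (subst entry_mult_mat[of r N c]) auto
  have l: "flinear K \<iota> (\<lambda>u. \<mu> (w * u))" for w by (rule flinear_mult[OF add.prems])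
  have "eval_via_X \<mu> (?Q * (\<Sum>d<N. Var (r, d) * Const (M $$ (d, c)))) = (\<Sum>d<N. eval_via_X \<mu> (?Q * Var (r, d) * Const (M $$ (d, c))))"
    by (simp add: sum_distrib_left eval_via_X_sum[OF add.prems] mult.assoc)
  also have "\<dots> = (\<Sum>d<N. \<X> $$ (r, d) * eval_via_X (\<lambda>u. \<mu> (M $$ (d, c) * u)) ?Q)"
    by (simp add: eval_via_X_Const[OF add.prems] eval_via_X_Var[OF l])
  also have "\<dots> = (\<Sum>d<N. \<X> $$ (r, d) * eval_via_M (\<lambda>u. \<mu> (M $$ (d, c) * u)) M ?Q')"
    by (simp add: add.IH[OF l])
  also have "\<dots> = (\<Sum>d<N. eval_via_M \<mu> M (?Q' * Var (d, c) * Const (\<X> $$ (r, d))))"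
    by (simp add: eval_via_M_Const[OF add.prems] eval_via_M_Var[OF add.prems])
  also have "\<dots> = eval_via_M \<mu> M (?Q' * (\<Sum>d<N. Const (\<X> $$ (r, d)) * Var (d, c)))"
    by (simp add: sum_distrib_left eval_via_M_sum[OF add.prems] mult_ac)
  finally show ?case
    by (simp only: eval_mon_add eval_mon_single power_one_right ZM XT)
qed

text \<open>Both sides are the image of \<open>P(\<X> \<otimes> M) \<in> L \<otimes>\<^sub>K U\<close> under the map \<open>id \<otimes> \<mu>\<close>.\<close>
lemma functionals_agree:
  assumes M: "M \<in> carrier_mat N N" and P: "P \<in> pol_over K V" and \<mu>: "flinear K \<iota> \<mu>"
  shows "eval_via_X \<mu> (msubst N M (Poly_Mapping.map \<iota> P)) = eval_via_M \<mu> M (eval_pol Const (($$) XT) P)"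
proof -
  let ?ZM = "mat N N Var * map_mat Const M"
  have "msubst N M (Poly_Mapping.map \<iota> P) = (\<Sum>t\<in>Poly_Mapping.keys P. eval_mon (($$) ?ZM) t * Const (\<iota> (Poly_Mapping.lookup P t)))"
    unfolding msubst_alt by (subst eval_pol_map) (simp_all add: KU.\<iota> eval_pol_alt mult.commute)
  then have "eval_via_X \<mu> (msubst N M (Poly_Mapping.map \<iota> P)) = (\<Sum>t\<in>Poly_Mapping.keys P. Poly_Mapping.lookup P t * eval_via_X \<mu> (eval_mon (($$) ?ZM) t))"
    by (simp add: eval_via_X_sum[OF \<mu>] eval_via_X_Const_K[OF \<mu>] pol_over_lookup[OF P])
  also have "\<dots> = (\<Sum>t\<in>Poly_Mapping.keys P. Poly_Mapping.lookup P t * eval_via_M \<mu> M (eval_mon (($$) XT) t))"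
    by (intro sum.cong refl arg_cong2[where f = "(*)"] functionals_agree_mon[OF M pol_over_keys[OF P] \<mu>])
  also have "\<dots> = eval_via_M \<mu> M (\<Sum>t\<in>Poly_Mapping.keys P. eval_mon (($$) XT) t * Const (Poly_Mapping.lookup P t))"
    by (simp add: eval_via_M_sum[OF \<mu>] eval_via_M_Const[OF \<mu>])
  also have "\<dots> = eval_via_M \<mu> M (eval_pol Const (($$) XT) P)"
    by (simp add: eval_pol_alt mult.commute)
  finally show ?thesis .
qed

text \<open>For \<open>P\<close> in \<open>I\<close>, membership of \<open>P(Z M)\<close> in
  \<open>IU\<close> means that \<open>id \<otimes> \<mu>\<close> kills \<open>P(\<X> M)\<close> for
  all \<open>\<mu>\<close>. By \<open>functionals_agree\<close> these values are computed from
  \<open>P(\<X> Z)\<close>, and by descent the polynomials \<open>P(\<X> Z)\<close> with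
  \<open>P\<close> in \<open>I\<close> span the same \<open>L\<close>-space as
  \<open>J\<close>.\<close>

theorem Galois_group_equations:
  assumes M: "M \<in> carrier_mat N N"
  shows "(\<forall>P\<in>IU. msubst N M P \<in> IU) \<longleftrightarrow> (\<forall>q\<in>J. eval_pol \<iota> (($$) M) q = 0)"
proof
  interpret t: comm_ring_hom "msubst N M" by (rule msubst_hom)
  assume *: "\<forall>q\<in>J. eval_pol \<iota> (($$) M) q = 0"
  have 1: "msubst N M (Poly_Mapping.map \<iota> P) \<in> IU" if P: "P \<in> I" for P
  proof -
    have PK: "P \<in> pol_over K V" using is_ideal_inD(1)[OF I_ideal P] .
    have PU: "msubst N M (Poly_Mapping.map \<iota> P) \<in> pol_over UNIV V"
      by (rule msubst_pol_over[OF M KU.map_\<iota>_pol_over[OF PK]])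
    have "eval_pol Const (($$) XT) P \<in> \<AA>"
      unfolding \<AA>_def using eval_T0_XT(1)[OF PK] I_IL[OF P]
        eval_const_mat_pol_over[OF is_subring_UNIV \<X>(1) _ PK, of Const] by (simp add: XT_def pol_over_Const)
    then obtain n l q where q: "\<forall>i<n::nat. q i \<in> J" "eval_pol Const (($$) XT) P = (\<Sum>i<n. Const (l i) * q i)"
      using descent by blast
    have "Poly_Mapping.map \<mu> (msubst N M (Poly_Mapping.map \<iota> P)) \<in> I" if \<mu>: "flinear K \<iota> \<mu>" for \<mu>
    proof -
      have "eval_pol id (($$) \<X>) (Poly_Mapping.map \<mu> (msubst N M (Poly_Mapping.map \<iota> P))) = eval_via_M \<mu> M (\<Sum>i<n. q i * Const (l i))"
        using functionals_agree[OF M PK \<mu>] eval_via_X_eval[OF \<mu>] q(2) by (simp add: mult.commute)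
      also have "\<dots> = (\<Sum>i<n. l i * \<mu> (eval_pol \<iota> (($$) M) (q i)))"
        unfolding eval_via_M_sum[OF \<mu>] eval_via_M_Const[OF \<mu>]
        using q(1) by (intro sum.cong refl arg_cong2[where f = "(*)"] eval_via_M_eval[OF \<mu>]) (auto simp: J_def)
      also have "\<dots> = 0" using * q(1) by (simp add: flinearD(4)[OF \<mu>])
      finally show ?thesis
        unfolding I_def vanishing_ideal_def using KU.map_flinear_pol_over[OF \<mu> PU] by simp
    qed
    then show ?thesis unfolding IU_def KU.mem_extend_ideal[OF I_ideal] using PU by blast
  qed
  show "\<forall>P\<in>IU. msubst N M P \<in> IU"
  proof
    fix P assume "P \<in> IU"
    then obtain A p where A: "finite A" "\<And>b. p b \<in> I" "P = (\<Sum>b\<in>A. Const b * Poly_Mapping.map \<iota> (p b))"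
      using KU.extend_ideal_expand[OF I_ideal, of P] by (auto simp: IU_def)
    have "msubst N M P = (\<Sum>b\<in>A. Const b * msubst N M (Poly_Mapping.map \<iota> (p b)))"
      by (simp add: A(3) t.hom_sum t.hom_mult)
    also have "\<dots> \<in> IU"
      by (intro is_ideal_in_sum[OF IU_ideal] is_ideal_inD(4)[OF IU_ideal] 1 A(2) pol_over_Const) auto
    finally show "msubst N M P \<in> IU" .
  qed
next
  assume *: "\<forall>P\<in>IU. msubst N M P \<in> IU"
  show "\<forall>q\<in>J. eval_pol \<iota> (($$) M) q = 0"
  proof
    fix q assume q: "q \<in> J"
    then have qC: "q \<in> pol_over C V" and "eval_pol Const (($$) T0) q \<in> IL" by (auto simp: J_def)
    then obtain A p where A: "finite A" "\<And>b. p b \<in> I" "eval_pol Const (($$) T0) q = (\<Sum>b\<in>A. Const b * Poly_Mapping.map id (p b))"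
      using KL.extend_ideal_expand[OF I_ideal, of "eval_pol Const (($$) T0) q"] by (auto simp: IL_def)
    interpret e: comm_ring_hom "eval_pol Const (($$) XT)" by (rule eval_pol_comm_ring_hom[OF comm_ring_hom_Const])
    \<comment> \<open>Substituting \<open>\<X> Z\<close> into \<open>q(T0)\<close> returns
      \<open>q\<close>, which is thus an \<open>L\<close>-combination of the \<open>p b\<close>
      evaluated at \<open>\<X> Z\<close>, with \<open>p b\<close> in \<open>I\<close>.\<close>
    have qe: "q = (\<Sum>b\<in>A. eval_pol Const (($$) XT) (p b) * Const b)"
      using eval_T0_XT(2)[OF qC] A(3) by (simp add: e.hom_sum e.hom_mult mult.commute)
    have "\<mu> (eval_pol \<iota> (($$) M) q) = 0" if \<mu>: "flinear K \<iota> \<mu>" for \<mu>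
    proof -
      have "eval_via_M \<mu> M (eval_pol Const (($$) XT) (p b)) = 0" for b
      proof -
        have "msubst N M (Poly_Mapping.map \<iota> (p b)) \<in> IU"
          using * KU.map_mem_extend_ideal[OF A(2)] by (simp add: IU_def)
        then have "Poly_Mapping.map \<mu> (msubst N M (Poly_Mapping.map \<iota> (p b))) \<in> I"
          using \<mu> unfolding IU_def KU.mem_extend_ideal[OF I_ideal] by blast
        then have "eval_via_X \<mu> (msubst N M (Poly_Mapping.map \<iota> (p b))) = 0"
          unfolding eval_via_X_eval[OF \<mu>] by (simp add: I_def vanishing_ideal_def)
        then show ?thesis using functionals_agree[OF M is_ideal_inD(1)[OF I_ideal A(2)] \<mu>] by simp
      qed
      then have "eval_via_M \<mu> M q = 0" by (subst qe) (simp add: eval_via_M_sum[OF \<mu>] eval_via_M_Const[OF \<mu>])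
      then show ?thesis using eval_via_M_eval[OF \<mu> qC] by simp
    qed
    then show "eval_pol \<iota> (($$) M) q = 0" by (rule KU.eq_0_if_flinear)
  qed
qed

text \<open>The group demands equality, the equations yield only stability of \<open>IU\<close>;
  finite dimensionality supplies the missing inclusion.\<close>

theorem Galois_group_iff:
  assumes M: "M \<in> GL N"
  shows "msubst N M ` IU = IU \<longleftrightarrow> (\<forall>q\<in>J. eval_pol \<iota> (($$) M) q = 0)"
proof -
  obtain M' where Mc: "M \<in> carrier_mat N N" and M': "M' \<in> carrier_mat N N" "M * M' = 1\<^sub>m N" "M' * M = 1\<^sub>m N"
    using M by (rule GL_E)
  have c: "Const c * P \<in> IU" if "P \<in> IU" for c P
    using is_ideal_inD(4)[OF IU_ideal _ that] pol_over_Const[OF is_subring_UNIV] by blast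
  have "msubst N M ` IU = IU" if "\<forall>P\<in>IU. msubst N M P \<in> IU"
    by (rule msubst_invariant_imp_onto[OF Mc M']) (use is_ideal_inD[OF IU_ideal] c that in auto)
  then show ?thesis using Galois_group_equations[OF Mc] by blast
qed

end

section \<open>Prolongation of matrices\<close>

lemma Leibniz_rule:
  assumes "derivation d"
  shows "(d ^^ k) (x * y) = (\<Sum>t\<le>k. of_nat (k choose t) * ((d ^^ (k - t)) x * (d ^^ t) y))"
proof (induction k)
  case (Suc k)
  note D = derivationD[OF assms] derivation_sum[OF assms] derivation_of_nat[OF assms]
  define a where "a i t = (d ^^ i) x * (d ^^ t) y" for i t
  have "(d ^^ Suc k) (x * y) = (\<Sum>t\<le>k. of_nat (k choose t) * (a (Suc k - t) t + a (k - t) (Suc t)))"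
    by (simp add: Suc D a_def Suc_diff_le)
  also have "\<dots> = (\<Sum>t\<le>k. of_nat (k choose t) * a (Suc k - t) t) + (\<Sum>t\<le>k. of_nat (k choose t) * a (k - t) (Suc t))"
    by (simp add: distrib_left sum.distrib)
  also have "(\<Sum>t\<le>k. of_nat (k choose t) * a (k - t) (Suc t)) = (\<Sum>t\<in>{1..Suc k}. of_nat (k choose (t - 1)) * a (Suc k - t) t)"
    by (rule sum.reindex_bij_witness[of _ "\<lambda>t. t - 1" Suc]) auto
  also have "(\<Sum>t\<le>k. of_nat (k choose t) * a (Suc k - t) t) = (\<Sum>t\<le>Suc k. of_nat (k choose t) * a (Suc k - t) t)"
    by (simp add: binomial_eq_0)
  also have "(\<Sum>t\<in>{1..Suc k}. of_nat (k choose (t - 1)) * a (Suc k - t) t) =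
      (\<Sum>t\<le>Suc k. of_nat (if t = 0 then 0 else k choose (t - 1)) * a (Suc k - t) t)"
    by (rule sum.mono_neutral_cong_left) auto
  also have "(\<Sum>t\<le>Suc k. of_nat (k choose t) * a (Suc k - t) t) + \<dots> =
      (\<Sum>t\<le>Suc k. of_nat (Suc k choose t) * a (Suc k - t) t)"
    unfolding sum.distrib[symmetric]
  proof (rule sum.cong[OF refl])
    fix t
    show "of_nat (k choose t) * a (Suc k - t) t + of_nat (if t = 0 then 0 else k choose (t - 1)) * a (Suc k - t) t =
      of_nat (Suc k choose t) * a (Suc k - t) t"
      by (cases t) (simp_all add: algebra_simps)
  qed
  finally show ?case by (simp add: a_def)
qed simp

text \<open>\<open>prolong\<close> over arbitrary commutative rings, as needed for matrices whose
  entries are differential polynomials; the size \<open>m\<close> is passed explicitly.\<close>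

definition prolongation :: "('r::comm_ring_1 \<Rightarrow> 'r) \<Rightarrow> nat \<Rightarrow> nat \<Rightarrow> 'r mat \<Rightarrow> 'r mat" where
  "prolongation d m n B = mat (m * (n + 1)) (m * (n + 1)) (\<lambda>(r, c).
     if c div m \<le> r div m
     then of_nat ((r div m) choose (c div m)) * (d ^^ (r div m - c div m)) (B $$ (r mod m, c mod m)) else 0)"

lemma prolong_eq_prolongation: "B \<in> carrier_mat m m \<Longrightarrow> prolong d n B = prolongation d m n B"
  by (auto simp: prolong_def prolongation_def Let_def)

lemma prolongation_carrier [simp]: "prolongation d m n B \<in> carrier_mat (m * (n + 1)) (m * (n + 1))"
  by (simp add: prolongation_def)

lemma prolongation_carrier' [simp]: "prolongation d m n B \<in> carrier_mat (m + m * n) (m + m * n)"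
  using prolongation_carrier[of d m n B] by simp

lemma prolongation_dim [simp]: "dim_row (prolongation d m n B) = m * (n + 1)" "dim_col (prolongation d m n B) = m * (n + 1)"
  by (simp_all add: prolongation_def)

lemma prolongation_entry:
  assumes "r < m * (n + 1)" "c < m * (n + 1)"
  shows "prolongation d m n B $$ (r, c) = (if c div m \<le> r div m
     then of_nat ((r div m) choose (c div m)) * (d ^^ (r div m - c div m)) (B $$ (r mod m, c mod m)) else 0)"
  using assms by (simp add: prolongation_def)

lemma block_index:
  fixes r m n :: nat
  assumes "r < m * (n + 1)"
  shows "0 < m" "r mod m < m" "r div m \<le> n" "r = r div m * m + r mod m"
proof -
  show m: "0 < m" using assms by (cases m) auto
  then show "r mod m < m" by simp
  have "r div m < n + 1" using assms by (simp add: less_mult_imp_div_less mult.commute)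
  then show "r div m \<le> n" by simp
qed simp

lemma block_index_less:
  fixes l m n i :: nat
  assumes "i < m" "l \<le> n"
  shows "l * m + i < m * (n + 1)"
proof -
  have "l * m + i < Suc l * m" using assms by simp
  also have "\<dots> \<le> (n + 1) * m" using assms by (intro mult_right_mono) auto
  finally show ?thesis by (simp only: mult.commute)
qed

lemma sum_blocks:
  fixes m n :: nat
  assumes "0 < m"
  shows "(\<Sum>l<m * (n + 1). f l) = (\<Sum>s\<le>n. \<Sum>e<m. f (s * m + e))"
proof -
  have "(\<Sum>s\<le>n. \<Sum>e<m. f (s * m + e)) = (\<Sum>(s, e)\<in>{..n} \<times> {..<m}. f (s * m + e))"
    by (simp add: sum.cartesian_product)
  also have "\<dots> = (\<Sum>l<m * (n + 1). f l)"
  proof (rule sum.reindex_bij_witness[of _ "\<lambda>l. (l div m, l mod m)" "\<lambda>(s, e). s * m + e"])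
    fix l assume "l \<in> {..<m * (n + 1)}"
    then show "(l div m, l mod m) \<in> {..n} \<times> {..<m}" using block_index[of l m n] by auto
  next
    fix p assume "p \<in> {..n} \<times> {..<m}"
    then obtain s e where p: "p = (s, e)" "s \<le> n" "e < m" by auto
    then show "(case p of (s, e) \<Rightarrow> s * m + e) \<in> {..<m * (n + 1)}"
      using block_index_less[of e m s n] by simp
  qed (use assms in auto)
  finally show ?thesis by simp
qed

text \<open>The Leibniz rule in matrix form: the double sum collapses by \<open>(i choose s) * (s
  choose j) = (i choose j) * ((i - j) choose (s - j))\<close>.\<close>

lemma prolongation_mult:
  assumes d: "derivation d" and B: "B \<in> carrier_mat m m" and C: "C \<in> carrier_mat m m"
  shows "prolongation d m n (B * C) = prolongation d m n B * prolongation d m n C"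
proof (rule eq_matI)
  let ?N = "m * (n + 1)"
  note D = derivationD[OF d] derivation_sum[OF d]
  fix r c assume "r < dim_row (prolongation d m n B * prolongation d m n C)" "c < dim_col (prolongation d m n B * prolongation d m n C)"
  then have rc: "r < ?N" "c < ?N" by (simp_all add: prolongation_def)
  define i a j b where "i = r div m" "a = r mod m" "j = c div m" "b = c mod m"
  note ij = this
  have m: "0 < m" and ab: "a < m" "b < m" "i \<le> n" "j \<le> n"
    using block_index[OF rc(1)] block_index[OF rc(2)] ij by auto
  have dsum: "(d ^^ k) (\<Sum>e<m. f e) = (\<Sum>e<m. (d ^^ k) (f e))" for k and f :: "nat \<Rightarrow> 'a"
    by (induction k) (simp_all add: D)
  have "(prolongation d m n B * prolongation d m n C) $$ (r, c) =
      (\<Sum>l<?N. prolongation d m n B $$ (r, l) * prolongation d m n C $$ (l, c))"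
    by (rule entry_mult_mat[OF rc]) simp_all
  also have "\<dots> = (\<Sum>s\<le>n. \<Sum>e<m. (if s \<le> i then of_nat (i choose s) * (d ^^ (i - s)) (B $$ (a, e)) else 0) *
      (if j \<le> s then of_nat (s choose j) * (d ^^ (s - j)) (C $$ (e, b)) else 0))"
    unfolding sum_blocks[OF m]
  proof (intro sum.cong refl)
    fix s e assume "s \<in> {..n}" "e \<in> {..<m}"
    then have l: "s * m + e < ?N" by (intro block_index_less) auto
    have "(s * m + e) div m = s" "(s * m + e) mod m = e" using \<open>e \<in> {..<m}\<close> by auto
    then show "prolongation d m n B $$ (r, s * m + e) * prolongation d m n C $$ (s * m + e, c) =
      (if s \<le> i then of_nat (i choose s) * (d ^^ (i - s)) (B $$ (a, e)) else 0) *
      (if j \<le> s then of_nat (s choose j) * (d ^^ (s - j)) (C $$ (e, b)) else 0)"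
      unfolding prolongation_entry[OF rc(1) l] prolongation_entry[OF l rc(2)] ij by simp
  qed
  also have "\<dots> = (if j \<le> i then of_nat (i choose j) * (d ^^ (i - j)) ((B * C) $$ (a, b)) else 0)"
  proof (cases "j \<le> i")
    case True
    have "(\<Sum>s\<le>n. \<Sum>e<m. (if s \<le> i then of_nat (i choose s) * (d ^^ (i - s)) (B $$ (a, e)) else 0) *
      (if j \<le> s then of_nat (s choose j) * (d ^^ (s - j)) (C $$ (e, b)) else 0)) =
      (\<Sum>s\<in>{j..i}. \<Sum>e<m. of_nat ((i choose s) * (s choose j)) * ((d ^^ (i - s)) (B $$ (a, e)) * (d ^^ (s - j)) (C $$ (e, b))))"
      by (rule sum.mono_neutral_cong_right) (use ab True in \<open>auto simp: mult_ac not_le intro!: sum.neutral sum.cong\<close>)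
    also have "\<dots> = (\<Sum>t\<le>i - j. \<Sum>e<m. of_nat ((i choose j) * ((i - j) choose t)) *
        ((d ^^ (i - j - t)) (B $$ (a, e)) * (d ^^ t) (C $$ (e, b))))"
      by (rule sum.reindex_bij_witness[of _ "\<lambda>t. j + t" "\<lambda>s. s - j"]) (use True choose_mult[of j _ i] in auto)
    also have "\<dots> = of_nat (i choose j) * (\<Sum>e<m. (d ^^ (i - j)) (B $$ (a, e) * C $$ (e, b)))"
      unfolding Leibniz_rule[OF d]
      by (subst sum.swap) (simp add: sum_distrib_left mult_ac)
    also have "\<dots> = of_nat (i choose j) * (d ^^ (i - j)) ((B * C) $$ (a, b))"
      using entry_mult_mat[OF ab(1,2) B C] by (simp only: dsum)
    finally show ?thesis using True by simp
  next
    case False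
    then show ?thesis by (auto intro!: sum.neutral)
  qed
  finally show "prolongation d m n (B * C) $$ (r, c) = (prolongation d m n B * prolongation d m n C) $$ (r, c)"
    by (simp only: prolongation_entry[OF rc] ij)
qed (simp_all add: prolongation_def)

lemma hom_funpow_derivation:
  assumes "\<And>w. \<Phi> (d w) = d' (\<Phi> w)"
  shows "\<Phi> ((d ^^ k) w) = (d' ^^ k) (\<Phi> w)"
  by (induction k) (simp_all add: assms)

lemma map_prolongation:
  assumes "comm_ring_hom \<Phi>" "\<And>w. \<Phi> (d w) = d' (\<Phi> w)" "B \<in> carrier_mat m m"
  shows "map_mat \<Phi> (prolongation d m n B) = prolongation d' m n (map_mat \<Phi> B)"
proof (rule eq_matI)
  interpret comm_ring_hom \<Phi> by fact
  fix r c assume "r < dim_row (prolongation d' m n (map_mat \<Phi> B))" "c < dim_col (prolongation d' m n (map_mat \<Phi> B))"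
  then have rc: "r < m * (n + 1)" "c < m * (n + 1)" by (simp_all add: prolongation_def)
  note b = block_index[OF rc(1)] block_index[OF rc(2)]
  have nat: "\<Phi> (of_nat k) = of_nat k" for k by (induction k) (simp_all add: hom_add)
  have h: "\<Phi> ((d ^^ k) w) = (d' ^^ k) (\<Phi> w)" for k w by (rule hom_funpow_derivation) (rule assms(2))
  have "map_mat \<Phi> (prolongation d m n B) $$ (r, c) = \<Phi> (prolongation d m n B $$ (r, c))"
    using rc prolongation_carrier[of d m n B] by (intro index_map_mat) auto
  then show "map_mat \<Phi> (prolongation d m n B) $$ (r, c) = prolongation d' m n (map_mat \<Phi> B) $$ (r, c)"
    using b assms(3) unfolding prolongation_entry[OF rc] by (simp add: hom_mult h nat)
qed (simp_all add: prolongation_def)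

lemma prolongation_one:
  assumes "derivation d"
  shows "prolongation d m n (1\<^sub>m m) = 1\<^sub>m (m * (n + 1))"
proof (rule eq_matI)
  note D = derivationD[OF assms]
  fix r c assume "r < dim_row (1\<^sub>m (m * (n + 1)))" "c < dim_col (1\<^sub>m (m * (n + 1)))"
  then have rc: "r < m * (n + 1)" "c < m * (n + 1)" by simp_all
  note b = block_index[OF rc(1)] block_index[OF rc(2)]
  have z: "(d ^^ k) 0 = 0" for k by (induction k) (simp_all add: D)
  have o: "(d ^^ k) 1 = (if k = 0 then 1 else 0)" for k by (induction k) (simp_all add: D)
  have "r = c \<longleftrightarrow> r div m = c div m \<and> r mod m = c mod m" using b(4) b(8) by metis
  then show "prolongation d m n (1\<^sub>m m) $$ (r, c) = 1\<^sub>m (m * (n + 1)) $$ (r, c)"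
    unfolding prolongation_entry[OF rc] using b rc by (auto simp: z o)
qed (simp_all add: prolongation_def)

lemma prolongation_pol:
  assumes "is_subring F" "d ` F \<subseteq> F" "\<And>i j. i < m \<Longrightarrow> j < m \<Longrightarrow> B $$ (i, j) \<in> F" "r < m * (n + 1)" "c < m * (n + 1)"
  shows "prolongation d m n B $$ (r, c) \<in> F"
proof -
  have "(d ^^ k) x \<in> F" if "x \<in> F" for k x using that assms(2) by (induction k) auto
  then show ?thesis
    using assms(1,3) block_index[OF assms(4)] block_index[OF assms(5)]
    unfolding prolongation_entry[OF assms(4,5)] by (auto simp: is_subringD is_subring_of_nat)
qed

lemma prolongation_block:
  "i < m \<Longrightarrow> j < m \<Longrightarrow> l \<le> n \<Longrightarrow> prolongation d m n B $$ (l * m + i, j) = (d ^^ l) (B $$ (i, j))"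
proof -
  assume "i < m" "j < m" "l \<le> n"
  then have "l * m + i < m * (n + 1)" by (intro block_index_less)
  moreover have "j < m * (n + 1)" using \<open>j < m\<close> by (simp add: less_le_trans)
  ultimately show ?thesis using \<open>i < m\<close> \<open>j < m\<close> by (simp add: prolongation_entry)
qed

lemma mult_inverse_prolongation:
  assumes "derivation d" "B \<in> carrier_mat m m" "C \<in> carrier_mat m m" "B * C = 1\<^sub>m m"
  shows "prolongation d m n B * prolongation d m n C = 1\<^sub>m (m * (n + 1))"
  using prolongation_mult[OF assms(1-3), of n] prolongation_one[OF assms(1)] by (simp add: assms(4))

lemma prolongation_GL:
  assumes "derivation d" "B \<in> GL m"
  shows "prolongation d m n B \<in> GL (m * (n + 1))"
proof -
  obtain C where "B \<in> carrier_mat m m" "C \<in> carrier_mat m m" "B * C = 1\<^sub>m m" using GL_E[OF assms(2)] by metis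
  then show ?thesis using mult_inverse_prolongation[OF assms(1)] by (intro GL_I[of _ _ "prolongation d m n C"]) auto
qed

text \<open>The first block row of the prolongation is \<open>(B, 0, ..., 0)\<close>, so the upper
  left block of its inverse is an inverse of \<open>B\<close>.\<close>

lemma GL_if_prolongation_GL:
  assumes "B \<in> carrier_mat m m" "prolongation d m n B \<in> GL (m * (n + 1))"
  shows "B \<in> GL m"
proof (cases "m = 0")
  case True
  then show ?thesis using assms(1) by (intro GL_I[of _ _ "1\<^sub>m 0"]) auto
next
  case False
  obtain W where W: "W \<in> carrier_mat (m * (n + 1)) (m * (n + 1))" "prolongation d m n B * W = 1\<^sub>m (m * (n + 1))"
    using GL_E[OF assms(2)] by metis
  define C where "C = mat m m (($$) W)"
  have "B * C = 1\<^sub>m m"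
  proof (rule eq_matI)
    fix i j assume "i < dim_row (1\<^sub>m m)" "j < dim_col (1\<^sub>m m)"
    then have ij: "i < m" "j < m" by simp_all
    then have ij': "i < m * (n + 1)" "j < m * (n + 1)" by (simp_all add: less_le_trans)
    have "(1\<^sub>m (m * (n + 1)) :: 'a mat) $$ (i, j) = (\<Sum>l<m * (n + 1). prolongation d m n B $$ (i, l) * W $$ (l, j))"
      using entry_mult_mat[OF ij' prolongation_carrier W(1), of d B] W(2) by simp
    also have "\<dots> = (\<Sum>l<m. prolongation d m n B $$ (i, l) * W $$ (l, j))"
    proof (rule sum.mono_neutral_right)
      show "\<forall>l\<in>{..<m * (n + 1)} - {..<m}. prolongation d m n B $$ (i, l) * W $$ (l, j) = 0"
      proof
        fix l assume "l \<in> {..<m * (n + 1)} - {..<m}"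
        then have l: "l < m * (n + 1)" "0 < l div m" using False by (auto simp: div_greater_zero_iff)
        then show "prolongation d m n B $$ (i, l) * W $$ (l, j) = 0"
          using ij by (simp add: prolongation_entry[OF ij'(1) l(1)])
      qed
    qed auto
    also have "\<dots> = (\<Sum>l<m. B $$ (i, l) * C $$ (l, j))"
      using prolongation_block[of i m _ 0 n d B] ij by (intro sum.cong) (auto simp: C_def)
    also have "\<dots> = (B * C) $$ (i, j)" using entry_mult_mat[OF ij assms(1), of C] by (simp add: C_def)
    finally show "(B * C) $$ (i, j) = 1\<^sub>m m $$ (i, j)" using ij ij' by simp
  qed (use assms(1) in \<open>auto simp: C_def\<close>)
  then show ?thesis using assms(1) by (intro GL_I[of B m C]) (auto simp: C_def)
qed

section \<open>From matrix polynomials to differential polynomials\<close>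

definition generic_mat :: "nat \<Rightarrow> (nat \<times> nat \<times> nat, 'a::comm_ring_1) mpol mat" where
  "generic_mat m = mat m m (\<lambda>(i, j). Var (0, i, j))"

text \<open>The prolongation of the generic matrix with the derivation carried out. Its entries are
  integer multiples of indeterminates, hence compatible with any change of coefficients.\<close>

definition generic_prolongation :: "nat \<Rightarrow> nat \<Rightarrow> (nat \<times> nat \<times> nat, 'a::comm_ring_1) mpol mat" where
  "generic_prolongation m n = mat (m * (n + 1)) (m * (n + 1)) (\<lambda>(r, c).
     if c div m \<le> r div m
     then of_nat ((r div m) choose (c div m)) * Var (r div m - c div m, r mod m, c mod m) else 0)"

lemma generic_mat_carrier [simp]: "generic_mat m \<in> carrier_mat m m"
  by (simp add: generic_mat_def)

lemma generic_prolongation_carrier [simp]: "generic_prolongation m n \<in> carrier_mat (m * (n + 1)) (m * (n + 1))"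
  by (simp add: generic_prolongation_def)

lemma generic_prolongation_entry:
  assumes "r < m * (n + 1)" "c < m * (n + 1)"
  shows "generic_prolongation m n $$ (r, c) = (if c div m \<le> r div m
     then of_nat ((r div m) choose (c div m)) * Var (r div m - c div m, r mod m, c mod m) else 0)"
  using assms by (simp add: generic_prolongation_def)

lemma dpol_deriv_funpow_Var: "derivation \<delta> \<Longrightarrow> (dpol_deriv \<delta> ^^ k) (Var (l, v)) = Var (k + l, v)"
  by (induction k) simp_all

lemma prolongation_generic_mat:
  assumes "derivation \<delta>"
  shows "prolongation (dpol_deriv \<delta>) m n (generic_mat m) = generic_prolongation m n"
proof (rule eq_matI)
  fix r c assume "r < dim_row (generic_prolongation m n :: (nat \<times> nat \<times> nat, 'a) mpol mat)"
    "c < dim_col (generic_prolongation m n :: (nat \<times> nat \<times> nat, 'a) mpol mat)"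
  then have rc: "r < m * (n + 1)" "c < m * (n + 1)" by (simp_all add: generic_prolongation_def)
  show "prolongation (dpol_deriv \<delta>) m n (generic_mat m) $$ (r, c) = generic_prolongation m n $$ (r, c)"
    unfolding prolongation_entry[OF rc] generic_prolongation_entry[OF rc]
    using block_index[OF rc(1)] block_index[OF rc(2)]
    by (simp add: generic_mat_def dpol_deriv_funpow_Var[OF assms])
qed (simp_all add: prolongation_def generic_prolongation_def)

text \<open>Links polynomials in the matrix \<open>Z\<close> with differential polynomials:
  \<open>p\<close> goes to \<open>p(Y_[n])\<close>. The map is in general not injective, since the
  blocks of \<open>Y_[n]\<close> repeat.\<close>

definition prolong_subst :: "nat \<Rightarrow> nat \<Rightarrow> (nat \<times> nat, 'a::comm_ring_1) mpol \<Rightarrow> (nat \<times> nat \<times> nat, 'a) mpol" where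
  "prolong_subst m n = eval_pol Const (($$) (generic_prolongation m n))"

lemma prolong_subst_hom: "comm_ring_hom (prolong_subst m n)"
  unfolding prolong_subst_def by (rule eval_pol_comm_ring_hom[OF comm_ring_hom_Const])

lemma prolong_subst_Const [simp]: "prolong_subst m n (Const c) = Const c"
  by (simp add: prolong_subst_def)

lemma prolong_subst_Var: "prolong_subst m n (Var v) = generic_prolongation m n $$ v"
  by (simp add: prolong_subst_def)

lemma generic_prolongation_pol_over:
  assumes "is_subring F" "v \<in> mat_vars (m * (n + 1))"
  shows "generic_prolongation m n $$ v \<in> pol_over F (dmat_vars m)"
proof -
  note R = is_subring_pol_over[OF assms(1), of "dmat_vars m"]
  obtain r c where v: "v = (r, c)" "r < m * (n + 1)" "c < m * (n + 1)" using assms(2) by (auto simp: mat_vars_def)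
  have "(l, r mod m, c mod m) \<in> dmat_vars m" for l
    using block_index[OF v(2)] block_index[OF v(3)] by (simp add: dmat_vars_def)
  then show ?thesis
    unfolding v(1) generic_prolongation_entry[OF v(2,3)]
    by (auto intro!: is_subringD(1,4)[OF R] is_subring_of_nat[OF R] pol_over_Var assms(1))
qed

lemma prolong_subst_pol_over:
  assumes "is_subring F" "P \<in> pol_over F (mat_vars (m * (n + 1)))"
  shows "prolong_subst m n P \<in> pol_over F (dmat_vars m)"
  unfolding prolong_subst_def
  by (rule eval_pol_in_subring[OF is_subring_pol_over[OF assms(1)] assms(2)])
    (use assms(1) generic_prolongation_pol_over in \<open>auto simp: pol_over_Const\<close>)

lemma map_mat_eval_generic_prolongation:
  assumes "comm_ring_hom h" "B \<in> carrier_mat m m"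
  shows "map_mat (eval_pol h (jet d (($$) B))) (generic_prolongation m n) = prolongation d m n B"
proof (rule eq_matI)
  interpret h: comm_ring_hom h by fact
  interpret e: comm_ring_hom "eval_pol h (jet d (($$) B))" by (rule eval_pol_comm_ring_hom) fact
  have nat: "eval_pol h (jet d (($$) B)) (of_nat k) = of_nat k" for k by (induction k) (simp_all add: e.hom_add)
  have jet: "jet d (($$) B) (k, v) = (d ^^ k) (B $$ v)" for k v by (simp add: jet_def)
  fix r c assume "r < dim_row (prolongation d m n B)" "c < dim_col (prolongation d m n B)"
  then have rc: "r < m * (n + 1)" "c < m * (n + 1)" by (simp_all add: prolongation_def)
  have "map_mat (eval_pol h (jet d (($$) B))) (generic_prolongation m n) $$ (r, c) =
      eval_pol h (jet d (($$) B)) (generic_prolongation m n $$ (r, c))"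
    using rc by (intro index_map_mat) (simp_all add: generic_prolongation_def)
  then show "map_mat (eval_pol h (jet d (($$) B))) (generic_prolongation m n) $$ (r, c) = prolongation d m n B $$ (r, c)"
    unfolding generic_prolongation_entry[OF rc] prolongation_entry[OF rc]
    by (simp add: e.hom_mult jet nat)
qed (simp_all add: prolongation_def generic_prolongation_def)

lemma eval_prolong_subst:
  assumes "comm_ring_hom h" "B \<in> carrier_mat m m" "P \<in> pol_over F (mat_vars (m * (n + 1)))"
  shows "eval_pol h (jet d (($$) B)) (prolong_subst m n P) = eval_pol h (($$) (prolongation d m n B)) P"
  unfolding prolong_subst_def eval_mat_eval_mat[OF assms(1) generic_prolongation_carrier assms(3)]
    map_mat_eval_generic_prolongation[OF assms(1,2)] ..

lemma mat_vars_mono: "N \<le> N' \<Longrightarrow> mat_vars N \<subseteq> mat_vars N'"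
  by (auto simp: mat_vars_def)

text \<open>\<open>Y_[n]\<close> is the upper left part of \<open>Y_[n']\<close>; this allows
  passing to a common order for finitely many differential polynomials.\<close>

lemma prolong_subst_mono:
  fixes P :: "(nat \<times> nat, 'a::comm_ring_1) mpol"
  assumes "P \<in> pol_over F (mat_vars (m * (n + 1)))" "n \<le> n'"
  shows "prolong_subst m n' P = prolong_subst m n P"
  unfolding prolong_subst_def
proof (rule eval_mat_cong[OF assms(1)])
  fix i j assume ij: "i < m * (n + 1)" "j < m * (n + 1)"
  have "m * (n + 1) \<le> m * (n' + 1)" using assms(2) by (intro mult_left_mono) auto
  then have "i < m * (n' + 1)" "j < m * (n' + 1)" using ij less_le_trans by blast+
  then show "(generic_prolongation m n' :: (nat \<times> nat \<times> nat, 'a) mpol mat) $$ (i, j) = generic_prolongation m n $$ (i, j)"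
    using ij by (simp add: generic_prolongation_entry)
qed

text \<open>The first block column of \<open>Y_[n]\<close> is \<open>Y, Y', ..., Y^(n)\<close> with
  binomial coefficients 1, so every jet variable is an image, with \<open>n\<close> its
  order.\<close>

lemma prolong_subst_surj:
  assumes "is_subring F" "Q \<in> pol_over F (dmat_vars m)"
  shows "\<exists>n. \<exists>P\<in>pol_over F (mat_vars (m * (n + 1))). Q = prolong_subst m n P"
  using assms(2,1)
proof (induction Q rule: pol_over_induct)
  case (Const c)
  then show ?case using assms(1) by (intro exI[of _ 0] bexI[of _ "Const c"]) (auto simp: pol_over_Const)
next
  case (Var v)
  then obtain l i j where v: "v = (l, i, j)" "i < m" "j < m" by (auto simp: dmat_vars_def)
  have b: "l * m + i < m * (l + 1)" using v by (intro block_index_less) auto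
  have "j < m * (l + 1)" using v by (simp add: less_le_trans)
  then have "Var (l * m + i, j) \<in> pol_over F (mat_vars (m * (l + 1)))" "Var v = prolong_subst m l (Var (l * m + i, j))"
    using v b assms(1) by (auto simp: pol_over_Var mat_vars_def prolong_subst_Var generic_prolongation_entry)
  then show ?case by blast
next
  case (add P Q)
  then obtain a b p q where pq: "p \<in> pol_over F (mat_vars (m * (a + 1)))" "P = prolong_subst m a p"
    "q \<in> pol_over F (mat_vars (m * (b + 1)))" "Q = prolong_subst m b q" by blast
  interpret s: comm_ring_hom "prolong_subst m (max a b)" by (rule prolong_subst_hom)
  have "mat_vars (m * (a + 1)) \<subseteq> mat_vars (m * (max a b + 1))" "mat_vars (m * (b + 1)) \<subseteq> mat_vars (m * (max a b + 1))"
    by (intro mat_vars_mono mult_left_mono; simp)+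
  then have "p + q \<in> pol_over F (mat_vars (m * (max a b + 1)))"
    using pq pol_over_mono[OF subset_refl] by (intro pol_over_add assms(1)) blast+
  moreover have "P + Q = prolong_subst m (max a b) (p + q)"
    using prolong_subst_mono[OF pq(1), of "max a b"] prolong_subst_mono[OF pq(3), of "max a b"] pq
    by (simp add: s.hom_add)
  ultimately show ?case by blast
next
  case (mult P Q)
  then obtain a b p q where pq: "p \<in> pol_over F (mat_vars (m * (a + 1)))" "P = prolong_subst m a p"
    "q \<in> pol_over F (mat_vars (m * (b + 1)))" "Q = prolong_subst m b q" by blast
  interpret s: comm_ring_hom "prolong_subst m (max a b)" by (rule prolong_subst_hom)
  have "mat_vars (m * (a + 1)) \<subseteq> mat_vars (m * (max a b + 1))" "mat_vars (m * (b + 1)) \<subseteq> mat_vars (m * (max a b + 1))"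
    by (intro mat_vars_mono mult_left_mono; simp)+
  then have "p * q \<in> pol_over F (mat_vars (m * (max a b + 1)))"
    using pq pol_over_mono[OF subset_refl] by (intro pol_over_mult assms(1)) blast+
  moreover have "P * Q = prolong_subst m (max a b) (p * q)"
    using prolong_subst_mono[OF pq(1), of "max a b"] prolong_subst_mono[OF pq(3), of "max a b"] pq
    by (simp add: s.hom_mult)
  ultimately show ?case by blast
qed

lemma dsubst_alt: "dsubst d m B = eval_pol Const (jet (dpol_deriv d) (($$) (generic_mat m * map_mat Const B)))"
  by (simp add: dsubst_def generic_mat_def jet_def case_prod_unfold)

text \<open>Since \<open>(Y B)_[n] = Y_[n] B_[n]\<close>, the differential substitution by
  \<open>B\<close> is in every order the ordinary substitution by \<open>B_[n]\<close>.\<close>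

lemma dsubst_prolong_subst:
  assumes d: "derivation d" and B: "B \<in> carrier_mat m m" and P: "P \<in> pol_over UNIV (mat_vars (m * (n + 1)))"
  shows "dsubst d m B (prolong_subst m n P) = prolong_subst m n (msubst (m * (n + 1)) (prolongation d m n B) P)"
proof -
  note D = derivation_dpol_deriv[OF d]
  have c: "generic_mat m * map_mat Const B \<in> carrier_mat m m" using B by (intro mult_carrier_mat[of _ _ m]) auto
  have "dsubst d m B (prolong_subst m n P) = eval_pol Const (($$) (prolongation (dpol_deriv d) m n (generic_mat m * map_mat Const B))) P"
    unfolding dsubst_alt by (rule eval_prolong_subst[OF comm_ring_hom_Const c P])
  also have "prolongation (dpol_deriv d) m n (generic_mat m * map_mat Const B) =
      generic_prolongation m n * map_mat Const (prolongation d m n B)"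
    using B by (simp add: prolongation_mult[OF D] prolongation_generic_mat[OF d]
        map_prolongation[OF comm_ring_hom_Const, of d "dpol_deriv d"] d)
  also have "eval_pol Const (($$) \<dots>) P = prolong_subst m n (msubst (m * (n + 1)) (prolongation d m n B) P)"
    unfolding prolong_subst_def
    by (rule eval_msubst[OF comm_ring_hom_Const generic_prolongation_carrier prolongation_carrier P, symmetric])
  finally show ?thesis .
qed

context field_embedding
begin

lemma \<iota>_of_nat: "\<iota> (of_nat n) = of_nat n"
  by (induction n) (auto simp: \<iota> is_subringD subring is_subring_of_nat)

lemma map_mult: "P \<in> pol_over F V \<Longrightarrow> Q \<in> pol_over F V \<Longrightarrow> Poly_Mapping.map \<iota> (P * Q) = Poly_Mapping.map \<iota> P * Poly_Mapping.map \<iota> Q"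
  by (rule map_hom_mult[OF subring hom])

lemma map_add: "P \<in> pol_over F V \<Longrightarrow> Q \<in> pol_over F V \<Longrightarrow> Poly_Mapping.map \<iota> (P + Q) = Poly_Mapping.map \<iota> P + Poly_Mapping.map \<iota> Q"
  by (rule map_hom_add[OF subring hom])

lemma map_of_nat: "Poly_Mapping.map \<iota> (of_nat n :: ('v, 'a) mpol) = of_nat n"
  by (simp add: of_nat_eq_Const \<iota> \<iota>_of_nat)

lemma map_generic_prolongation:
  assumes "v \<in> mat_vars (m * (n + 1))"
  shows "Poly_Mapping.map \<iota> (generic_prolongation m n $$ v) = generic_prolongation m n $$ v"
proof -
  obtain r c where v: "v = (r, c)" "r < m * (n + 1)" "c < m * (n + 1)" using assms by (auto simp: mat_vars_def)
  have "Poly_Mapping.map \<iota> (of_nat a * Var w :: (nat \<times> nat \<times> nat, 'a) mpol) = of_nat a * Var w" for a w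
    by (subst map_mult[where V = UNIV])
      (simp_all add: map_of_nat \<iota> is_subring_of_nat[OF is_subring_pol_over[OF subring]] pol_over_Var[OF subring])
  then show ?thesis
    unfolding v(1) generic_prolongation_entry[OF v(2,3)] by (simp add: map_0 \<iota>)
qed

lemma map_prolong_subst:
  assumes "P \<in> pol_over F (mat_vars (m * (n + 1)))"
  shows "Poly_Mapping.map \<iota> (prolong_subst m n P) = prolong_subst m n (Poly_Mapping.map \<iota> P)"
  using assms subring
proof (induction P rule: pol_over_induct)
  interpret s: comm_ring_hom "prolong_subst m n :: (nat \<times> nat, 'b) mpol \<Rightarrow> _" by (rule prolong_subst_hom)
  interpret s': comm_ring_hom "prolong_subst m n :: (nat \<times> nat, 'a) mpol \<Rightarrow> _" by (rule prolong_subst_hom)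
  {
    case (Const c)
    then show ?case by (simp add: \<iota>)
  next
    case (Var v)
    then show ?case by (simp add: \<iota> prolong_subst_Var map_generic_prolongation del: mult_Suc_right)
  next
    case (add P Q)
    then show ?case
      using prolong_subst_pol_over[OF subring add(1)] prolong_subst_pol_over[OF subring add(2)]
      by (simp add: s.hom_add s'.hom_add map_add)
  next
    case (mult P Q)
    then show ?case
      using prolong_subst_pol_over[OF subring mult(1)] prolong_subst_pol_over[OF subring mult(2)]
      by (simp add: s.hom_mult s'.hom_mult map_mult)
  }
qed

text \<open>\<open>\<mu>\<close> is not multiplicative, but the entries of \<open>Y_[n]\<close> have
  integer coefficients; for a single term its coefficient can be pulled out, and additivity does the
  rest.\<close>

lemma map_flinear_prolong_subst:
  assumes \<mu>: "flinear F \<iota> \<mu>" and P: "P \<in> pol_over UNIV (mat_vars (m * (n + 1)))"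
  shows "Poly_Mapping.map \<mu> (prolong_subst m n P) = prolong_subst m n (Poly_Mapping.map \<mu> P)"
proof -
  interpret s: comm_ring_hom "prolong_subst m n :: (nat \<times> nat, 'b) mpol \<Rightarrow> _" by (rule prolong_subst_hom)
  interpret s': comm_ring_hom "prolong_subst m n :: (nat \<times> nat, 'a) mpol \<Rightarrow> _" by (rule prolong_subst_hom)
  note \<mu>0 = flinearD(4)[OF \<mu>]
  have 1: "Poly_Mapping.map \<mu> (prolong_subst m n (Poly_Mapping.single t u)) = prolong_subst m n (Poly_Mapping.single t (\<mu> u))"
    if t: "Poly_Mapping.keys t \<subseteq> mat_vars (m * (n + 1))" for t u
  proof -
    have s1: "Poly_Mapping.single t 1 \<in> pol_over F (mat_vars (m * (n + 1)))"
      by (rule pol_over_single[OF subring is_subringD(2)[OF subring] t])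
    have c: "Poly_Mapping.single t u = Const u * Poly_Mapping.map \<iota> (Poly_Mapping.single t 1)"
      by (simp add: Const_def map_single \<iota> mult_single)
    have c': "Poly_Mapping.single t (\<mu> u) = Const (\<mu> u) * Poly_Mapping.single t 1"
      by (simp add: Const_def mult_single)
    have "prolong_subst m n (Poly_Mapping.single t u) = Const u * Poly_Mapping.map \<iota> (prolong_subst m n (Poly_Mapping.single t 1))"
      by (simp add: c s.hom_mult map_prolong_subst[OF s1])
    then show ?thesis
      using map_flinear_mult[OF \<mu> prolong_subst_pol_over[OF subring s1]]
      by (simp add: c' s'.hom_mult \<mu>0)
  qed
  have e: "Poly_Mapping.map \<mu> P = (\<Sum>t\<in>Poly_Mapping.keys P. Poly_Mapping.single t (\<mu> (Poly_Mapping.lookup P t)))"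
    by (subst mpol_expand[of P]) (simp add: map_flinear_sum[OF \<mu>] map_single \<mu>0)
  have "Poly_Mapping.map \<mu> (prolong_subst m n P) =
      (\<Sum>t\<in>Poly_Mapping.keys P. Poly_Mapping.map \<mu> (prolong_subst m n (Poly_Mapping.single t (Poly_Mapping.lookup P t))))"
    by (subst mpol_expand[of P]) (simp add: s.hom_sum map_flinear_sum[OF \<mu>])
  also have "\<dots> = prolong_subst m n (Poly_Mapping.map \<mu> P)"
    unfolding e s'.hom_sum by (intro sum.cong refl 1 pol_over_keys[OF P])
  finally show ?thesis .
qed

end

section \<open>The differential Galois group\<close>

lemma det_in_subring:
  fixes M :: "'a::comm_ring_1 mat"
  assumes "is_subring R" "M \<in> carrier_mat k k" "\<And>i j. i < k \<Longrightarrow> j < k \<Longrightarrow> M $$ (i, j) \<in> R"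
  shows "det M \<in> R"
  unfolding det_def'[OF assms(2)]
proof (rule is_subring_sum[OF assms(1)])
  fix p assume "p \<in> {p. p permutes {0..<k}}"
  then have "(\<Prod>i = 0..<k. M $$ (i, p i)) \<in> R"
    using permutes_in_image by (intro is_subring_prod assms(1,3)) fastforce+
  moreover have "(signof p :: 'a) \<in> R" for p
    using assms(1) by (auto simp: sign_def is_subringD)
  ultimately show "signof p * (\<Prod>i = 0..<k. M $$ (i, p i)) \<in> R" using is_subringD(4)[OF assms(1)] by blast
qed

text \<open>The data of the theorem in the form in which they are used: \<open>K\<close> stands for
  \<open>kC \<sigma> k\<close>, stable under \<open>\<sigma>\<close> and \<open>\<delta>\<close>,
  and \<open>X'\<close> witnesses that the generic matrix is invertible.\<close>

locale generic_solution =
  fixes \<sigma> \<delta> :: "'l::field_char_0 \<Rightarrow> 'l" and K :: "'l set" and m :: nat and A X X' :: "'l mat"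
    and \<delta>U :: "'u::field_char_0 \<Rightarrow> 'u" and \<iota> :: "'l \<Rightarrow> 'u"
  assumes \<sigma>: "comm_ring_hom \<sigma>" and \<delta>: "derivation \<delta>" and \<sigma>\<delta>: "\<And>x. \<sigma> (\<delta> x) = \<delta> (\<sigma> x)"
    and K: "is_subfield K" and fixed: "\<And>x. \<sigma> x = x \<Longrightarrow> x \<in> K"
    and \<sigma>K: "\<And>x. x \<in> K \<Longrightarrow> \<sigma> x \<in> K" and \<delta>K: "\<delta> ` K \<subseteq> K"
    and X: "X \<in> carrier_mat m m" "X' \<in> carrier_mat m m" "X * X' = 1\<^sub>m m" "X' * X = 1\<^sub>m m"
    and A: "A \<in> carrier_mat m m" "\<And>i j. i < m \<Longrightarrow> j < m \<Longrightarrow> A $$ (i, j) \<in> K"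
    and \<sigma>X: "map_mat \<sigma> X = A * X"
    and \<delta>U: "derivation \<delta>U" and \<iota>_hom: "hom_on K \<iota>" and \<iota>\<delta>: "\<And>x. x \<in> K \<Longrightarrow> \<iota> (\<delta> x) = \<delta>U (\<iota> x)"
begin

interpretation \<sigma>: comm_ring_hom \<sigma> by (rule \<sigma>)

sublocale KU: field_embedding K \<iota> by unfold_locales (rule K \<iota>_hom)+

sublocale KL: field_embedding K "id :: 'l \<Rightarrow> 'l" by unfold_locales (auto simp: K hom_on_def)

abbreviation N where "N n \<equiv> m * (n + 1)"
abbreviation V where "V n \<equiv> mat_vars (m * (n + 1))"
abbreviation DV where "DV \<equiv> dmat_vars m"

text \<open>Prolongation is multiplicative and commutes with \<open>\<sigma>\<close> because
  \<open>\<sigma>\<close> commutes with \<open>\<delta>\<close>; so the equation for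
  \<open>X\<close> turns into the system of order \<open>n\<close>.\<close>

lemma difference_system:
  "difference_system \<sigma> K (N n) (prolongation \<delta> m n X) (prolongation \<delta> m n X') (prolongation \<delta> m n A) \<iota>"
proof
  show "map_mat \<sigma> (prolongation \<delta> m n X) = prolongation \<delta> m n A * prolongation \<delta> m n X"
    using map_prolongation[OF \<sigma>, of \<delta> \<delta> X m n] \<sigma>\<delta> X(1) A(1) \<sigma>X prolongation_mult[OF \<delta> A(1) X(1)] by simp
  show "prolongation \<delta> m n A $$ (i, j) \<in> K" if "i < N n" "j < N n" for i j
    by (rule prolongation_pol[OF KU.subring \<delta>K A(2) that])
qed (use \<sigma> K \<iota>_hom fixed \<sigma>K mult_inverse_prolongation[OF \<delta>] X in \<open>auto intro!: prolongation_carrier simp del: mult_Suc_right One_nat_def add_Suc_right\<close>)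

definition C where "C = {x. \<sigma> x = x}"

definition I_diff where "I_diff = vanishing_ideal K DV (jet \<delta> (($$) X))"
definition I_mat where "I_mat n = vanishing_ideal K (V n) (($$) (prolongation \<delta> m n X))"
definition I_diff_U where "I_diff_U = extend_ideal \<iota> DV I_diff"
definition I_mat_U where "I_mat_U n = extend_ideal \<iota> (V n) (I_mat n)"
definition I_diff_L where "I_diff_L = extend_ideal (id :: 'l \<Rightarrow> 'l) DV I_diff"
definition J_mat where "J_mat n = difference_system.J \<sigma> K (N n) (prolongation \<delta> m n X) (prolongation \<delta> m n X')"

lemma I_diff_ideal: "is_ideal_in (pol_over K DV) I_diff" and I_mat_ideal: "is_ideal_in (pol_over K (V n)) (I_mat n)"
  unfolding I_diff_def I_mat_def by (rule vanishing_ideal_is_ideal[OF KU.subring])+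

lemma DV_closed: "(l, v) \<in> DV \<Longrightarrow> (Suc l, v) \<in> DV"
  by (auto simp: dmat_vars_def)

lemma prolong_subst_mem_I_diff:
  assumes "p \<in> pol_over K (V n)"
  shows "prolong_subst m n p \<in> I_diff \<longleftrightarrow> p \<in> I_mat n"
  using assms prolong_subst_pol_over[OF KU.subring assms] eval_prolong_subst[OF comm_ring_hom_id X(1) assms, of \<delta>]
  by (simp add: I_diff_def I_mat_def vanishing_ideal_def)

text \<open>Membership in an extended ideal is decided by coordinates, and these commute with
  \<open>prolong_subst\<close>. The embedding is left open, as both \<open>U\<close> and
  \<open>L\<close> occur.\<close>

lemma prolong_subst_mem_extend_I_diff:
  assumes "field_embedding K j" "Q \<in> pol_over UNIV (V n)"
  shows "prolong_subst m n Q \<in> extend_ideal j DV I_diff \<longleftrightarrow> Q \<in> extend_ideal j (V n) (I_mat n)"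
proof -
  interpret e: field_embedding K j by fact
  have "Poly_Mapping.map \<mu> (prolong_subst m n Q) \<in> I_diff \<longleftrightarrow> Poly_Mapping.map \<mu> Q \<in> I_mat n" if "flinear K j \<mu>" for \<mu>
    using e.map_flinear_prolong_subst[OF that assms(2)] prolong_subst_mem_I_diff[OF e.map_flinear_pol_over[OF that assms(2)]]
    by simp
  then show ?thesis
    unfolding e.mem_extend_ideal[OF I_diff_ideal] e.mem_extend_ideal[OF I_mat_ideal]
    using assms(2) prolong_subst_pol_over[OF is_subring_UNIV assms(2)] by blast
qed

lemma I_diff_U_mem: "Q \<in> pol_over UNIV (V n) \<Longrightarrow> prolong_subst m n Q \<in> I_diff_U \<longleftrightarrow> Q \<in> I_mat_U n"
  unfolding I_diff_U_def I_mat_U_def by (rule prolong_subst_mem_extend_I_diff[OF KU.field_embedding_axioms])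

lemma I_diff_U_pol_over: "Q \<in> I_diff_U \<Longrightarrow> Q \<in> pol_over UNIV DV"
  unfolding I_diff_U_def using is_ideal_inD(1)[OF KU.extend_ideal_is_ideal[OF I_diff_ideal]] .

lemma I_mat_U_pol_over: "Q \<in> I_mat_U n \<Longrightarrow> Q \<in> pol_over UNIV (V n)"
  unfolding I_mat_U_def using is_ideal_inD(1)[OF KU.extend_ideal_is_ideal[OF I_mat_ideal]] .

lemma I_diff_U_E:
  assumes "Q \<in> I_diff_U"
  obtains n P where "P \<in> I_mat_U n" "Q = prolong_subst m n P"
proof -
  obtain n P where P: "P \<in> pol_over UNIV (V n)" "Q = prolong_subst m n P"
    using prolong_subst_surj[OF is_subring_UNIV I_diff_U_pol_over[OF assms]] by blast
  then have "P \<in> I_mat_U n" using I_diff_U_mem assms by blast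
  then show ?thesis using that P(2) by blast
qed

lemma msubst_invariant_iff:
  assumes "M \<in> GL (N n)"
  shows "msubst (N n) M ` I_mat_U n = I_mat_U n \<longleftrightarrow> (\<forall>q\<in>J_mat n. eval_pol \<iota> (($$) M) q = 0)"
    "(\<forall>P\<in>I_mat_U n. msubst (N n) M P \<in> I_mat_U n) \<longleftrightarrow> (\<forall>q\<in>J_mat n. eval_pol \<iota> (($$) M) q = 0)"
proof -
  interpret S: difference_system \<sigma> K "N n" "prolongation \<delta> m n X" "prolongation \<delta> m n X'" "prolongation \<delta> m n A" \<iota>
    by (rule difference_system)
  have I: "I_mat_U n = S.IU" unfolding I_mat_U_def I_mat_def S.IU_def S.I_def ..
  show "msubst (N n) M ` I_mat_U n = I_mat_U n \<longleftrightarrow> (\<forall>q\<in>J_mat n. eval_pol \<iota> (($$) M) q = 0)"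
    unfolding I J_mat_def by (rule S.Galois_group_iff[OF assms])
  have "M \<in> carrier_mat (N n) (N n)" using assms by (simp add: GL_def)
  then show "(\<forall>P\<in>I_mat_U n. msubst (N n) M P \<in> I_mat_U n) \<longleftrightarrow> (\<forall>q\<in>J_mat n. eval_pol \<iota> (($$) M) q = 0)"
    unfolding I J_mat_def by (rule S.Galois_group_equations)
qed

text \<open>\<open>I_diff_U\<close> is the union of the images of the ideals
  \<open>I_mat_U n\<close>, and on these images the two substitutions correspond.\<close>

lemma dsubst_invariant_iff:
  assumes B: "B \<in> GL m"
  shows "dsubst \<delta>U m B ` I_diff_U = I_diff_U \<longleftrightarrow> (\<forall>n. msubst (N n) (prolongation \<delta>U m n B) ` I_mat_U n = I_mat_U n)"
proof
  have Bc: "B \<in> carrier_mat m m" using B by (simp add: GL_def)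
  note sub = dsubst_prolong_subst[OF \<delta>U Bc]
  {
    assume inv: "dsubst \<delta>U m B ` I_diff_U = I_diff_U"
    show "\<forall>n. msubst (N n) (prolongation \<delta>U m n B) ` I_mat_U n = I_mat_U n"
    proof
      fix n
      note G = prolongation_GL[OF \<delta>U B, of n]
      have "msubst (N n) (prolongation \<delta>U m n B) P \<in> I_mat_U n" if "P \<in> I_mat_U n" for P
      proof -
        note P = I_mat_U_pol_over[OF that]
        have "prolong_subst m n P \<in> I_diff_U" using I_diff_U_mem[OF P] that by simp
        then have "dsubst \<delta>U m B (prolong_subst m n P) \<in> I_diff_U" using inv by blast
        then show ?thesis
          unfolding sub[OF P] using I_diff_U_mem[OF msubst_pol_over[OF prolongation_carrier P]] by blast
      qed
      \<comment> \<open>A preimage under \<open>dsubst\<close> may a priori come from another order,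
        so only stability is carried over; equality follows because both are equivalent to the same
        equations.\<close>
      then show "msubst (N n) (prolongation \<delta>U m n B) ` I_mat_U n = I_mat_U n"
        using msubst_invariant_iff[OF G] by blast
    qed
  }
  assume inv: "\<forall>n. msubst (N n) (prolongation \<delta>U m n B) ` I_mat_U n = I_mat_U n"
  show "dsubst \<delta>U m B ` I_diff_U = I_diff_U"
  proof (intro equalityI subsetI)
    fix Q assume "Q \<in> dsubst \<delta>U m B ` I_diff_U"
    then obtain Q' where "Q' \<in> I_diff_U" "Q = dsubst \<delta>U m B Q'" by blast
    moreover from this(1) obtain n P where P: "P \<in> I_mat_U n" "Q' = prolong_subst m n P" by (rule I_diff_U_E)
    ultimately have "Q = prolong_subst m n (msubst (N n) (prolongation \<delta>U m n B) P)"
      using sub[OF I_mat_U_pol_over[OF P(1)]] by simp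
    moreover have "msubst (N n) (prolongation \<delta>U m n B) P \<in> I_mat_U n" using inv P(1) by blast
    ultimately show "Q \<in> I_diff_U" using I_diff_U_mem[OF I_mat_U_pol_over] by blast
  next
    fix Q assume "Q \<in> I_diff_U"
    then obtain n P where P: "P \<in> I_mat_U n" "Q = prolong_subst m n P" by (rule I_diff_U_E)
    then obtain P' where P': "P' \<in> I_mat_U n" "P = msubst (N n) (prolongation \<delta>U m n B) P'" using inv by blast
    have "Q = dsubst \<delta>U m B (prolong_subst m n P')"
      using sub[OF I_mat_U_pol_over[OF P'(1)]] P(2) P'(2) by simp
    moreover have "prolong_subst m n P' \<in> I_diff_U" using I_diff_U_mem[OF I_mat_U_pol_over] P'(1) by blast
    ultimately show "Q \<in> dsubst \<delta>U m B ` I_diff_U" by blast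
  qed
qed

section \<open>Relations of \<open>X\<^sup>-\<^sup>1 Y\<close> over the fixed field\<close>

definition T :: "(nat \<times> nat \<times> nat, 'l) mpol mat" where "T = map_mat Const X' * generic_mat m"

definition J_diff where "J_diff = {q \<in> pol_over C DV. eval_pol Const (jet (dpol_deriv \<delta>) (($$) T)) q \<in> I_diff_L}"

lemma C_K: "C \<subseteq> K" using fixed by (auto simp: C_def)

lemma C_subfield: "is_subfield C"
  by (auto simp: is_subfield_def C_def \<sigma>.hom_add \<sigma>.hom_mult \<sigma>.hom_uminus)
    (metis \<sigma> \<sigma>.hom_mult \<sigma>.hom_one \<sigma>.hom_zero inverse_unique inverse_zero right_inverse)

lemma C_subring: "is_subring C"
  using C_subfield by (rule is_subfield_imp_is_subring)

lemma \<delta>_C: "\<delta> ` C \<subseteq> C"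
  by (auto simp: C_def \<sigma>\<delta>)

sublocale CU: field_embedding C \<iota>
  by unfold_locales (use C_subfield \<iota>_hom C_K in \<open>auto simp: hom_on_def subset_iff\<close>)

lemma T_carrier: "T \<in> carrier_mat m m"
  unfolding T_def using X(2) by (intro mult_carrier_mat[of _ _ m]) auto

text \<open>The prolongation of \<open>T\<close> is the image of \<open>S.T0\<close> under
  \<open>prolong_subst\<close>, so relations of \<open>T\<close> of order \<open>n\<close>
  correspond to relations of its prolongation.\<close>

lemma prolong_subst_mem_J_diff:
  assumes p: "p \<in> pol_over C (V n)"
  shows "prolong_subst m n p \<in> J_diff \<longleftrightarrow> p \<in> J_mat n"
proof -
  interpret S: difference_system \<sigma> K "N n" "prolongation \<delta> m n X" "prolongation \<delta> m n X'" "prolongation \<delta> m n A" \<iota>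
    by (rule difference_system)
  note D = derivation_dpol_deriv[OF \<delta>]
  let ?\<phi> = "prolong_subst m n :: (nat \<times> nat, 'l) mpol \<Rightarrow> _"
  have CC: "S.C = C" by (simp add: S.C_def C_def)
  have "eval_pol Const (jet (dpol_deriv \<delta>) (($$) T)) (prolong_subst m n p) = eval_pol Const (($$) (prolongation (dpol_deriv \<delta>) m n T)) p"
    by (rule eval_prolong_subst[OF comm_ring_hom_Const T_carrier p])
  also have "prolongation (dpol_deriv \<delta>) m n T = map_mat Const (prolongation \<delta> m n X') * generic_prolongation m n"
    unfolding T_def using X(2)
    by (simp add: prolongation_mult[OF D] prolongation_generic_mat[OF \<delta>]
        map_prolongation[OF comm_ring_hom_Const, of \<delta> "dpol_deriv \<delta>"] \<delta>)
  also have "\<dots> = map_mat ?\<phi> S.T0"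
  proof -
    have 1: "map_mat ?\<phi> (map_mat Const (prolongation \<delta> m n X')) = map_mat Const (prolongation \<delta> m n X')"
      by (rule eq_matI) auto
    have 2: "map_mat ?\<phi> (mat (N n) (N n) Var) = generic_prolongation m n"
      by (rule eq_matI) (auto simp: prolong_subst_Var generic_prolongation_def)
    have "map_mat ?\<phi> S.T0 = map_mat ?\<phi> (map_mat Const (prolongation \<delta> m n X')) * map_mat ?\<phi> (mat (N n) (N n) Var)"
      unfolding S.T0_def by (rule map_mat_hom_mult[OF prolong_subst_hom, of _ "N n" "N n" _ "N n"]) (use S.\<X>(2) in auto)
    then show ?thesis by (simp only: 1 2)
  qed
  also have "eval_pol Const (($$) (map_mat ?\<phi> S.T0)) p = ?\<phi> (eval_pol Const (($$) S.T0) p)"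
    using hom_eval_mat[OF prolong_subst_hom S.T0_carrier p, of m n Const] by (simp add: o_def)
  finally have e: "eval_pol Const (jet (dpol_deriv \<delta>) (($$) T)) (prolong_subst m n p) = ?\<phi> (eval_pol Const (($$) S.T0) p)" .
  have "eval_pol Const (($$) S.T0) p \<in> pol_over UNIV (V n)"
    unfolding S.T0_def by (rule S.eval_const_mat_pol_over[OF is_subring_UNIV S.\<X>(2) _ p]) (auto simp: pol_over_Const)
  note c = prolong_subst_mem_extend_I_diff[OF KL.field_embedding_axioms this]
  have "p \<in> J_mat n \<longleftrightarrow> eval_pol Const (($$) S.T0) p \<in> extend_ideal id (V n) (I_mat n)"
    unfolding J_mat_def S.J_def CC S.IL_def S.I_def I_mat_def using p by blast
  then show ?thesis
    unfolding J_diff_def I_diff_L_def using prolong_subst_pol_over[OF C_subring p] e c by simp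
qed

lemma J_mat_pol_over: "q \<in> J_mat n \<Longrightarrow> q \<in> pol_over C (V n)"
proof -
  interpret S: difference_system \<sigma> K "N n" "prolongation \<delta> m n X" "prolongation \<delta> m n X'" "prolongation \<delta> m n A" \<iota>
    by (rule difference_system)
  show "q \<in> J_mat n \<Longrightarrow> q \<in> pol_over C (V n)" unfolding J_mat_def S.J_def S.C_def C_def by blast
qed

lemma dpol_deriv_I_diff_L:
  assumes "P \<in> I_diff_L"
  shows "dpol_deriv \<delta> P \<in> I_diff_L"
proof -
  note D = derivationD[OF derivation_dpol_deriv[OF \<delta>]] derivation_sum[OF derivation_dpol_deriv[OF \<delta>]]
  have I_diff_L: "is_ideal_in (pol_over UNIV DV) I_diff_L" unfolding I_diff_L_def by (rule KL.extend_ideal_is_ideal[OF I_diff_ideal])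
  have sub: "p \<in> I_diff_L" if "p \<in> I_diff" for p
    using KL.map_mem_extend_ideal[OF that, of DV] by (simp add: I_diff_L_def)
  have der: "dpol_deriv \<delta> p \<in> I_diff" if "p \<in> I_diff" for p
    using that dpol_deriv_pol_over[OF \<delta> KU.subring \<delta>K DV_closed, of p]
      eval_jet_dpol_deriv[OF \<delta> \<delta> comm_ring_hom_id, of "($$) X" p]
    by (auto simp: I_diff_def vanishing_ideal_def derivationD[OF \<delta>])
  obtain S p where S: "finite S" "\<And>b. p b \<in> I_diff" "P = (\<Sum>b\<in>S. Const b * Poly_Mapping.map id (p b))"
    using KL.extend_ideal_expand[OF I_diff_ideal, of P] assms by (auto simp: I_diff_L_def)
  have "dpol_deriv \<delta> P = (\<Sum>b\<in>S. Const (\<delta> b) * p b + Const b * dpol_deriv \<delta> (p b))"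
    by (simp add: S(3) D \<delta>)
  also have "\<dots> \<in> I_diff_L"
    by (intro is_ideal_in_sum[OF I_diff_L] is_ideal_inD(3,4)[OF I_diff_L] pol_over_Const sub der S(2)) auto
  finally show ?thesis .
qed

lemma J_diff_ideal: "is_ideal_in (pol_over C DV) J_diff"
proof -
  interpret e: comm_ring_hom "eval_pol Const (jet (dpol_deriv \<delta>) (($$) T))"
    by (rule eval_pol_comm_ring_hom[OF comm_ring_hom_Const])
  have I_diff_L: "is_ideal_in (pol_over UNIV DV) I_diff_L" unfolding I_diff_L_def by (rule KL.extend_ideal_is_ideal[OF I_diff_ideal])
  note R = is_subring_pol_over[OF C_subring, of DV]
  have "eval_pol Const (jet (dpol_deriv \<delta>) (($$) T)) r \<in> pol_over UNIV DV" if "r \<in> pol_over C DV" for r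
  proof (rule eval_pol_in_subring[OF is_subring_pol_over[OF is_subring_UNIV] that])
    note RU = is_subring_pol_over[OF is_subring_UNIV, of DV, where 'a = 'l]
    fix v assume "v \<in> DV"
    then obtain l i j where v: "v = (l, i, j)" "i < m" "j < m" by (auto simp: dmat_vars_def)
    have "T $$ (i, j) = (\<Sum>d<m. Const (X' $$ (i, d)) * Var (0, d, j))"
      unfolding T_def using v X(2) by (subst entry_mult_mat[of i m j]) (auto simp: generic_mat_def)
    also have "\<dots> \<in> pol_over UNIV DV"
      using v by (intro is_subring_sum[OF RU] is_subringD(4)[OF RU] pol_over_Const pol_over_Var) (auto simp: dmat_vars_def)
    finally have "T $$ (i, j) \<in> pol_over UNIV DV" .
    then have "(dpol_deriv \<delta> ^^ l) (T $$ (i, j)) \<in> pol_over UNIV DV"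
      by (induction l) (auto intro!: dpol_deriv_pol_over[OF \<delta> is_subring_UNIV] DV_closed)
    then show "jet (dpol_deriv \<delta>) (($$) T) v \<in> pol_over UNIV DV" by (simp add: jet_def v(1))
  qed (simp add: pol_over_Const)
  then show ?thesis
    by (auto simp: is_ideal_in_def J_diff_def e.hom_add e.hom_mult is_subringD[OF R] is_ideal_inD[OF I_diff_L])
qed

lemma J_diff_pol_over: "q \<in> J_diff \<Longrightarrow> q \<in> pol_over C DV"
  by (simp add: J_diff_def)

lemma dpol_deriv_J_diff: "q \<in> J_diff \<Longrightarrow> dpol_deriv \<delta> q \<in> J_diff"
  using dpol_deriv_pol_over[OF \<delta> C_subring \<delta>_C DV_closed, of q] dpol_deriv_I_diff_L
    eval_jet_dpol_deriv[OF \<delta> derivation_dpol_deriv[OF \<delta>] comm_ring_hom_Const, of "($$) T" q] \<delta>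
  by (simp add: J_diff_def)

lemma eval_\<iota>_prolong_subst:
  assumes "B \<in> carrier_mat m m" "p \<in> pol_over C (V n)"
  shows "eval_pol \<iota> (jet \<delta>U (($$) B)) (prolong_subst m n p) = eval_pol \<iota> (($$) (prolongation \<delta>U m n B)) p"
  using eval_prolong_subst[OF comm_ring_hom_id assms(1) CU.map_\<iota>_pol_over[OF assms(2)], of \<delta>U]
  by (simp add: CU.map_prolong_subst[OF assms(2), symmetric] CU.eval_map_\<iota>)

text \<open>Every element of \<open>J_diff\<close> comes from some \<open>J_mat n\<close>, so the
  equations of all orders together amount to those of \<open>J_diff\<close>.\<close>

lemma delta_Galois_group_iff:
  assumes B: "B \<in> GL m"
  shows "dsubst \<delta>U m B ` I_diff_U = I_diff_U \<longleftrightarrow> (\<forall>q\<in>J_diff. eval_pol \<iota> (jet \<delta>U (($$) B)) q = 0)"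
proof -
  have Bc: "B \<in> carrier_mat m m" using B by (simp add: GL_def)
  have "dsubst \<delta>U m B ` I_diff_U = I_diff_U \<longleftrightarrow> (\<forall>n. \<forall>p\<in>J_mat n. eval_pol \<iota> (($$) (prolongation \<delta>U m n B)) p = 0)"
    unfolding dsubst_invariant_iff[OF B] using msubst_invariant_iff(1)[OF prolongation_GL[OF \<delta>U B]] by simp
  also have "\<dots> \<longleftrightarrow> (\<forall>q\<in>J_diff. eval_pol \<iota> (jet \<delta>U (($$) B)) q = 0)"
  proof
    assume *: "\<forall>n. \<forall>p\<in>J_mat n. eval_pol \<iota> (($$) (prolongation \<delta>U m n B)) p = 0"
    show "\<forall>q\<in>J_diff. eval_pol \<iota> (jet \<delta>U (($$) B)) q = 0"
    proof
      fix q assume q: "q \<in> J_diff"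
      obtain n p where p: "p \<in> pol_over C (V n)" "q = prolong_subst m n p"
        using prolong_subst_surj[OF C_subring J_diff_pol_over[OF q]] by blast
      then have "p \<in> J_mat n" using prolong_subst_mem_J_diff q by blast
      then show "eval_pol \<iota> (jet \<delta>U (($$) B)) q = 0" using * eval_\<iota>_prolong_subst[OF Bc p(1)] p(2) by simp
    qed
  next
    assume *: "\<forall>q\<in>J_diff. eval_pol \<iota> (jet \<delta>U (($$) B)) q = 0"
    show "\<forall>n. \<forall>p\<in>J_mat n. eval_pol \<iota> (($$) (prolongation \<delta>U m n B)) p = 0"
    proof (intro allI ballI)
      fix n p assume p: "p \<in> J_mat n"
      note pC = J_mat_pol_over[OF p]
      have "prolong_subst m n p \<in> J_diff" using prolong_subst_mem_J_diff[OF pC] p by simp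
      then show "eval_pol \<iota> (($$) (prolongation \<delta>U m n B)) p = 0" using * eval_\<iota>_prolong_subst[OF Bc pC] by metis
    qed
  qed
  finally show ?thesis .
qed

text \<open>The basis theorem is applied after extension of the coefficients to \<open>U\<close>;
  the finite set found there is the image of a finite subset of \<open>J_diff\<close>.\<close>

lemma J_diff_finitely_determined:
  "\<exists>S. finite S \<and> S \<subseteq> J_diff \<and>
     (\<forall>y. (\<forall>q\<in>S. eval_pol \<iota> (jet \<delta>U y) q = 0) \<longrightarrow> (\<forall>q\<in>J_diff. eval_pol \<iota> (jet \<delta>U y) q = 0))"
proof -
  \<comment> \<open>One slot more than the number of entries, so that the shift is positive also for
    \<open>m = 0\<close>; the spare slot is filled with 0, which is compatible with
    differentiation.\<close>
  define M where "M = Suc (m * m)"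
  \<comment> \<open>Orderly numbering: \<open>n div M\<close> is the order of derivation,
    \<open>n mod M\<close> the position of the entry read row by row.\<close>
  define x :: "nat \<Rightarrow> (nat \<times> nat \<times> nat, 'u) mpol" where
    "x n = (if n mod M < m * m then Var (n div M, (n mod M) div m, (n mod M) mod m) else 0)" for n
  note D = derivationD[OF derivation_dpol_deriv[OF \<delta>U]]
  interpret Co: comm_ring_hom "Const :: 'u \<Rightarrow> (nat \<times> nat \<times> nat, 'u) mpol" by (rule comm_ring_hom_Const)
  interpret fg: delta_finitely_generated "dpol_deriv \<delta>U" "range (Const :: 'u \<Rightarrow> (nat \<times> nat \<times> nat, 'u) mpol)" x M
  proof
    show "derivation (dpol_deriv \<delta>U)" by (rule derivation_dpol_deriv[OF \<delta>U])
    show "is_subring (range (Const :: 'u \<Rightarrow> (nat \<times> nat \<times> nat, 'u) mpol))"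
      unfolding is_subring_def
      by (auto simp: image_iff simp flip: Co.hom_add Co.hom_mult Co.hom_uminus) (metis Co.hom_zero, metis Co.hom_one)
    show "dpol_deriv \<delta>U ` range Const \<subseteq> (range Const :: (nat \<times> nat \<times> nat, 'u) mpol set)" using \<delta>U by auto
    show "\<exists>c'\<in>range Const. c * c' = 1" if "c \<in> range Const" "c \<noteq> 0" for c :: "(nat \<times> nat \<times> nat, 'u) mpol"
    proof -
      obtain a where a: "c = Const a" using \<open>c \<in> range Const\<close> by blast
      moreover have "a \<noteq> 0" using \<open>c \<noteq> 0\<close> a by auto
      ultimately have "c * Const (inverse a) = 1" by (simp flip: Co.hom_mult)
      then show ?thesis by blast
    qed
    have "0 < M" by (simp add: M_def)
    then show "dpol_deriv \<delta>U (x i) = x (i + M)" for i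
      using \<delta>U by (simp add: x_def D)
    show "0 < M" by (simp add: M_def)
    show "of_nat n \<noteq> (0 :: (nat \<times> nat \<times> nat, 'u) mpol)" if "0 < n" for n
      using that by simp
  qed
  have Var_R: "Var (l, i, j) \<in> fg.R" if "i < m" "j < m" for l i j
  proof -
    have b: "i * m + j < m * m" using block_index_less[of j m i "m - 1"] that by simp
    have "i * m + j < M" using b by (simp add: M_def)
    then have "(l * M + (i * m + j)) div M = l" "(l * M + (i * m + j)) mod M = i * m + j" by simp_all
    then have "x (l * M + (i * m + j)) = Var (l, i, j)" unfolding x_def using b that by simp
    moreover have "x (l * M + (i * m + j)) \<in> fg.W (Suc (l * M + (i * m + j)))" by (rule fg.W.x) simp
    ultimately show ?thesis using fg.W_R by metis
  qed
  have R: "P \<in> fg.R" if "P \<in> pol_over UNIV DV" for P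
    using that is_subring_UNIV
  proof (induction P rule: pol_over_induct)
    case (Const c)
    then show ?case using fg.W_R[OF fg.W.base[of "Const c" 0]] by blast
  next
    case (Var v)
    then show ?case using Var_R by (auto simp: dmat_vars_def)
  qed (auto intro: is_subringD[OF fg.R_subring])
  define \<Phi> where "\<Phi> = range (\<lambda>y. eval_pol (id :: 'u \<Rightarrow> 'u) (jet \<delta>U (y :: nat \<times> nat \<Rightarrow> 'u)))"
  have "fg.finitely_determined \<Phi> (Poly_Mapping.map \<iota> ` J_diff)"
  proof (rule fg.basis_theorem)
    show "comm_ring_hom \<phi>" if "\<phi> \<in> \<Phi>" for \<phi>
      using that eval_pol_comm_ring_hom[OF comm_ring_hom_id] by (auto simp: \<Phi>_def)
    show "\<phi> (dpol_deriv \<delta>U a) = 0" if "\<phi> \<in> \<Phi>" "\<phi> a = 0" for \<phi> a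
      using that by (auto simp: \<Phi>_def eval_jet_dpol_deriv[OF \<delta>U \<delta>U comm_ring_hom_id] derivationD(3)[OF \<delta>U])
    show "Poly_Mapping.map \<iota> ` J_diff \<subseteq> fg.R" using R CU.map_\<iota>_pol_over[OF J_diff_pol_over] by blast
  qed
  then obtain S' where S': "finite S'" "S' \<subseteq> Poly_Mapping.map \<iota> ` J_diff"
    "\<forall>\<phi>\<in>\<Phi>. (\<forall>s\<in>S'. \<phi> s = 0) \<longrightarrow> (\<forall>s\<in>Poly_Mapping.map \<iota> ` J_diff. \<phi> s = 0)"
    unfolding fg.finitely_determined_def by blast
  obtain S where S: "S \<subseteq> J_diff" "finite S" "S' = Poly_Mapping.map \<iota> ` S"
    using finite_subset_image[OF S'(1,2)] by blast
  show ?thesis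
  proof (intro exI[of _ S] conjI allI impI ballI S(1,2))
    fix y q assume y: "\<forall>q\<in>S. eval_pol \<iota> (jet \<delta>U y) q = 0" and q: "q \<in> J_diff"
    have "eval_pol id (jet \<delta>U y) (Poly_Mapping.map \<iota> q) = 0"
      using S'(3) q y by (auto simp: \<Phi>_def S(3) CU.eval_map_\<iota>)
    then show "eval_pol \<iota> (jet \<delta>U y) q = 0" by (simp add: CU.eval_map_\<iota>)
  qed
qed

text \<open>\<open>n0\<close> is a common bound for the orders of the finitely many equations;
  membership at this single order already forces all of them.\<close>

lemma finite_order:
  "\<exists>n0. \<forall>B\<in>GL m. msubst (N n0) (prolongation \<delta>U m n0 B) ` I_mat_U n0 = I_mat_U n0 \<longrightarrow> dsubst \<delta>U m B ` I_diff_U = I_diff_U"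
proof -
  obtain S where S: "finite S" "S \<subseteq> J_diff"
    "\<And>y. (\<forall>q\<in>S. eval_pol \<iota> (jet \<delta>U y) q = 0) \<Longrightarrow> \<forall>q\<in>J_diff. eval_pol \<iota> (jet \<delta>U y) q = 0"
    using J_diff_finitely_determined by blast
  have "\<exists>n. \<forall>q\<in>S. \<exists>p\<in>pol_over C (V n). q = prolong_subst m n p"
    using S(1,2)
  proof (induction S rule: finite_induct)
    case (insert q S)
    then obtain a where a: "\<forall>q\<in>S. \<exists>p\<in>pol_over C (V a). q = prolong_subst m a p" by auto
    obtain b p where b: "p \<in> pol_over C (V b)" "q = prolong_subst m b p"
      using prolong_subst_surj[OF C_subring J_diff_pol_over, of q] insert.prems by auto
    have "V a \<subseteq> V (max a b)" "V b \<subseteq> V (max a b)"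
      by (intro mat_vars_mono mult_left_mono; simp)+
    then have sub: "pol_over C (V a) \<subseteq> pol_over C (V (max a b))" "pol_over C (V b) \<subseteq> pol_over C (V (max a b))"
      by (intro pol_over_mono; simp)+
    have "\<exists>p\<in>pol_over C (V (max a b)). q' = prolong_subst m (max a b) p" if q': "q' \<in> insert q S" for q'
    proof (cases "q' = q")
      case True
      have "p \<in> pol_over C (V (max a b))" using b(1) sub(2) by blast
      moreover have "q' = prolong_subst m (max a b) p"
        using True b(2) prolong_subst_mono[OF b(1), of "max a b"] by simp
      ultimately show ?thesis by blast
    next
      case False
      then have "q' \<in> S" using q' by simp
      then obtain p' where p': "p' \<in> pol_over C (V a)" "q' = prolong_subst m a p'" using a by blast
      have "p' \<in> pol_over C (V (max a b))" using p'(1) sub(1) by blast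
      moreover have "q' = prolong_subst m (max a b) p'"
        using p'(2) prolong_subst_mono[OF p'(1), of "max a b"] by simp
      ultimately show ?thesis by blast
    qed
    then show ?case by blast
  qed auto
  then obtain n where n: "\<And>q. q \<in> S \<Longrightarrow> \<exists>p\<in>pol_over C (V n). q = prolong_subst m n p" by blast
  have "dsubst \<delta>U m B ` I_diff_U = I_diff_U"
    if B: "B \<in> GL m" and inv: "msubst (N n) (prolongation \<delta>U m n B) ` I_mat_U n = I_mat_U n" for B
  proof -
    have Bc: "B \<in> carrier_mat m m" using B by (simp add: GL_def)
    have z: "\<forall>q\<in>J_mat n. eval_pol \<iota> (($$) (prolongation \<delta>U m n B)) q = 0"
      using msubst_invariant_iff(1)[OF prolongation_GL[OF \<delta>U B]] inv by blast
    have "eval_pol \<iota> (jet \<delta>U (($$) B)) q = 0" if q: "q \<in> S" for q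
    proof -
      obtain p where p: "p \<in> pol_over C (V n)" "q = prolong_subst m n p" using n[OF q] by blast
      then have "p \<in> J_mat n" using prolong_subst_mem_J_diff q S(2) by blast
      then show ?thesis using z eval_\<iota>_prolong_subst[OF Bc p(1)] p(2) by simp
    qed
    then show ?thesis unfolding delta_Galois_group_iff[OF B] using S(3) by blast
  qed
  then show ?thesis by blast
qed

text \<open>
  \<open>differentially_closed\<close> speaks of unknowns indexed by natural numbers; the entries of a matrix are
  numbered by \<open>prod_encode\<close>.
\<close>
definition renumber :: "(nat \<times> nat \<times> nat, 'u) mpol \<Rightarrow> (nat \<times> nat, 'u) mpol" where
  "renumber = eval_pol Const (\<lambda>(l, v). Var (l, prod_encode v))"

definition unnumber :: "(nat \<times> nat, 'u) mpol \<Rightarrow> (nat \<times> nat \<times> nat, 'u) mpol" where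
  "unnumber = eval_pol Const (\<lambda>(l, a). if (l, prod_decode a) \<in> DV then Var (l, prod_decode a) else 0)"

lemma renumber_hom: "comm_ring_hom renumber" and unnumber_hom: "comm_ring_hom unnumber"
  unfolding renumber_def unnumber_def by (rule eval_pol_comm_ring_hom[OF comm_ring_hom_Const])+

lemma unnumber_renumber:
  assumes "Q \<in> pol_over UNIV DV"
  shows "unnumber (renumber Q) = Q"
proof -
  have "unnumber (renumber Q) = eval_pol (unnumber \<circ> Const) (unnumber \<circ> (\<lambda>(l, v). Var (l, prod_encode v))) Q"
    unfolding renumber_def by (rule hom_eval_pol[OF unnumber_hom])
  also have "\<dots> = eval_pol Const Var Q"
    by (rule eval_pol_cong[OF assms]) (auto simp: unnumber_def)
  finally show ?thesis by simp
qed

lemma unnumber_pol_over: "unnumber P \<in> pol_over UNIV DV"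
  unfolding unnumber_def
  by (rule eval_pol_in_subring[of _ P UNIV UNIV])
    (auto simp: is_subring_pol_over pol_over_Const pol_over_Var is_subringD[OF is_subring_pol_over[OF is_subring_UNIV]])

lemma unnumber_dpol_deriv: "unnumber (dpol_deriv \<delta>U P) = dpol_deriv \<delta>U (unnumber P)"
proof (rule hom_dpol_deriv[OF \<delta>U derivation_dpol_deriv[OF \<delta>U] unnumber_hom])
  show "unnumber (Const (\<delta>U c)) = dpol_deriv \<delta>U (unnumber (Const c))" for c
    using \<delta>U by (simp add: unnumber_def)
  show "unnumber (Var (Suc l, v)) = dpol_deriv \<delta>U (unnumber (Var (l, v)))" for l v
    using \<delta>U by (auto simp: unnumber_def dmat_vars_def derivationD[OF derivation_dpol_deriv[OF \<delta>U]] split: prod.splits)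
qed

lemma eval_renumber:
  assumes "Q \<in> pol_over UNIV DV"
  shows "eval_pol id (jet \<delta>U y) (renumber Q) = eval_pol id (jet \<delta>U (($$) (mat m m (\<lambda>v. y (prod_encode v))))) Q"
proof -
  have "eval_pol id (jet \<delta>U y) (renumber Q) = eval_pol id (\<lambda>v. eval_pol id (jet \<delta>U y) ((\<lambda>(l, v). Var (l, prod_encode v)) v)) Q"
    unfolding renumber_def by (rule eval_pol_eval_pol[OF comm_ring_hom_id])
  also have "\<dots> = eval_pol id (jet \<delta>U (($$) (mat m m (\<lambda>v. y (prod_encode v))))) Q"
    by (rule eval_pol_cong[OF assms]) (auto simp: dmat_vars_def jet_def)
  finally show ?thesis .
qed

section \<open>The Nullstellensatz for the equations of the group, and density\<close>

definition J_diff_U where "J_diff_U = extend_ideal \<iota> DV J_diff"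

lemma J_diff_U_ideal: "is_ideal_in (pol_over UNIV DV) J_diff_U"
  unfolding J_diff_U_def by (rule CU.extend_ideal_is_ideal[OF J_diff_ideal])

text \<open>\<open>J_diff\<close> is closed under derivation and \<open>\<iota>\<close> commutes
  with the derivations on \<open>C\<close>, so differentiating a combination of generators stays in
  the ideal.\<close>

lemma dpol_deriv_J_diff_U:
  assumes "P \<in> J_diff_U"
  shows "dpol_deriv \<delta>U P \<in> J_diff_U"
proof -
  note D = derivationD[OF derivation_dpol_deriv[OF \<delta>U]] derivation_sum[OF derivation_dpol_deriv[OF \<delta>U]]
  obtain S p where S: "finite S" "\<And>b. p b \<in> J_diff" "P = (\<Sum>b\<in>S. Const b * Poly_Mapping.map \<iota> (p b))"
    using CU.extend_ideal_expand[OF J_diff_ideal, of P] assms by (auto simp: J_diff_U_def)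
  have \<iota>C: "\<iota> (\<delta> c) = \<delta>U (\<iota> c)" if "c \<in> C" for c using \<iota>\<delta> that C_K by blast
  have m: "Poly_Mapping.map \<iota> (p b) \<in> J_diff_U" "Poly_Mapping.map \<iota> (dpol_deriv \<delta> (p b)) \<in> J_diff_U" for b
    unfolding J_diff_U_def by (intro CU.map_mem_extend_ideal dpol_deriv_J_diff S(2))+
  have "dpol_deriv \<delta>U P = (\<Sum>b\<in>S. Const (\<delta>U b) * Poly_Mapping.map \<iota> (p b) + Const b * Poly_Mapping.map \<iota> (dpol_deriv \<delta> (p b)))"
    using map_dpol_deriv[OF \<delta> \<delta>U C_subring \<delta>_C CU.hom \<iota>C J_diff_pol_over[OF S(2)]] by (simp add: S(3) D \<delta>U)
  also have "\<dots> \<in> J_diff_U"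
    by (intro is_ideal_in_sum[OF J_diff_U_ideal] is_ideal_inD(3,4)[OF J_diff_U_ideal] pol_over_Const m) auto
  finally show ?thesis .
qed

text \<open>The coordinates of \<open>R\<close> over \<open>C\<close> lie in \<open>J_mat n\<close>,
  because coordinates commute with \<open>prolong_subst\<close>. This brings a statement about the
  differential ideal back to arbitrary points of the algebraic group.\<close>

lemma eval_eq_0_if_prolong_subst_mem_J_diff_U:
  assumes R: "R \<in> pol_over UNIV (V n)" "prolong_subst m n R \<in> J_diff_U"
    and M: "\<forall>q\<in>J_mat n. eval_pol \<iota> (($$) M) q = 0"
  shows "eval_pol id (($$) M) R = 0"
proof -
  interpret e: comm_ring_hom "eval_pol id (($$) M) :: _ \<Rightarrow> 'u" by (rule eval_pol_comm_ring_hom[OF comm_ring_hom_id])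
  obtain S \<mu> where S: "finite S" "\<And>b. flinear C \<iota> (\<mu> b)" "R = (\<Sum>b\<in>S. Const b * Poly_Mapping.map \<iota> (Poly_Mapping.map (\<mu> b) R))"
    by (rule CU.mpol_coordinates[of R]) (rule that)
  have "Poly_Mapping.map (\<mu> b) R \<in> J_mat n" for b
  proof -
    have "Poly_Mapping.map (\<mu> b) (prolong_subst m n R) \<in> J_diff"
      using R(2) S(2) unfolding J_diff_U_def CU.mem_extend_ideal[OF J_diff_ideal] by blast
    then show ?thesis
      unfolding CU.map_flinear_prolong_subst[OF S(2) R(1)]
      using prolong_subst_mem_J_diff[OF CU.map_flinear_pol_over[OF S(2) R(1)]] by blast
  qed
  then have "eval_pol id (($$) M) (Poly_Mapping.map \<iota> (Poly_Mapping.map (\<mu> b) R)) = 0" for b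
    using M by (simp add: CU.eval_map_\<iota>)
  then show ?thesis by (subst S(3)) (simp add: e.hom_sum e.hom_mult)
qed

text \<open>A prime differential ideal that contains the equations and avoids \<open>Q\<close>
  yields a solution with \<open>Q \<noteq> 0\<close> in its differential fraction field, and
  \<open>differentially_closed\<close> moves it into \<open>U\<close>. That notion admits finite
  systems only, so the equations are first cut down by the basis theorem.\<close>

lemma delta_Nullstellensatz:
  assumes dc: "differentially_closed \<delta>U"
    and Q: "Q \<in> pol_over UNIV DV" "\<And>s. Q ^ s \<notin> J_diff_U"
  shows "\<exists>B\<in>carrier_mat m m. (\<forall>q\<in>J_diff. eval_pol \<iota> (jet \<delta>U (($$) B)) q = 0) \<and> eval_pol id (jet \<delta>U (($$) B)) Q \<noteq> 0"
proof -
  obtain S where S: "finite S" "S \<subseteq> J_diff"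
    "\<And>y. (\<forall>q\<in>S. eval_pol \<iota> (jet \<delta>U y) q = 0) \<Longrightarrow> \<forall>q\<in>J_diff. eval_pol \<iota> (jet \<delta>U y) q = 0"
    using J_diff_finitely_determined by blast
  interpret r: comm_ring_hom renumber by (rule renumber_hom)
  interpret u: comm_ring_hom unnumber by (rule unnumber_hom)
  note D = derivation_dpol_deriv[OF \<delta>U]
  define J' where "J' = {P. unnumber P \<in> J_diff_U}"
  have J': "is_delta_ideal (dpol_deriv \<delta>U) J'"
    by (rule is_delta_idealI)
      (auto simp: J'_def u.hom_add u.hom_mult is_ideal_inD[OF J_diff_U_ideal] unnumber_pol_over unnumber_dpol_deriv dpol_deriv_J_diff_U)
  have g: "renumber Q ^ s \<notin> J'" for s
    using Q(2)[of s] by (simp add: J'_def u.hom_power unnumber_renumber[OF Q(1)])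
  have c0: "\<exists>c. of_nat n * c = (1 :: (nat \<times> nat, 'u) mpol)" if "0 < n" for n
    using that by (intro exI[of _ "Const (inverse (of_nat n))"]) (simp add: of_nat_eq_Const flip: Const_mult)
  obtain P where P: "is_delta_ideal (dpol_deriv \<delta>U) P" "J' \<subseteq> P" "renumber Q \<notin> P" "1 \<notin> P" "\<And>a b. a * b \<in> P \<Longrightarrow> a \<in> P \<or> b \<in> P"
    by (rule prime_delta_ideal_avoiding[OF D c0 J' g]) blast+
  interpret p: prime_delta_ideal "dpol_deriv \<delta>U" P
    by unfold_locales (use D P in auto)
  let ?S = "(\<lambda>q. renumber (Poly_Mapping.map \<iota> q)) ` S"
  have SP: "f \<in> P" if f: "f \<in> ?S" for f
  proof -
    obtain q where q: "q \<in> S" "f = renumber (Poly_Mapping.map \<iota> q)" using f by blast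
    have "q \<in> J_diff" using q S(2) by blast
    then have "f \<in> J'"
      using CU.map_mem_extend_ideal[of q J_diff DV] unnumber_renumber[OF CU.map_\<iota>_pol_over[OF J_diff_pol_over]]
      by (simp add: J'_def q(2) J_diff_U_def)
    then show ?thesis using P(2) by blast
  qed
  have ex: "\<exists>(E :: 'u ext_elem ring) D \<psi>. is_delta_field E D \<and>
            \<psi> \<in> ring_hom \<lparr>carrier = UNIV, mult = (*), one = 1, zero = 0, add = (+)\<rparr> E \<and>
            (\<forall>P. \<psi> (dpol_deriv \<delta>U P) = D (\<psi> P)) \<and>
            (\<forall>f\<in>?S. \<psi> f = \<zero>\<^bsub>E\<^esub>) \<and> \<psi> (renumber Q) \<noteq> \<zero>\<^bsub>E\<^esub>"
    using p.is_delta_field_Frac p.frac_embed_hom p.frac_embed_deriv SP P(3)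
    by (intro exI[of _ p.Frac] exI[of _ p.frac_deriv] exI[of _ p.frac_embed]) (auto simp: p.frac_embed_eq_0)
  have fin: "finite ?S" using S(1) by simp
  note dcS = dc[unfolded differentially_closed_def, THEN spec[of _ ?S], THEN spec[of _ "renumber Q"]]
  from mp[OF mp[OF dcS fin] ex] obtain y :: "nat \<Rightarrow> 'u" where
    y: "\<forall>f\<in>?S. eval_pol id (jet \<delta>U y) f = 0" "eval_pol id (jet \<delta>U y) (renumber Q) \<noteq> 0"
    by (elim exE conjE)
  define B where "B = mat m m (\<lambda>v. y (prod_encode v))"
  have "eval_pol \<iota> (jet \<delta>U (($$) B)) q = 0" if "q \<in> S" for q
  proof -
    have "q \<in> J_diff" using that S(2) by blast
    note q = CU.map_\<iota>_pol_over[OF J_diff_pol_over[OF this]]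
    show ?thesis using y(1) that eval_renumber[OF q, of y] by (simp add: B_def CU.eval_map_\<iota>)
  qed
  then have "\<forall>q\<in>J_diff. eval_pol \<iota> (jet \<delta>U (($$) B)) q = 0" using S(3) by blast
  moreover have "eval_pol id (jet \<delta>U (($$) B)) Q \<noteq> 0" using y(2) eval_renumber[OF Q(1), of y] by (simp add: B_def)
  moreover have "B \<in> carrier_mat m m" by (simp add: B_def)
  ultimately show ?thesis by blast
qed

theorem dense:
  assumes dc: "differentially_closed \<delta>U"
    and M: "M \<in> GL (N n)" "msubst (N n) M ` I_mat_U n = I_mat_U n"
    and P: "P \<in> pol_over UNIV (V n)"
    and van: "\<And>B. B \<in> GL m \<Longrightarrow> dsubst \<delta>U m B ` I_diff_U = I_diff_U \<Longrightarrow> eval_pol id (($$) (prolongation \<delta>U m n B)) P = 0"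
  shows "eval_pol id (($$) M) P = 0"
proof (rule ccontr)
  assume nz: "eval_pol id (($$) M) P \<noteq> 0"
  interpret s: comm_ring_hom "prolong_subst m n :: (nat \<times> nat, 'u) mpol \<Rightarrow> _" by (rule prolong_subst_hom)
  \<comment> \<open>The determinant factor ensures that the point produced by the Nullstellensatz
    prolongs to an invertible matrix, hence lies in \<open>GL m\<close>.\<close>
  define R where "R = det (mat (N n) (N n) Var) * P"
  have eval_R: "eval_pol id (($$) Y) R = det Y * eval_pol id (($$) Y) P" if "Y \<in> carrier_mat (N n) (N n)" for Y :: "'u mat"
  proof -
    interpret e: comm_ring_hom "eval_pol id (($$) Y) :: _ \<Rightarrow> 'u" by (rule eval_pol_comm_ring_hom[OF comm_ring_hom_id])
    show ?thesis
      unfolding R_def e.hom_mult e.hom_det[symmetric] map_mat_eval_Var[OF comm_ring_hom_id that] ..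
  qed
  have RV: "R \<in> pol_over UNIV (V n)"
    unfolding R_def using P
    by (intro pol_over_mult det_in_subring[of _ _ "N n"] is_subring_pol_over) (auto simp: mat_vars_def intro!: pol_over_Var)
  have Mz: "\<forall>q\<in>J_mat n. eval_pol \<iota> (($$) M) q = 0" using msubst_invariant_iff(1)[OF M(1)] M(2) by blast
  have "prolong_subst m n R ^ s \<notin> J_diff_U" for s
  proof
    interpret e: comm_ring_hom "eval_pol id (($$) M) :: _ \<Rightarrow> 'u" by (rule eval_pol_comm_ring_hom[OF comm_ring_hom_id])
    assume "prolong_subst m n R ^ s \<in> J_diff_U"
    then have "eval_pol id (($$) M) (R ^ s) = 0"
      using eval_eq_0_if_prolong_subst_mem_J_diff_U[OF is_subring_power[OF is_subring_pol_over[OF is_subring_UNIV] RV] _ Mz]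
      by (simp add: s.hom_power)
    then have "eval_pol id (($$) M) R = 0" by (simp add: e.hom_power)
    then show False using eval_R[of M] nz M(1) unfolding GL_iff_det by simp
  qed
  then obtain B where B: "B \<in> carrier_mat m m" "\<forall>q\<in>J_diff. eval_pol \<iota> (jet \<delta>U (($$) B)) q = 0"
    "eval_pol id (jet \<delta>U (($$) B)) (prolong_subst m n R) \<noteq> 0"
    using delta_Nullstellensatz[OF dc prolong_subst_pol_over[OF is_subring_UNIV RV]] by blast
  have e: "det (prolongation \<delta>U m n B) * eval_pol id (($$) (prolongation \<delta>U m n B)) P \<noteq> 0"
    using B(3) unfolding eval_prolong_subst[OF comm_ring_hom_id B(1) RV] eval_R[OF prolongation_carrier] .
  then have "prolongation \<delta>U m n B \<in> GL (N n)" unfolding GL_iff_det by simp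
  then have "B \<in> GL m" by (rule GL_if_prolongation_GL[OF B(1)])
  moreover from this have "dsubst \<delta>U m B ` I_diff_U = I_diff_U" using delta_Galois_group_iff B(2) by blast
  ultimately show False using van[of B] e by simp
qed

end

text \<open>The determinant of the generic matrix is a nonzero polynomial, as its value at the
  identity matrix is 1, so it cannot vanish at a generic \<open>X\<close>.\<close>

lemma delta_generic_GL:
  assumes k: "is_subring k" and X: "X \<in> carrier_mat m m" and gen: "delta_generic \<delta> k m X"
  shows "X \<in> GL m"
proof -
  let ?Y = "generic_mat m :: (nat \<times> nat \<times> nat, 'a::field) mpol mat"
  have ev: "eval_pol id x (det ?Y) = det (mat m m (\<lambda>(i, j). x (0, i, j)))" for x :: "nat \<times> nat \<times> nat \<Rightarrow> 'a"
  proof -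
    interpret e: comm_ring_hom "eval_pol id x :: _ \<Rightarrow> 'a" by (rule eval_pol_comm_ring_hom[OF comm_ring_hom_id])
    have "map_mat (eval_pol id x) ?Y = mat m m (\<lambda>(i, j). x (0, i, j))"
      by (rule eq_matI) (auto simp: generic_mat_def)
    then show ?thesis unfolding e.hom_det[symmetric] by simp
  qed
  have mX: "mat m m (\<lambda>(i, j). jet \<delta> (($$) X) (0, i, j)) = X" using X by (intro eq_matI) auto
  have m1: "mat m m (\<lambda>(i, j). (\<lambda>(l, i, j). if i = j then 1 else 0) (0::nat, i, j)) = (1\<^sub>m m :: 'a mat)"
    by (rule eq_matI) auto
  have "det ?Y \<in> pol_over k (dmat_vars m)"
    by (rule det_in_subring[of _ _ m])
      (auto simp: is_subring_pol_over k generic_mat_def dmat_vars_def intro!: pol_over_Var[OF k])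
  then have "det ?Y \<in> vanishing_ideal k (dmat_vars m) (jet \<delta> (($$) X))" if "det X = 0"
    using ev[of "jet \<delta> (($$) X)"] that unfolding mX by (simp add: vanishing_ideal_def)
  moreover have "det ?Y \<noteq> 0"
  proof
    assume "det ?Y = 0"
    then show False using ev[of "\<lambda>(l, i, j). if i = j then 1 else 0"] unfolding m1 by simp
  qed
  ultimately have "det X \<noteq> 0" using gen unfolding delta_generic_def by blast
  then show ?thesis using X by (simp add: GL_iff_det)
qed

section \<open>Stability of \<open>k C_L\<close> and assembly of the results\<close>

theorem corollary2p3:
  fixes \<sigma> \<delta> :: "'l::field_char_0 \<Rightarrow> 'l" and k :: "'l set"
    and m :: nat and A X :: "'l mat"
    and \<delta>U :: "'u::field_char_0 \<Rightarrow> 'u" and \<iota> :: "'l \<Rightarrow> 'u"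
  assumes "H = delta_Galois_group \<delta> (kC \<sigma> k) m X \<delta>U \<iota>"
    and "Hn = Galois_group \<delta> (kC \<sigma> k) m X \<iota>"
    and "is_automorphism \<sigma>" and "is_derivation \<delta>" and "\<And>x. \<sigma> (\<delta> x) = \<delta> (\<sigma> x)"
    and "is_subfield k" and "\<sigma> ` k = k" and "\<delta> ` k \<subseteq> k"
    and "rel_alg_closure (fixed_field \<sigma> k) k = fixed_field \<sigma> k"
    and "A \<in> GL_over m k"
    and "X \<in> carrier_mat m m" and "delta_generic \<delta> k m X"
    and "delta_field_generated \<delta> k X = UNIV"
    and "map_mat \<sigma> X = A * X"
    and "is_derivation \<delta>U" and "differentially_closed \<delta>U"
    and "is_delta_embedding (kC \<sigma> k) \<delta> \<delta>U \<iota>"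
  shows "(\<forall>B\<in>GL m. B \<in> H \<longleftrightarrow> (\<forall>n. prolong \<delta>U n B \<in> Hn n)) \<and>
    (\<exists>n0. \<forall>B\<in>GL m. B \<in> H \<longleftrightarrow> (\<forall>n\<in>{0..n0}. prolong \<delta>U n B \<in> Hn n)) \<and>
    (\<forall>n. prolong \<delta>U n \<in> H \<rightarrow> Hn n \<and> inj_on (prolong \<delta>U n) H \<and>
       (\<forall>B\<in>H. \<forall>C\<in>H. prolong \<delta>U n (B * C) = prolong \<delta>U n B * prolong \<delta>U n C) \<and>
       zariski_dense_in (m * (n + 1)) (prolong \<delta>U n ` H) (Hn n))"
proof -
  have \<sigma>: "comm_ring_hom \<sigma>"
    using assms(3) unfolding is_automorphism_def hom_on_UNIV[symmetric] hom_on_def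
    by (metis add_cancel_right_right)
  interpret \<sigma>: comm_ring_hom \<sigma> by (rule \<sigma>)
  define K where "K = kC \<sigma> k"
  have \<delta>: "derivation \<delta>" and \<delta>U: "derivation \<delta>U" using assms(4,15) by (simp_all add: is_derivation_eq)
  have hull_sub: "is_subfield S \<Longrightarrow> k \<subseteq> S \<Longrightarrow> fixed_field \<sigma> UNIV \<subseteq> S \<Longrightarrow> K \<subseteq> S" for S
    unfolding K_def kC_def by (rule hull_minimal) auto
  have K: "is_subfield K" unfolding K_def kC_def
    by (rule hull_in) (auto simp: is_subfield_def)
  note Ks = is_subfield_imp_is_subring[OF K]
  have kK: "k \<subseteq> K" and CK: "\<And>x. \<sigma> x = x \<Longrightarrow> x \<in> K"
    unfolding K_def kC_def using hull_subset[of "k \<union> fixed_field \<sigma> UNIV" is_subfield] by (auto simp: fixed_field_def)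
  have inv: "\<sigma> (inverse x) = inverse (\<sigma> x)" for x
  proof (cases "x = 0")
    case False
    then have "\<sigma> (inverse x) * \<sigma> x = 1" by (simp flip: \<sigma>.hom_mult)
    then show ?thesis by (metis inverse_unique mult.commute)
  qed simp
  have \<delta>inv: "\<delta> (inverse x) = - \<delta> x * (inverse x * inverse x)" for x
  proof (cases "x = 0")
    case False
    have "\<delta> x * inverse x + x * \<delta> (inverse x) = 0"
      using derivationD(2)[OF \<delta>, of x "inverse x"] derivationD(4)[OF \<delta>] False by simp
    then have "x * \<delta> (inverse x) = - (\<delta> x * inverse x)" by (simp add: eq_neg_iff_add_eq_0 add.commute)
    then show ?thesis using False by (simp add: field_simps)
  qed (simp add: derivationD[OF \<delta>])
  \<comment> \<open>By minimality of the hull: the elements with image in \<open>K\<close> form a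
    subfield containing the generators.\<close>
  have "K \<subseteq> {x. \<sigma> x \<in> K}"
  proof (rule hull_sub)
    show "is_subfield {x. \<sigma> x \<in> K}"
      using K by (auto simp: is_subfield_def \<sigma>.hom_add \<sigma>.hom_mult \<sigma>.hom_uminus inv)
    show "k \<subseteq> {x. \<sigma> x \<in> K}" using assms(7) kK by auto
    show "fixed_field \<sigma> UNIV \<subseteq> {x. \<sigma> x \<in> K}" using CK by (auto simp: fixed_field_def)
  qed
  then have \<sigma>K: "\<And>x. x \<in> K \<Longrightarrow> \<sigma> x \<in> K" by blast
  have "K \<subseteq> {x \<in> K. \<delta> x \<in> K}"
  proof (rule hull_sub)
    \<comment> \<open>The intersection with \<open>K\<close> matters: the product and quotient rules
      multiply derivatives by the elements themselves.\<close>
    show "is_subfield {x \<in> K. \<delta> x \<in> K}"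
      using K by (auto simp: is_subfield_def derivationD[OF \<delta>] \<delta>inv)
    show "k \<subseteq> {x \<in> K. \<delta> x \<in> K}" using assms(8) kK by auto
    \<comment> \<open>\<open>\<delta>\<close> preserves the fixed field, as \<open>\<sigma>\<close>
      and \<open>\<delta>\<close> commute.\<close>
    show "fixed_field \<sigma> UNIV \<subseteq> {x \<in> K. \<delta> x \<in> K}" using CK assms(5) by (auto simp: fixed_field_def)
  qed
  then have \<delta>K: "\<delta> ` K \<subseteq> K" by blast
  have \<iota>: "hom_on K \<iota>" "\<And>x. x \<in> K \<Longrightarrow> \<iota> (\<delta> x) = \<delta>U (\<iota> x)"
  proof -
    have a: "\<iota> (x + y) = \<iota> x + \<iota> y" "\<iota> (x * y) = \<iota> x * \<iota> y" if "x \<in> K" "y \<in> K" for x y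
      using assms(17) that by (auto simp: is_delta_embedding_def K_def)
    have "\<iota> 0 = 0" using a(1)[of 0 0] is_subringD(1)[OF Ks] by (simp only: add_0_left add_cancel_right_right)
    then show "hom_on K \<iota>" using a assms(17) by (simp add: hom_on_def is_delta_embedding_def)
    show "\<And>x. x \<in> K \<Longrightarrow> \<iota> (\<delta> x) = \<delta>U (\<iota> x)" using assms(17) by (simp add: is_delta_embedding_def K_def)
  qed
  have A: "A \<in> carrier_mat m m" "\<And>i j. i < m \<Longrightarrow> j < m \<Longrightarrow> A $$ (i, j) \<in> K"
  proof -
    show c: "A \<in> carrier_mat m m" using assms(10) by (simp add: GL_over_def GL_def)
    have "elements_mat A \<subseteq> K" using assms(10) kK by (auto simp only: GL_over_def)
    then show "\<And>i j. i < m \<Longrightarrow> j < m \<Longrightarrow> A $$ (i, j) \<in> K" using elements_matI[OF c] by blast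
  qed
  have "X \<in> GL m" using delta_generic_GL[OF is_subfield_imp_is_subring[OF assms(6)] assms(11,12)] .
  then obtain X' where X': "X' \<in> carrier_mat m m" "X * X' = 1\<^sub>m m" "X' * X = 1\<^sub>m m" by (rule GL_E)
  interpret g: generic_solution \<sigma> \<delta> K m A X X' \<delta>U \<iota>
    by unfold_locales (fact \<sigma> \<delta> \<delta>U assms(5,11,14) K CK \<sigma>K \<delta>K X' A \<iota>)+
  have H: "B \<in> H \<longleftrightarrow> B \<in> GL m \<and> dsubst \<delta>U m B ` g.I_diff_U = g.I_diff_U" for B
    unfolding assms(1) delta_Galois_group_def K_def[symmetric] Let_def g.I_diff_U_def g.I_diff_def by simp
  have Hn: "M \<in> Hn n \<longleftrightarrow> M \<in> GL (m * (n + 1)) \<and> msubst (m * (n + 1)) M ` g.I_mat_U n = g.I_mat_U n" for M n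
    unfolding assms(2) Galois_group_def K_def[symmetric] Let_def g.I_mat_U_def g.I_mat_def prolong_eq_prolongation[OF assms(11)] by simp
  have prol: "prolong \<delta>U n B = prolongation \<delta>U m n B" if "B \<in> GL m" for n B
    using that by (intro prolong_eq_prolongation) (simp add: GL_def)
  have 1: "B \<in> H \<longleftrightarrow> (\<forall>n. prolong \<delta>U n B \<in> Hn n)" if "B \<in> GL m" for B
    unfolding H Hn prol[OF that] using g.dsubst_invariant_iff[OF that] prolongation_GL[OF \<delta>U that] that by blast
  obtain n0 where "\<forall>B\<in>GL m. msubst (m * (n0 + 1)) (prolongation \<delta>U m n0 B) ` g.I_mat_U n0 = g.I_mat_U n0 \<longrightarrow> dsubst \<delta>U m B ` g.I_diff_U = g.I_diff_U"
    using g.finite_order ..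
  then have n0: "B \<in> H" if "B \<in> GL m" "prolong \<delta>U n0 B \<in> Hn n0" for B
    using that(2) that(1) unfolding H Hn prol[OF that(1)] by blast
  \<comment> \<open>Order \<open>n0\<close> alone forces membership; the lower orders are automatic
    for elements of \<open>H\<close>.\<close>
  have 2: "B \<in> H \<longleftrightarrow> (\<forall>n\<in>{0..n0}. prolong \<delta>U n B \<in> Hn n)" if "B \<in> GL m" for B
    using 1[OF that] n0[OF that] by auto
  have HGL: "B \<in> GL m" if "B \<in> H" for B using that H by blast
  \<comment> \<open>The upper left block of the prolongation is the matrix itself.\<close>
  have inj: "inj_on (prolong \<delta>U n) H" for n
  proof (rule inj_onI)
    fix B C assume BC: "B \<in> H" "C \<in> H" "prolong \<delta>U n B = prolong \<delta>U n C"
    then have c: "B \<in> carrier_mat m m" "C \<in> carrier_mat m m" using HGL by (auto simp: GL_def)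
    have e: "prolongation \<delta>U m n B = prolongation \<delta>U m n C" using BC HGL prol by simp
    show "B = C"
    proof (rule eq_matI)
      fix i j assume "i < dim_row C" "j < dim_col C"
      then have ij: "i < m" "j < m" using c by auto
      show "B $$ (i, j) = C $$ (i, j)"
        using prolongation_block[OF ij, of 0 n \<delta>U B] prolongation_block[OF ij, of 0 n \<delta>U C] e by simp
    qed (use c in auto)
  qed
  have mult: "prolong \<delta>U n (B * C) = prolong \<delta>U n B * prolong \<delta>U n C" if "B \<in> H" "C \<in> H" for n B C
  proof -
    have c: "B \<in> carrier_mat m m" "C \<in> carrier_mat m m" using that HGL by (auto simp: GL_def)
    show ?thesis
      by (simp only: prolong_eq_prolongation[OF c(1)] prolong_eq_prolongation[OF c(2)]
          prolong_eq_prolongation[OF mult_carrier_mat[OF c]] prolongation_mult[OF \<delta>U c])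
  qed
  have dense: "zariski_dense_in (m * (n + 1)) (prolong \<delta>U n ` H) (Hn n)" for n
    unfolding zariski_dense_in_def
  proof (intro conjI subsetI)
    show "M \<in> Hn n" if "M \<in> prolong \<delta>U n ` H" for M
      using that 1 HGL by blast
    fix M assume M: "M \<in> Hn n"
    show "M \<in> zariski_closure (m * (n + 1)) (prolong \<delta>U n ` H)"
      unfolding zariski_closure_def
    proof (intro CollectI conjI ballI impI)
      show "M \<in> GL (m * (n + 1))" using M Hn by blast
      fix P assume P: "P \<in> pol_over UNIV (mat_vars (m * (n + 1)))"
        "\<forall>M'\<in>prolong \<delta>U n ` H. eval_pol id (($$) M') P = 0"
      show "eval_pol id (($$) M) P = 0"
      proof (rule g.dense[OF assms(16)])
        show "M \<in> GL (m * (n + 1))" "msubst (m * (n + 1)) M ` g.I_mat_U n = g.I_mat_U n" using M Hn by blast+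
        show "eval_pol id (($$) (prolongation \<delta>U m n B)) P = 0"
          if "B \<in> GL m" "dsubst \<delta>U m B ` g.I_diff_U = g.I_diff_U" for B
          using P(2) that prol H by force
      qed (rule P(1))
    qed
  qed
  have emb: "prolong \<delta>U n \<in> H \<rightarrow> Hn n" for n using 1 HGL by blast
  show ?thesis using 1 2 emb inj mult dense by blast
qed

end
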